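(* Let $\mathcal{N}$ be a nest on a Hilbert space $H$. Then the hypofinite radical, the hypocompact radical and the scattered radical of the nest algebra $\mathrm{Alg}\,\mathcal{N}$ coincide: $$\mathcal{R}_{hf}(\mathrm{Alg}\,\mathcal{N})=\mathcal{R}_{hc}(\mathrm{Alg}\,\mathcal{N})=\mathcal{R}_{sc}(\mathrm{Alg}\,\mathcal{N}).$$
   Context: Hilbert spaces and Banach algebras are over $\mathbb{C}$; $\mathcal{B}(H)$ is the algebra of bounded linear operators on $H$. Ideals are two-sided, and all ideals are considered to be closed. A nest $\mathcal{N}$ on $H$ is a family of closed subspaces of $H$, totally ordered by inclusion, containing $\{0\}$ and $H$, and closed under (arbitrary) intersection and closed linear span. The nest algebra is $\mathrm{Alg}\,\mathcal{N}=\{T\in\mathcal{B}(H): T(N)\subseteq N \text{ for all } N\in\mathcal{N}\}$, a Banach algebra in the operator norm. An element $a$ of a Banach algebra $\mathcal{A}$ is compact (respectively, finite rank) if the map $M_{a,a}:\mathcal{A}\to\mathcal{A}$, $x\mapsto axa$, is a compact (respectively, finite rank) operator. A Banach algebra $\mathcal{A}$ is hypocompact (respectively, hypofinite) if every nonzero quotient $\mathcal{A}/\mathcal{J}$ by a closed ideal $\mathcal{J}$ contains a nonzero compact (respectively, nonzero finite rank) element of $\mathcal{A}/\mathcal{J}$. A Banach algebra $\mathcal{A}$ is scattered if the spectrum of every element $a\in\mathcal{A}$ is finite or countable (for a non-unital algebra, the spectrum is taken in the unitization). It is known (Shulman–Turovskii) that every Banach algebra $\mathcal{A}$ has a largest hypofinite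 closed ideal, a largest hypocompact closed ideal, and a largest scattered closed ideal (a closed ideal having the given property as a Banach algebra and containing every other such ideal). They are denoted $\mathcal{R}_{hf}(\mathcal{A})$, $\mathcal{R}_{hc}(\mathcal{A})$, $\mathcal{R}_{sc}(\mathcal{A})$ and called the hypofinite, hypocompact and scattered radical of $\mathcal{A}$, respectively. *)

theory Defs
  imports "HOL-Analysis.Analysis"
begin

section \<open>Complex Hilbert spaces\<close>

class complex_vector = real_vector +
  fixes scaleC :: "complex \<Rightarrow> 'a \<Rightarrow> 'a"  (infixr \<open>*\<^sub>C\<close> 75)
  assumes scaleC_add_right: "c *\<^sub>C (x + y) = c *\<^sub>C x + c *\<^sub>C y"
    and scaleC_add_left: "(c + d) *\<^sub>C x = c *\<^sub>C x + d *\<^sub>C x"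
    and scaleC_scaleC: "c *\<^sub>C d *\<^sub>C x = (c * d) *\<^sub>C x"
    and scaleC_one: "1 *\<^sub>C x = x"
    and scaleR_scaleC: "r *\<^sub>R x = complex_of_real r *\<^sub>C x"

global_interpretation complex_vector: vector_space "scaleC :: complex \<Rightarrow> 'a \<Rightarrow> 'a::complex_vector"
  defines csubspace = complex_vector.subspace
    and cspan = complex_vector.span
  by unfold_locales (simp_all add: scaleC_add_right scaleC_add_left scaleC_scaleC scaleC_one)

text \<open>The inner product is linear in its first argument.\<close>

class complex_inner = complex_vector + real_normed_vector +
  fixes cinner :: "'a \<Rightarrow> 'a \<Rightarrow> complex"
  assumes cinner_commute: "cinner x y = cnj (cinner y x)"
    and cinner_add_left: "cinner (x + y) z = cinner x z + cinner y z"
    and cinner_scaleC_left: "cinner (c *\<^sub>C x) y = c * cinner x y"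
    and cinner_ge_zero: "0 \<le> Re (cinner x x)"
    and cinner_eq_zero_iff: "cinner x x = 0 \<longleftrightarrow> x = 0"
    and norm_eq_sqrt_cinner: "norm x = sqrt (Re (cinner x x))"

class chilbert_space = complex_inner + banach

lemma norm_scaleC: "norm (c *\<^sub>C x) = cmod c * norm (x :: 'a::complex_inner)"
proof -
  have "cinner (c *\<^sub>C x) (c *\<^sub>C x) = c * cnj (cinner (c *\<^sub>C x) x)"
    by (metis cinner_commute cinner_scaleC_left)
  also have "\<dots> = (c * cnj c) * cnj (cinner x x)"
    by (simp add: cinner_scaleC_left)
  also have "\<dots> = of_real ((cmod c)\<^sup>2) * cinner x x"
    by (metis complex_norm_square cinner_commute)
  finally have "Re (cinner (c *\<^sub>C x) (c *\<^sub>C x)) = (cmod c)\<^sup>2 * Re (cinner x x)"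
    by simp
  then show ?thesis
    by (simp add: norm_eq_sqrt_cinner real_sqrt_mult)
qed

lemma bounded_linear_scaleC: "bounded_linear (\<lambda>x :: 'a::complex_inner. c *\<^sub>C x)"
  by (rule bounded_linear_intro[where K = "cmod c"])
    (simp_all add: scaleC_add_right scaleR_scaleC scaleC_scaleC norm_scaleC mult.commute)


section \<open>Banach algebras\<close>

text \<open>
  Ideals and quotients of a Banach algebra are treated as Banach algebras in their own right,
  so algebras have explicit carriers. A unit is not required.
\<close>

record 'a normed_algebra =
  acarrier :: "'a set"
  azero :: 'a
  aadd :: "'a \<Rightarrow> 'a \<Rightarrow> 'a"
  ascale :: "complex \<Rightarrow> 'a \<Rightarrow> 'a"
  amult :: "'a \<Rightarrow> 'a \<Rightarrow> 'a"
  anorm :: "'a \<Rightarrow> real"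

definition aminus :: "'a normed_algebra \<Rightarrow> 'a \<Rightarrow> 'a \<Rightarrow> 'a" where
  "aminus A x y = aadd A x (ascale A (-1) y)"

text \<open>
  The locale \<^locale>\<open>Metric_space\<close> asks for nonnegativity and symmetry of the distance function on
  the whole type, hence the irrelevant default value off the carrier.
\<close>

definition adist :: "'a normed_algebra \<Rightarrow> 'a \<Rightarrow> 'a \<Rightarrow> real" where
  "adist A x y = (if x \<in> acarrier A \<and> y \<in> acarrier A then anorm A (aminus A x y) else 0)"

definition atopology :: "'a normed_algebra \<Rightarrow> 'a topology" where
  "atopology A = Metric_space.mtopology (acarrier A) (adist A)"

locale banach_algebra =
  fixes A :: "'a normed_algebra" (structure)
  assumes zero_closed: "azero A \<in> acarrier A"
    and add_closed: "\<lbrakk>x \<in> acarrier A; y \<in> acarrier A\<rbrakk> \<Longrightarrow> aadd A x y \<in> acarrier A"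
    and scale_closed: "x \<in> acarrier A \<Longrightarrow> ascale A c x \<in> acarrier A"
    and mult_closed: "\<lbrakk>x \<in> acarrier A; y \<in> acarrier A\<rbrakk> \<Longrightarrow> amult A x y \<in> acarrier A"
    and add_assoc: "\<lbrakk>x \<in> acarrier A; y \<in> acarrier A; z \<in> acarrier A\<rbrakk>
      \<Longrightarrow> aadd A (aadd A x y) z = aadd A x (aadd A y z)"
    and add_commute: "\<lbrakk>x \<in> acarrier A; y \<in> acarrier A\<rbrakk> \<Longrightarrow> aadd A x y = aadd A y x"
    and add_zero: "x \<in> acarrier A \<Longrightarrow> aadd A x (azero A) = x"
    and minus_self: "x \<in> acarrier A \<Longrightarrow> aminus A x x = azero A"
    and scale_add_right: "\<lbrakk>x \<in> acarrier A; y \<in> acarrier A\<rbrakk>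
      \<Longrightarrow> ascale A c (aadd A x y) = aadd A (ascale A c x) (ascale A c y)"
    and scale_add_left: "x \<in> acarrier A
      \<Longrightarrow> ascale A (c + d) x = aadd A (ascale A c x) (ascale A d x)"
    and scale_scale: "x \<in> acarrier A \<Longrightarrow> ascale A c (ascale A d x) = ascale A (c * d) x"
    and scale_one: "x \<in> acarrier A \<Longrightarrow> ascale A 1 x = x"
    and mult_assoc: "\<lbrakk>x \<in> acarrier A; y \<in> acarrier A; z \<in> acarrier A\<rbrakk>
      \<Longrightarrow> amult A (amult A x y) z = amult A x (amult A y z)"
    and mult_add_left: "\<lbrakk>x \<in> acarrier A; y \<in> acarrier A; z \<in> acarrier A\<rbrakk>
      \<Longrightarrow> amult A (aadd A x y) z = aadd A (amult A x z) (amult A y z)"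
    and mult_add_right: "\<lbrakk>x \<in> acarrier A; y \<in> acarrier A; z \<in> acarrier A\<rbrakk>
      \<Longrightarrow> amult A x (aadd A y z) = aadd A (amult A x y) (amult A x z)"
    and mult_scale_left: "\<lbrakk>x \<in> acarrier A; y \<in> acarrier A\<rbrakk>
      \<Longrightarrow> amult A (ascale A c x) y = ascale A c (amult A x y)"
    and mult_scale_right: "\<lbrakk>x \<in> acarrier A; y \<in> acarrier A\<rbrakk>
      \<Longrightarrow> amult A x (ascale A c y) = ascale A c (amult A x y)"
    and norm_nonneg: "x \<in> acarrier A \<Longrightarrow> 0 \<le> anorm A x"
    and norm_eq_zero: "x \<in> acarrier A \<Longrightarrow> anorm A x = 0 \<longleftrightarrow> x = azero A"
    and norm_triangle: "\<lbrakk>x \<in> acarrier A; y \<in> acarrier A\<rbrakk>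
      \<Longrightarrow> anorm A (aadd A x y) \<le> anorm A x + anorm A y"
    and norm_scale: "x \<in> acarrier A \<Longrightarrow> anorm A (ascale A c x) = cmod c * anorm A x"
    and norm_mult: "\<lbrakk>x \<in> acarrier A; y \<in> acarrier A\<rbrakk>
      \<Longrightarrow> anorm A (amult A x y) \<le> anorm A x * anorm A y"
    and complete: "Metric_space.mcomplete (acarrier A) (adist A)"

definition alg_subspace :: "'a normed_algebra \<Rightarrow> 'a set \<Rightarrow> bool" where
  "alg_subspace A S \<longleftrightarrow> S \<subseteq> acarrier A \<and> azero A \<in> S \<and>
     (\<forall>x\<in>S. \<forall>y\<in>S. aadd A x y \<in> S) \<and> (\<forall>c. \<forall>x\<in>S. ascale A c x \<in> S)"

definition alg_span :: "'a normed_algebra \<Rightarrow> 'a set \<Rightarrow> 'a set" where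
  "alg_span A F = \<Inter>{S. alg_subspace A S \<and> F \<subseteq> S}"

definition closed_ideal :: "'a normed_algebra \<Rightarrow> 'a set \<Rightarrow> bool" where
  "closed_ideal A J \<longleftrightarrow> alg_subspace A J \<and>
     (\<forall>a\<in>acarrier A. \<forall>x\<in>J. amult A a x \<in> J \<and> amult A x a \<in> J) \<and>
     closedin (atopology A) J"

definition ideal_algebra :: "'a normed_algebra \<Rightarrow> 'a set \<Rightarrow> 'a normed_algebra" where
  "ideal_algebra A J = A\<lparr>acarrier := J\<rparr>"

definition acoset :: "'a normed_algebra \<Rightarrow> 'a set \<Rightarrow> 'a \<Rightarrow> 'a set" where
  "acoset A J a = aadd A a ` J"

definition quotient_algebra :: "'a normed_algebra \<Rightarrow> 'a set \<Rightarrow> 'a set normed_algebra" where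
  "quotient_algebra A J =
    \<lparr>acarrier = acoset A J ` acarrier A,
     azero = J,
     aadd = (\<lambda>X Y. \<Union>x\<in>X. \<Union>y\<in>Y. acoset A J (aadd A x y)),
     ascale = (\<lambda>c X. \<Union>x\<in>X. acoset A J (ascale A c x)),
     amult = (\<lambda>X Y. \<Union>x\<in>X. \<Union>y\<in>Y. acoset A J (amult A x y)),
     anorm = (\<lambda>X. INF x\<in>X. anorm A x)\<rparr>"


section \<open>Spectrum\<close>

definition unitization :: "'a normed_algebra \<Rightarrow> ('a \<times> complex) normed_algebra" where
  "unitization A =
    \<lparr>acarrier = acarrier A \<times> UNIV,
     azero = (azero A, 0),
     aadd = (\<lambda>(a, s) (b, t). (aadd A a b, s + t)),
     ascale = (\<lambda>c (a, s). (ascale A c a, c * s)),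
     amult = (\<lambda>(a, s) (b, t).
       (aadd A (amult A a b) (aadd A (ascale A s b) (ascale A t a)), s * t)),
     anorm = (\<lambda>(a, s). anorm A a + cmod s)\<rparr>"

definition is_unit_of :: "'a normed_algebra \<Rightarrow> 'a \<Rightarrow> bool" where
  "is_unit_of A e \<longleftrightarrow> e \<in> acarrier A \<and> (\<forall>x\<in>acarrier A. amult A e x = x \<and> amult A x e = x)"

definition unital :: "'a normed_algebra \<Rightarrow> bool" where
  "unital A \<longleftrightarrow> (\<exists>e. is_unit_of A e)"

definition aone :: "'a normed_algebra \<Rightarrow> 'a" where
  "aone A = (THE e. is_unit_of A e)"

definition ainvertible :: "'a normed_algebra \<Rightarrow> 'a \<Rightarrow> bool" where
  "ainvertible A x \<longleftrightarrow> x \<in> acarrier A \<and>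
     (\<exists>y\<in>acarrier A. amult A x y = aone A \<and> amult A y x = aone A)"

definition unital_spectrum :: "'a normed_algebra \<Rightarrow> 'a \<Rightarrow> complex set" where
  "unital_spectrum A a = {c. \<not> ainvertible A (aminus A (ascale A c (aone A)) a)}"

definition aspectrum :: "'a normed_algebra \<Rightarrow> 'a \<Rightarrow> complex set" where
  "aspectrum A a =
    (if unital A then unital_spectrum A a else unital_spectrum (unitization A) (a, 0))"


section \<open>Hypofinite, hypocompact and scattered algebras and radicals\<close>

text \<open>The operator $M_{a,a}$.\<close>

definition two_sided_mult :: "'a normed_algebra \<Rightarrow> 'a \<Rightarrow> 'a \<Rightarrow> 'a" where
  "two_sided_mult A a x = amult A (amult A a x) a"

definition compact_operator :: "'a normed_algebra \<Rightarrow> ('a \<Rightarrow> 'a) \<Rightarrow> bool" where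
  "compact_operator A T \<longleftrightarrow>
     compactin (atopology A) (atopology A closure_of (T ` {x \<in> acarrier A. anorm A x \<le> 1}))"

definition finite_rank_operator :: "'a normed_algebra \<Rightarrow> ('a \<Rightarrow> 'a) \<Rightarrow> bool" where
  "finite_rank_operator A T \<longleftrightarrow>
     (\<exists>F. finite F \<and> F \<subseteq> acarrier A \<and> T ` acarrier A \<subseteq> alg_span A F)"

definition compact_element :: "'a normed_algebra \<Rightarrow> 'a \<Rightarrow> bool" where
  "compact_element A a \<longleftrightarrow> a \<in> acarrier A \<and> compact_operator A (two_sided_mult A a)"

definition finite_rank_element :: "'a normed_algebra \<Rightarrow> 'a \<Rightarrow> bool" where
  "finite_rank_element A a \<longleftrightarrow> a \<in> acarrier A \<and> finite_rank_operator A (two_sided_mult A a)"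

definition hypocompact :: "'a normed_algebra \<Rightarrow> bool" where
  "hypocompact A \<longleftrightarrow> (\<forall>J. closed_ideal A J \<and> J \<noteq> acarrier A \<longrightarrow>
     (\<exists>a. compact_element (quotient_algebra A J) a \<and> a \<noteq> azero (quotient_algebra A J)))"

definition hypofinite :: "'a normed_algebra \<Rightarrow> bool" where
  "hypofinite A \<longleftrightarrow> (\<forall>J. closed_ideal A J \<and> J \<noteq> acarrier A \<longrightarrow>
     (\<exists>a. finite_rank_element (quotient_algebra A J) a \<and> a \<noteq> azero (quotient_algebra A J)))"

definition scattered :: "'a normed_algebra \<Rightarrow> bool" where
  "scattered A \<longleftrightarrow> (\<forall>a\<in>acarrier A. countable (aspectrum A a))"

definition is_largest_ideal ::
    "('a normed_algebra \<Rightarrow> bool) \<Rightarrow> 'a normed_algebra \<Rightarrow> 'a set \<Rightarrow> bool" where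
  "is_largest_ideal P A R \<longleftrightarrow> closed_ideal A R \<and> P (ideal_algebra A R) \<and>
     (\<forall>J. closed_ideal A J \<and> P (ideal_algebra A J) \<longrightarrow> J \<subseteq> R)"

text \<open>
  For a Banach algebra the largest ideals below exist by a theorem of Shulman and Turovskii;
  they are clearly unique.
\<close>

definition hypofinite_radical :: "'a normed_algebra \<Rightarrow> 'a set" where
  "hypofinite_radical A = (THE R. is_largest_ideal hypofinite A R)"

definition hypocompact_radical :: "'a normed_algebra \<Rightarrow> 'a set" where
  "hypocompact_radical A = (THE R. is_largest_ideal hypocompact A R)"

definition scattered_radical :: "'a normed_algebra \<Rightarrow> 'a set" where
  "scattered_radical A = (THE R. is_largest_ideal scattered A R)"


section \<open>Nest algebras\<close>

text \<open>
  In the closure conditions \<open>F\<close> may be empty; this only yields the whole space and the zero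
  subspace, which belong to the nest anyway.
\<close>

definition nest :: "'h::chilbert_space set set \<Rightarrow> bool" where
  "nest \<N> \<longleftrightarrow>
     (\<forall>N\<in>\<N>. csubspace N \<and> closed N) \<and>
     (\<forall>M\<in>\<N>. \<forall>N\<in>\<N>. M \<subseteq> N \<or> N \<subseteq> M) \<and>
     {0} \<in> \<N> \<and> UNIV \<in> \<N> \<and>
     (\<forall>F\<subseteq>\<N>. \<Inter>F \<in> \<N> \<and> closure (cspan (\<Union>F)) \<in> \<N>)"

text \<open>
  Bounded complex linear operators are those elements of the type of bounded real linear maps
  which commute with complex scalars; the norm of that type is the operator norm.
\<close>

definition bounded_operators :: "('h::chilbert_space \<Rightarrow>\<^sub>L 'h) set" where
  "bounded_operators = {T. \<forall>c x. blinfun_apply T (c *\<^sub>C x) = c *\<^sub>C blinfun_apply T x}"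

definition nest_algebra :: "'h::chilbert_space set set \<Rightarrow> ('h \<Rightarrow>\<^sub>L 'h) normed_algebra" where
  "nest_algebra \<N> =
    \<lparr>acarrier = {T \<in> bounded_operators. \<forall>N\<in>\<N>. blinfun_apply T ` N \<subseteq> N},
     azero = 0,
     aadd = (+),
     ascale = (\<lambda>c T. Blinfun (\<lambda>x. c *\<^sub>C blinfun_apply T x)),
     amult = (o\<^sub>L),
     anorm = norm\<rparr>"

lemma blinfun_apply_scaleC:
  "blinfun_apply (Blinfun (\<lambda>x. c *\<^sub>C blinfun_apply T x)) = (\<lambda>x. c *\<^sub>C blinfun_apply T x)"
  for T :: "'a::real_normed_vector \<Rightarrow>\<^sub>L 'b::complex_inner"
  by (intro bounded_linear_Blinfun_apply bounded_linear_compose[OF bounded_linear_scaleC]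
      blinfun.bounded_linear_right)


lemma closed_nest_algebra:
  assumes "nest \<N>"
  shows "closed (acarrier (nest_algebra \<N>))"
proof -
  have cl: "closed N" if "N \<in> \<N>" for N
    using assms that by (auto simp: nest_def)
  have app: "continuous_on UNIV (\<lambda>T :: 'a \<Rightarrow>\<^sub>L 'a. blinfun_apply T x)" for x :: 'a
    by (intro continuous_intros)
  have sc: "continuous_on UNIV (\<lambda>T :: 'a \<Rightarrow>\<^sub>L 'a. c *\<^sub>C blinfun_apply T x)" for c and x :: 'a
    by (rule bounded_linear.continuous_on[OF bounded_linear_scaleC app])
  have "acarrier (nest_algebra \<N>) =
      (\<Inter>c. \<Inter>x. {T. blinfun_apply T (c *\<^sub>C x) = c *\<^sub>C blinfun_apply T x}) \<inter>
      (\<Inter>N\<in>\<N>. \<Inter>x\<in>N. (\<lambda>T. blinfun_apply T x) -` N)"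
    by (auto simp: nest_algebra_def bounded_operators_def image_subset_iff)
  also have "closed \<dots>"
    by (intro closed_Int closed_INT ballI closed_Collect_eq app sc closed_vimage cl)
  finally show ?thesis .
qed

theorem banach_algebra_nest_algebra:
  assumes N: "nest \<N>"
  shows "banach_algebra (nest_algebra \<N>)"
proof -
  let ?A = "nest_algebra \<N>"
  note sc = blinfun_apply_scaleC
  have sub: "csubspace N" if "N \<in> \<N>" for N
    using N that by (auto simp: nest_def)
  have minus: "aminus ?A S T = S - T" for S T
    using sc[of "-1" T]
    by (intro blinfun_eqI) (simp add: aminus_def nest_algebra_def blinfun.bilinear_simps)
  have d: "adist ?A S T = dist S T" if "S \<in> acarrier ?A" "T \<in> acarrier ?A" for S T
    using that by (simp add: adist_def minus dist_norm) (simp add: nest_algebra_def)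
  interpret M: Metric_space "acarrier ?A" "adist ?A"
  proof
    show "0 \<le> adist ?A x y" for x y
      by (cases "x \<in> acarrier ?A \<and> y \<in> acarrier ?A") (auto simp: d, auto simp: adist_def)
    show "adist ?A x y = adist ?A y x" for x y
      by (cases "x \<in> acarrier ?A \<and> y \<in> acarrier ?A")
        (auto simp: d dist_commute, auto simp: adist_def)
  qed (auto simp: d dist_triangle)
  have comp: "M.mcomplete"
    unfolding M.mcomplete_def
  proof (intro allI impI)
    fix \<sigma> assume "M.MCauchy \<sigma>"
    then have r: "\<And>n. \<sigma> n \<in> acarrier ?A"
      and c: "\<And>e. e > 0 \<Longrightarrow> \<exists>n0. \<forall>n m. n0 \<le> n \<longrightarrow> n0 \<le> m \<longrightarrow> adist ?A (\<sigma> n) (\<sigma> m) < e"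
      by (auto simp: M.MCauchy_def)
    have "Cauchy \<sigma>"
      unfolding Cauchy_def using c by (metis d r)
    then obtain l where l: "\<sigma> \<longlonglongrightarrow> l"
      using Cauchy_convergent convergent_def by blast
    then have lA: "l \<in> acarrier ?A"
      using closed_nest_algebra[OF N] r closed_sequentially by blast
    show "\<exists>x. limitin M.mtopology \<sigma> x sequentially"
      using l lA r by (intro exI[of _ l]) (auto simp: M.limitin_metric tendsto_iff d)
  qed
  have ns: "norm (Blinfun (\<lambda>x. c *\<^sub>C blinfun_apply T x)) = cmod c * norm T" for c and T :: "'a \<Rightarrow>\<^sub>L 'a"
  proof (rule antisym)
    show le: "norm (Blinfun (\<lambda>x. c *\<^sub>C blinfun_apply T x)) \<le> cmod c * norm T" for c and T :: "'a \<Rightarrow>\<^sub>L 'a"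
      by (rule norm_blinfun_bound)
        (auto simp: sc norm_scaleC mult.assoc intro!: mult_left_mono norm_blinfun)
    show "cmod c * norm T \<le> norm (Blinfun (\<lambda>x. c *\<^sub>C blinfun_apply T x))"
    proof (cases "c = 0")
      case False
      have "T = Blinfun (\<lambda>x. inverse c *\<^sub>C blinfun_apply (Blinfun (\<lambda>x. c *\<^sub>C blinfun_apply T x)) x)"
        using False by (intro blinfun_eqI) (simp add: sc blinfun_apply_inverse)
      then have "norm T \<le> cmod (inverse c) * norm (Blinfun (\<lambda>x. c *\<^sub>C blinfun_apply T x))"
        by (metis le)
      with False show ?thesis
        by (simp add: norm_inverse norm_divide field_simps)
    qed simp
  qed
  define S :: "complex \<Rightarrow> ('a \<Rightarrow>\<^sub>L 'a) \<Rightarrow> ('a \<Rightarrow>\<^sub>L 'a)"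
    where "S c T = Blinfun (\<lambda>x. c *\<^sub>C blinfun_apply T x)" for c T
  have S: "blinfun_apply (S c T) x = c *\<^sub>C blinfun_apply T x" "ascale ?A = S"
    "norm (S c T) = cmod c * norm T" for c T x
    by (auto simp: S_def sc ns nest_algebra_def fun_eq_iff)
  have A: "aadd ?A = (+)" "amult ?A = (o\<^sub>L)" "azero ?A = 0" "anorm ?A = norm"
    and comm: "\<And>T c x. T \<in> acarrier ?A \<Longrightarrow> blinfun_apply T (c *\<^sub>C x) = c *\<^sub>C blinfun_apply T x"
    by (auto simp: nest_algebra_def bounded_operators_def)
  show ?thesis
  proof
    show "aminus ?A x x = azero ?A" for x
      by (simp add: minus) (simp add: nest_algebra_def)
    show "aadd ?A x y \<in> acarrier ?A" if "x \<in> acarrier ?A" "y \<in> acarrier ?A" for x y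
      using that complex_vector.subspace_add[OF sub]
      by (auto simp: nest_algebra_def bounded_operators_def blinfun.bilinear_simps
          complex_vector.scale_right_distrib image_subset_iff)
    show "ascale ?A c x \<in> acarrier ?A" if "x \<in> acarrier ?A" for c x
      using that complex_vector.subspace_scale[OF sub]
      by (auto simp: nest_algebra_def bounded_operators_def sc image_subset_iff mult.commute)
    show "amult ?A x y \<in> acarrier ?A" if "x \<in> acarrier ?A" "y \<in> acarrier ?A" for x y
      using that by (auto simp: nest_algebra_def bounded_operators_def image_subset_iff)
    show "azero ?A \<in> acarrier ?A"
      using complex_vector.subspace_0[OF sub]
      by (auto simp: nest_algebra_def bounded_operators_def image_subset_iff)
    show "Metric_space.mcomplete (acarrier ?A) (adist ?A)"
      by (rule comp)
    show "anorm ?A (amult ?A x y) \<le> anorm ?A x * anorm ?A y" for x y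
      by (simp add: nest_algebra_def norm_blinfun_compose)
  qed (auto simp: A S comm blinfun.bilinear_simps norm_triangle_ineq
      complex_vector.scale_right_distrib complex_vector.scale_left_distrib intro!: blinfun_eqI)
qed

end

theory Submission
  imports Defs "HOL-Complex_Analysis.Complex_Analysis"
begin

text \<open>
  A closed ideal \<open>J\<close> of the nest algebra is hypofinite, hypocompact or scattered if and only if it
  equals the closed span \<open>J\<^sub>0\<close> (below: \<open>core\<close>) of its operators of rank one and its operators of the form
  \<open>P Q (1 - P)\<close> with \<open>P\<close> the projection onto a member of the nest. So the three radicals are the largest
  elements of one and the same family of ideals, and no existence theorem is needed.

  If \<open>J = J\<^sub>0\<close>: each generator \<open>Q\<close> satisfies \<open>Q Y Q = \<phi>(Y) Q\<close> for a linear functional \<open>\<phi>\<close>, so it gives elements of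
  rank at most one in quotients of \<open>J\<close>. Moreover \<open>\<lambda> - X - Q\<close> is invertible unless \<open>\<phi>((\<lambda> - X)\<^sup>-\<^sup>1) = 1\<close>, where the left-hand
  side is holomorphic, so adding \<open>Q\<close> to \<open>X\<close> enlarges the spectrum only by countably many points off a disc.

  If \<open>b \<in> J - J\<^sub>0\<close>: interval compressions of \<open>b\<close> stay away from \<open>J\<^sub>0\<close> near some point of the nest, or
  on an atom. Hence \<open>b\<close> has large entries along an orthonormal sequence which either moves up or down the nest or lives
  on an atom, and a unilateral shift \<open>L b R\<close> with \<open>L\<close>, \<open>R\<close> in the nest algebra can be produced. It has a disc in its spectrum, and
  multiplying it by diagonal operators shows that \<open>x \<mapsto> b x b\<close> is not compact modulo \<open>J\<^sub>0\<close>.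
\<close>

section \<open>Complex Hilbert spaces: orthogonal projections\<close>

text \<open>All auxiliary operators must lie in the nest algebra, and this shapes the argument.
  Along vectors that climb the nest a shift is available in one direction only, and the inverse that
  removes the unwanted entries of \<open>b\<close> must stay in the algebra. Hence entries in the
  forbidden direction have to vanish exactly, while the other off-diagonal entries need only be
  small. For sequences that move along the nest this triangularity follows from invariance under
  \<open>b\<close>; on an atom it is built in by choosing each \<open>y j\<close> orthogonal to the
  earlier \<open>b (x i)\<close>. The large entries are located by a supremum argument at a fixed
  tolerance: approximability by \<open>core\<close> passes from two adjacent intervals to their
  union, because the corner between them is elementary and the two diagonal errors act on orthogonal
  spaces. What obstructs at the supremum is a limit from below, a limit from above, or a gap in the
  nest. On the spectral side, countability survives each perturbation because removing a countable
  set does not disconnect the exterior of a disc, so the identity theorem applies there.\<close>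

lemmas csubspace_0 = complex_vector.subspace_0
  and csubspace_add = complex_vector.subspace_add
  and csubspace_diff = complex_vector.subspace_diff
  and csubspace_scale = complex_vector.subspace_scale

lemma cinner_add_right: "cinner x (y + z) = cinner x y + cinner x (z::'a::complex_inner)"
  by (metis cinner_commute cinner_add_left complex_cnj_add)

lemma cinner_scaleC_right: "cinner x (c *\<^sub>C y) = cnj c * cinner x (y::'a::complex_inner)"
  by (metis cinner_commute cinner_scaleC_left complex_cnj_mult)

lemma cinner_scaleR_left: "cinner (r *\<^sub>R x) y = of_real r * cinner x (y::'a::complex_inner)"
  by (simp add: scaleR_scaleC cinner_scaleC_left)

lemma cinner_scaleR_right: "cinner x (r *\<^sub>R y) = of_real r * cinner x (y::'a::complex_inner)"
  by (simp add: scaleR_scaleC cinner_scaleC_right)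

lemma cinner_zero [simp]: "cinner 0 x = 0" "cinner x (0::'a::complex_inner) = 0"
  using cinner_scaleR_left[of 0 x x] cinner_scaleR_right[of x 0 x] by simp_all

lemma cinner_minus_left: "cinner (- x) y = - cinner x (y::'a::complex_inner)"
  using cinner_scaleR_left[of "-1" x y] by simp

lemma cinner_minus_right: "cinner x (- y) = - cinner x (y::'a::complex_inner)"
  using cinner_scaleR_right[of x "-1" y] by simp

lemma cinner_diff_left: "cinner (x - y) z = cinner x z - cinner y (z::'a::complex_inner)"
  using cinner_add_left[of x "-y" z] by (simp add: cinner_minus_left)

lemma cinner_diff_right: "cinner x (y - z) = cinner x y - cinner x (z::'a::complex_inner)"
  using cinner_add_right[of x y "-z"] by (simp add: cinner_minus_right)

lemma cinner_sum_left: "cinner (sum f F) z = (\<Sum>i\<in>F. cinner (f i) (z::'a::complex_inner))"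
  by (induction F rule: infinite_finite_induct) (auto simp: cinner_add_left)

lemma cinner_sum_right: "cinner z (sum f F) = (\<Sum>i\<in>F. cinner z (f i::'a::complex_inner))"
  by (induction F rule: infinite_finite_induct) (auto simp: cinner_add_right)

lemmas cinner_simps = cinner_add_left cinner_add_right cinner_scaleC_left cinner_scaleC_right
  cinner_diff_left cinner_diff_right cinner_minus_left cinner_minus_right

lemma cinner_self: "cinner x x = of_real ((norm (x::'a::complex_inner))\<^sup>2)"
proof -
  have "Im (cinner x x) = 0"
    using cinner_commute[of x x] by (metis complex_cnj_cancel_iff Reals_cnj_iff complex_is_Real_iff)
  moreover have "Re (cinner x x) = (norm x)\<^sup>2"
    by (simp add: norm_eq_sqrt_cinner cinner_ge_zero)
  ultimately show ?thesis
    by (simp add: complex_eq_iff)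
qed

lemma norm_add_orthogonal:
  assumes "cinner x (y::'a::complex_inner) = 0"
  shows "(norm (x + y))\<^sup>2 = (norm x)\<^sup>2 + (norm y)\<^sup>2"
proof -
  have "cinner y x = 0"
    using assms cinner_commute[of y x] by simp
  then have "cinner (x + y) (x + y) = cinner x x + cinner y y"
    using assms by (simp add: cinner_simps)
  then have "complex_of_real ((norm (x + y))\<^sup>2) = of_real ((norm x)\<^sup>2 + (norm y)\<^sup>2)"
    by (simp add: cinner_self)
  then show ?thesis
    using of_real_eq_iff by blast
qed

lemma parallelogram:
  "(norm (x + y))\<^sup>2 + (norm (x - y))\<^sup>2 = 2 * (norm x)\<^sup>2 + 2 * (norm (y::'a::complex_inner))\<^sup>2"
proof -
  have "cinner (x + y) (x + y) + cinner (x - y) (x - y) = 2 * cinner x x + 2 * cinner y y"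
    by (simp add: cinner_simps)
  then have "complex_of_real ((norm (x + y))\<^sup>2 + (norm (x - y))\<^sup>2) = of_real (2 * (norm x)\<^sup>2 + 2 * (norm y)\<^sup>2)"
    by (simp add: cinner_self)
  then show ?thesis
    using of_real_eq_iff by blast
qed

lemma Cauchy_Schwarz: "cmod (cinner x y) \<le> norm x * norm (y::'a::complex_inner)"
proof (cases "y = 0")
  case False
  define c where "c = cinner x y / cinner y y"
  have yy: "cinner y y \<noteq> 0" using False cinner_eq_zero_iff by blast
  have "cinner (x - c *\<^sub>C y) (c *\<^sub>C y) = 0"
    using yy by (simp add: cinner_simps c_def)
  from norm_add_orthogonal[OF this] have "(norm (c *\<^sub>C y))\<^sup>2 \<le> (norm x)\<^sup>2"
    by simp
  then have "cmod c * norm y \<le> norm x"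
    by (simp add: norm_scaleC)
  moreover have "cmod c = cmod (cinner x y) / (norm y)\<^sup>2"
    by (simp add: c_def cinner_self norm_divide norm_power)
  ultimately show ?thesis
    using False by (simp add: field_simps power2_eq_square)
qed simp

lemma bounded_bilinear_cinner: "bounded_bilinear (cinner :: 'a::complex_inner \<Rightarrow> _)"
proof
  show "\<exists>K. \<forall>a b::'a. norm (cinner a b) \<le> norm a * norm b * K"
    using Cauchy_Schwarz by (intro exI[of _ 1]) auto
qed (simp_all add: cinner_simps cinner_scaleR_left cinner_scaleR_right scaleR_conv_of_real)

lemmas tendsto_cinner = bounded_bilinear.tendsto[OF bounded_bilinear_cinner]
lemmas bounded_linear_cinner_left = bounded_bilinear.bounded_linear_left[OF bounded_bilinear_cinner]
lemmas bounded_linear_cinner_right = bounded_bilinear.bounded_linear_right[OF bounded_bilinear_cinner]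

definition orthocomp :: "'a::complex_inner set \<Rightarrow> 'a set" where
  "orthocomp K = {x. \<forall>u\<in>K. cinner x u = 0}"

lemma csubspace_orthocomp: "csubspace (orthocomp K)"
  by (auto simp: orthocomp_def complex_vector.subspace_def cinner_simps)

lemma closed_orthocomp: "closed (orthocomp K)"
proof -
  have "orthocomp K = (\<Inter>u\<in>K. {x. cinner x u = 0})" by (auto simp: orthocomp_def)
  also have "closed \<dots>"
    by (intro closed_INT ballI closed_Collect_eq linear_continuous_on bounded_linear_cinner_left continuous_on_const)
  finally show ?thesis .
qed

lemma orthocompD: "x \<in> orthocomp K \<Longrightarrow> u \<in> K \<Longrightarrow> cinner x u = 0"
  "x \<in> orthocomp K \<Longrightarrow> u \<in> K \<Longrightarrow> cinner u x = 0"
  unfolding orthocomp_def using cinner_commute[of u x] by auto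

lemma orthocompI: "(\<And>u. u \<in> K \<Longrightarrow> cinner x u = 0) \<Longrightarrow> x \<in> orthocomp K"
  by (simp add: orthocomp_def)

lemma orthocomp_anti: "K \<subseteq> L \<Longrightarrow> orthocomp L \<subseteq> orthocomp K"
  by (auto simp: orthocomp_def)

lemma orthocomp_Int_self: "x \<in> K \<Longrightarrow> x \<in> orthocomp K \<Longrightarrow> x = 0"
  using orthocompD(1) cinner_eq_zero_iff by blast

lemma csubspace_Int: "csubspace K \<Longrightarrow> csubspace L \<Longrightarrow> csubspace (K \<inter> L)"
  by (rule complex_vector.subspace_inter)

lemma csubspace_closure:
  fixes K :: "'a::{complex_vector, real_normed_vector} set"
  assumes "csubspace K" and bl: "\<And>c. bounded_linear (\<lambda>x :: 'a. c *\<^sub>C x)"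
  shows "csubspace (closure K)"
  unfolding complex_vector.subspace_def
proof (intro conjI ballI allI)
  show "0 \<in> closure K"
    using assms closure_subset csubspace_0 by blast
  fix x assume "x \<in> closure K"
  then obtain f where f: "\<And>n. f n \<in> K" "f \<longlonglongrightarrow> x" by (auto simp: closure_sequential)
  show "c *\<^sub>C x \<in> closure K" for c
    unfolding closure_sequential
    using f csubspace_scale[OF assms(1)]
    by (intro exI[of _ "\<lambda>n. c *\<^sub>C f n"]) (auto intro: bounded_linear.tendsto[OF bl])
  fix y assume "y \<in> closure K"
  then obtain g where g: "\<And>n. g n \<in> K" "g \<longlonglongrightarrow> y" by (auto simp: closure_sequential)
  show "x + y \<in> closure K"
    unfolding closure_sequential
    using f g csubspace_add[OF assms(1)]
    by (intro exI[of _ "\<lambda>n. f n + g n"]) (auto intro: tendsto_add)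
qed

text \<open>A minimizing sequence is Cauchy by the parallelogram law, since midpoints stay in
  \<open>K\<close> and so have distance at least \<open>d\<close> from \<open>x\<close>; minimality
  then makes the residual orthogonal to \<open>K\<close>.\<close>

lemma projection_exists:
  fixes K :: "'a::chilbert_space set"
  assumes K: "csubspace K" "closed K"
  shows "\<exists>p\<in>K. x - p \<in> orthocomp K"
proof -
  define d where "d = infdist x K"
  have K0: "K \<noteq> {}" using csubspace_0[OF K(1)] by auto
  have dle: "d \<le> norm (x - u)" if "u \<in> K" for u
    using infdist_le[OF that, of x] by (simp add: d_def dist_norm)
  have d0: "0 \<le> d" by (simp add: d_def infdist_nonneg)
  have "\<exists>u\<in>K. norm (x - u) < d + 1 / (n + 1)" for n :: nat
  proof -
    have "d < d + 1 / (n + 1)" by simp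
    then have "(INF a\<in>K. dist x a) < d + 1 / (n + 1)"
      unfolding d_def infdist_notempty[OF K0, symmetric] .
    moreover have "bdd_below (dist x ` K)"
      by (rule bdd_belowI2[of _ 0]) simp
    ultimately show ?thesis
      using cINF_less_iff[of K "dist x" "d + 1 / (n+1)"] K0
      by (auto simp: dist_norm)
  qed
  then obtain u where u: "\<And>n::nat. u n \<in> K" "\<And>n. norm (x - u n) < d + 1 / real (n + 1)" by metis
  have lim: "(\<lambda>n. (norm (x - u n))\<^sup>2) \<longlonglongrightarrow> d\<^sup>2"
  proof (rule tendsto_power, rule real_tendsto_sandwich)
    show "\<forall>\<^sub>F n in sequentially. d \<le> norm (x - u n)" using dle u by auto
    show "\<forall>\<^sub>F n in sequentially. norm (x - u n) \<le> d + 1 / (real n + 1)"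
      using u(2) by (intro always_eventually) (simp add: less_imp_le add.commute)
    show "(\<lambda>n. d + 1 / (real n + 1)) \<longlonglongrightarrow> d"
      using tendsto_add[OF tendsto_const LIMSEQ_inverse_real_of_nat, of d]
      by (simp add: inverse_eq_divide add.commute)
  qed simp
  have est: "(norm (u m - u n))\<^sup>2 \<le> 2 * ((norm (x - u m))\<^sup>2 - d\<^sup>2) + 2 * ((norm (x - u n))\<^sup>2 - d\<^sup>2)" for m n
  proof -
    have mid: "(1/2) *\<^sub>R (u m + u n) \<in> K"
      unfolding scaleR_scaleC
      by (intro csubspace_scale[OF K(1)] csubspace_add[OF K(1)] u)
    have "(x - u m) + (x - u n) = 2 *\<^sub>R (x - (1/2) *\<^sub>R (u m + u n))"
      by (simp add: algebra_simps scaleR_2)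
    then have "norm ((x - u m) + (x - u n)) = 2 * norm (x - (1/2) *\<^sub>R (u m + u n))"
      by simp
    then have "(norm ((x - u m) + (x - u n)))\<^sup>2 \<ge> 4 * d\<^sup>2"
      using dle[OF mid] d0 by (simp add: power_mult_distrib power_mono)
    moreover have "norm ((x - u m) - (x - u n)) = norm (u m - u n)"
      by (simp add: norm_minus_commute)
    ultimately show ?thesis
      using parallelogram[of "x - u m" "x - u n"] by simp
  qed
  have "Cauchy u"
  proof (rule metric_CauchyI)
    fix e :: real assume e: "e > 0"
    then have "\<forall>\<^sub>F n in sequentially. (norm (x - u n))\<^sup>2 < d\<^sup>2 + e\<^sup>2 / 4"
      by (intro order_tendstoD[OF lim]) simp
    then obtain M where M: "\<And>n. n \<ge> M \<Longrightarrow> (norm (x - u n))\<^sup>2 < d\<^sup>2 + e\<^sup>2 / 4"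
      by (auto simp: eventually_sequentially)
    have "dist (u m) (u n) < e" if "m \<ge> M" "n \<ge> M" for m n
    proof -
      have "(norm (u m - u n))\<^sup>2 < e\<^sup>2"
        using est[of m n] M[OF that(1)] M[OF that(2)] by argo
      then show ?thesis
        using e by (simp add: dist_norm power2_less_imp_less)
    qed
    then show "\<exists>M. \<forall>m\<ge>M. \<forall>n\<ge>M. dist (u m) (u n) < e" by blast
  qed
  then obtain p where p: "u \<longlonglongrightarrow> p" using Cauchy_convergent convergent_def by blast
  have pK: "p \<in> K" using K(2) u(1) p closed_sequentially by blast
  have "(\<lambda>n. (norm (x - u n))\<^sup>2) \<longlonglongrightarrow> (norm (x - p))\<^sup>2"
    by (intro tendsto_intros p)
  then have np: "(norm (x - p))\<^sup>2 = d\<^sup>2" using lim LIMSEQ_unique by blast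
  have "cinner (x - p) v = 0" if v: "v \<in> K" for v
  proof (cases "v = 0")
    case False
    \<comment> \<open>Moving \<open>p\<close> by the component of the residual along
      \<open>v\<close> would lower the distance unless that component is zero.\<close>
    define c where "c = cinner (x - p) v / cinner v v"
    have vv: "cinner v v \<noteq> 0" using False cinner_eq_zero_iff by blast
    have "p + c *\<^sub>C v \<in> K"
      by (intro csubspace_add[OF K(1)] csubspace_scale[OF K(1)] pK v)
    then have 1: "d\<^sup>2 \<le> (norm (x - p - c *\<^sub>C v))\<^sup>2"
      using dle[of "p + c *\<^sub>C v"] d0 by (simp add: diff_diff_eq power_mono)
    have "cinner (x - p - c *\<^sub>C v) (c *\<^sub>C v) = 0"
      using vv by (simp add: cinner_simps c_def)
    from norm_add_orthogonal[OF this] have "(norm (x - p))\<^sup>2 = (norm (x - p - c *\<^sub>C v))\<^sup>2 + (norm (c *\<^sub>C v))\<^sup>2"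
      by simp
    then have "norm (c *\<^sub>C v) = 0"
      using 1 np by simp
    then show ?thesis using vv by (auto simp: norm_scaleC c_def False)
  qed simp
  then show ?thesis using pK orthocompI by blast
qed

lemma projection_unique:
  assumes "csubspace K" "p \<in> K" "x - p \<in> orthocomp K" "q \<in> K" "x - q \<in> orthocomp K"
  shows "p = q"
proof -
  have "p - q \<in> K" using assms by (simp add: csubspace_diff)
  moreover have "(x - q) - (x - p) \<in> orthocomp K"
    by (rule csubspace_diff[OF csubspace_orthocomp assms(5,3)])
  ultimately show ?thesis
    using orthocomp_Int_self by fastforce
qed

definition proj_fun :: "'a::chilbert_space set \<Rightarrow> 'a \<Rightarrow> 'a" where
  "proj_fun K x = (THE p. p \<in> K \<and> x - p \<in> orthocomp K)"

definition proj :: "'a::chilbert_space set \<Rightarrow> 'a \<Rightarrow>\<^sub>L 'a" where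
  "proj K = Blinfun (proj_fun K)"

context
  fixes K :: "'a::chilbert_space set"
  assumes K: "csubspace K" "closed K"
begin

lemma proj_fun: "proj_fun K x \<in> K" "x - proj_fun K x \<in> orthocomp K"
proof -
  have "\<exists>!p. p \<in> K \<and> x - p \<in> orthocomp K"
    using projection_exists[OF K] projection_unique[OF K(1)] by blast
  from theI'[OF this] show "proj_fun K x \<in> K" "x - proj_fun K x \<in> orthocomp K"
    by (auto simp: proj_fun_def)
qed

lemma proj_fun_eq: "p \<in> K \<Longrightarrow> x - p \<in> orthocomp K \<Longrightarrow> proj_fun K x = p"
  using projection_unique[OF K(1)] proj_fun by blast

lemma norm_proj_fun_Pythagoras: "(norm x)\<^sup>2 = (norm (proj_fun K x))\<^sup>2 + (norm (x - proj_fun K x))\<^sup>2"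
  using norm_add_orthogonal[OF orthocompD(2)[OF proj_fun(2) proj_fun(1)], of x x] by simp

lemma bounded_linear_proj_fun: "bounded_linear (proj_fun K)"
proof (rule bounded_linear_intro[where K = 1])
  show "proj_fun K (x + y) = proj_fun K x + proj_fun K y" for x y
  proof (rule proj_fun_eq)
    show "proj_fun K x + proj_fun K y \<in> K"
      using proj_fun K csubspace_add by blast
    have "(x - proj_fun K x) + (y - proj_fun K y) \<in> orthocomp K"
      using proj_fun csubspace_orthocomp csubspace_add by blast
    then show "x + y - (proj_fun K x + proj_fun K y) \<in> orthocomp K"
      by (simp add: algebra_simps)
  qed
  show "proj_fun K (r *\<^sub>R x) = r *\<^sub>R proj_fun K x" for r x
    unfolding scaleR_scaleC
    by (intro proj_fun_eq csubspace_scale[OF K(1)] proj_fun)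
      (simp add: complex_vector.scale_right_diff_distrib[symmetric] csubspace_scale[OF csubspace_orthocomp] proj_fun)
  have "(norm (proj_fun K x))\<^sup>2 \<le> (norm x)\<^sup>2" for x
    using norm_proj_fun_Pythagoras[of x] by simp
  then show "norm (proj_fun K x) \<le> norm x * 1" for x
    by simp
qed

lemma proj_apply: "blinfun_apply (proj K) = proj_fun K"
  by (simp add: proj_def bounded_linear_Blinfun_apply bounded_linear_proj_fun)

lemma proj_in: "proj K x \<in> K"
  and proj_orthocomp: "x - proj K x \<in> orthocomp K"
  by (simp_all add: proj_apply proj_fun)

lemma proj_eq: "p \<in> K \<Longrightarrow> x - p \<in> orthocomp K \<Longrightarrow> proj K x = p"
  by (simp add: proj_apply proj_fun_eq)

lemma proj_id: "x \<in> K \<Longrightarrow> proj K x = x"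
  by (rule proj_eq) (auto simp: csubspace_0[OF csubspace_orthocomp])

lemma proj_zero: "x \<in> orthocomp K \<Longrightarrow> proj K x = 0"
  by (rule proj_eq) (auto simp: csubspace_0[OF K(1)])

lemma norm_proj_Pythagoras: "(norm x)\<^sup>2 = (norm (proj K x))\<^sup>2 + (norm (x - proj K x))\<^sup>2"
  unfolding proj_apply by (rule norm_proj_fun_Pythagoras)

lemma norm_proj_apply_le: "norm (proj K x) \<le> norm x"
proof -
  have "(norm (proj K x))\<^sup>2 \<le> (norm x)\<^sup>2"
    using norm_proj_Pythagoras[of x] by simp
  then show ?thesis by simp
qed

lemma proj_scaleC: "proj K (c *\<^sub>C x) = c *\<^sub>C proj K x"
  by (intro proj_eq csubspace_scale[OF K(1)] proj_in)
    (simp add: complex_vector.scale_right_diff_distrib[symmetric] csubspace_scale[OF csubspace_orthocomp] proj_orthocomp)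

lemma cinner_proj_left: "v \<in> K \<Longrightarrow> cinner (proj K x) v = cinner x v"
  using orthocompD(1)[OF proj_orthocomp, of v x] by (simp add: cinner_simps)

end

section \<open>The complex vector space of bounded operators\<close>

instantiation blinfun :: (real_normed_vector, complex_inner) complex_vector
begin

text \<open>Agrees with \<open>ascale\<close> of \<open>nest_algebra\<close>, and lets
  \<open>cspan\<close> and \<open>csubspace\<close> apply to sets of operators.\<close>

definition scaleC_blinfun :: "complex \<Rightarrow> 'a \<Rightarrow>\<^sub>L 'b \<Rightarrow> 'a \<Rightarrow>\<^sub>L 'b" where
  "scaleC_blinfun c T = Blinfun (\<lambda>x. c *\<^sub>C blinfun_apply T x)"

lemma scaleC_blinfun_apply [simp]: "blinfun_apply (c *\<^sub>C T) x = c *\<^sub>C blinfun_apply T x"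
  by (simp add: scaleC_blinfun_def blinfun_apply_scaleC)

instance
  by standard (auto intro!: blinfun_eqI simp: blinfun.bilinear_simps complex_vector.scale_right_distrib
      complex_vector.scale_left_distrib scaleR_scaleC)

end

lemma norm_scaleC_blinfun: "norm (c *\<^sub>C T) = cmod c * norm (T :: 'a::real_normed_vector \<Rightarrow>\<^sub>L 'b::complex_inner)"
proof -
  have le: "norm (c *\<^sub>C T) \<le> cmod c * norm T" for c and T :: "'a \<Rightarrow>\<^sub>L 'b"
    by (rule norm_blinfun_bound)
      (auto simp: norm_scaleC mult.assoc intro!: mult_left_mono norm_blinfun)
  show ?thesis
  proof (cases "c = 0")
    case False
    have "norm T = norm (inverse c *\<^sub>C c *\<^sub>C T)" using False by simp
    also have "\<dots> \<le> inverse (cmod c) * norm (c *\<^sub>C T)" by (metis le norm_inverse)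
    finally have "cmod c * norm T \<le> norm (c *\<^sub>C T)" using False by (simp add: field_simps)
    then show ?thesis using le[of c T] by simp
  qed simp
qed

lemma bounded_linear_scaleC_blinfun:
  "bounded_linear (\<lambda>T :: 'a::real_normed_vector \<Rightarrow>\<^sub>L 'b::complex_inner. c *\<^sub>C T)"
  by (rule bounded_linear_intro[where K = "cmod c"])
    (auto simp: complex_vector.scale_right_distrib norm_scaleC_blinfun scaleR_scaleC mult.commute)

lemma blinfun_compose_scaleC_left:
  "(c *\<^sub>C S) o\<^sub>L T = c *\<^sub>C (S o\<^sub>L T)" for S :: "'b::complex_inner \<Rightarrow>\<^sub>L 'c::complex_inner"
  by (auto intro!: blinfun_eqI)

section \<open>Orthonormal sequences and diagonal operators\<close>

definition orthonormal :: "(nat \<Rightarrow> 'a::complex_inner) \<Rightarrow> bool" where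
  "orthonormal e \<longleftrightarrow> (\<forall>i j. cinner (e i) (e j) = (if i = j then 1 else 0))"

lemma orthonormalD: "orthonormal e \<Longrightarrow> cinner (e i) (e j) = (if i = j then 1 else 0)"
  by (simp add: orthonormal_def)

lemma orthonormal_norm: "orthonormal e \<Longrightarrow> norm (e i) = 1"
  using orthonormalD[of e i i] by (simp add: norm_eq_sqrt_cinner)

lemma orthonormal_compose: "orthonormal e \<Longrightarrow> inj r \<Longrightarrow> orthonormal (\<lambda>k. e (r k))"
  by (auto simp: orthonormal_def inj_eq)

lemma norm_orthonormal_sum:
  assumes "orthonormal e" "finite F"
  shows "(norm (\<Sum>i\<in>F. a i *\<^sub>C e i))\<^sup>2 = (\<Sum>i\<in>F. (cmod (a i))\<^sup>2)"
  using assms(2)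
proof (induction F rule: finite_induct)
  case (insert j F)
  have "cinner (a j *\<^sub>C e j) (\<Sum>i\<in>F. a i *\<^sub>C e i) = 0"
    unfolding cinner_sum_right
    by (rule sum.neutral) (use insert in \<open>auto simp: cinner_simps orthonormalD[OF assms(1)]\<close>)
  then show ?case
    using insert by (simp add: norm_add_orthogonal norm_scaleC orthonormal_norm[OF assms(1)])
qed simp

lemma Bessel_finite:
  assumes "orthonormal e" "finite F"
  shows "(\<Sum>i\<in>F. (cmod (cinner z (e i)))\<^sup>2) \<le> (norm z)\<^sup>2"
proof -
  let ?s = "\<Sum>i\<in>F. cinner z (e i) *\<^sub>C e i"
  have "cinner ?s (e j) = cinner z (e j)" if "j \<in> F" for j
  proof -
    have "cinner ?s (e j) = (\<Sum>i\<in>F. if i = j then cinner z (e i) else 0)"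
      unfolding cinner_sum_left
      by (rule sum.cong) (auto simp: cinner_simps orthonormalD[OF assms(1)])
    then show ?thesis using that assms(2) by simp
  qed
  then have "cinner (z - ?s) ?s = 0"
    unfolding cinner_sum_right
    by (intro sum.neutral) (simp add: cinner_simps del: cinner_sum_left)
  from norm_add_orthogonal[OF this] have "(norm ?s)\<^sup>2 \<le> (norm z)\<^sup>2" by simp
  then show ?thesis by (simp add: norm_orthonormal_sum[OF assms])
qed

lemma summable_Bessel:
  assumes "orthonormal e"
  shows "summable (\<lambda>i. (cmod (cinner z (e i)))\<^sup>2)" and "(\<Sum>i. (cmod (cinner z (e i)))\<^sup>2) \<le> (norm z)\<^sup>2"
proof -
  have *: "(\<Sum>i<n. (cmod (cinner z (e i)))\<^sup>2) \<le> (norm z)\<^sup>2" for n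
    by (rule Bessel_finite[OF assms]) simp
  show sm: "summable (\<lambda>i. (cmod (cinner z (e i)))\<^sup>2)"
    by (rule summableI_nonneg_bounded[where x = "(norm z)\<^sup>2"]) (use * in auto)
  show "(\<Sum>i. (cmod (cinner z (e i)))\<^sup>2) \<le> (norm z)\<^sup>2"
    by (rule suminf_le_const[OF sm *])
qed

lemma le_square_if_le_mult_sqrt: "(0::real) \<le> C \<Longrightarrow> s \<le> C * sqrt s \<Longrightarrow> 0 \<le> s \<Longrightarrow> s \<le> C\<^sup>2"
proof -
  assume a: "0 \<le> C" "s \<le> C * sqrt s" "0 \<le> s"
  show ?thesis
  proof (cases "s = 0")
    case False
    then have "sqrt s > 0" using a by simp
    moreover have "sqrt s * sqrt s \<le> C * sqrt s" using a by simp
    ultimately have "sqrt s \<le> C" by (simp only: mult_le_cancel_right_pos)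
    then have "(sqrt s)\<^sup>2 \<le> C\<^sup>2" using a by (intro power_mono) auto
    then show ?thesis using a by simp
  qed simp
qed

lemma tendsto_square_summable:
  assumes "summable (\<lambda>i. (cmod (f i))\<^sup>2)"
  shows "f \<longlonglongrightarrow> 0"
proof -
  have "(\<lambda>i. sqrt ((cmod (f i))\<^sup>2)) \<longlonglongrightarrow> sqrt 0"
    by (intro tendsto_real_sqrt summable_LIMSEQ_zero assms)
  then show ?thesis using tendsto_norm_zero_iff[of f] by simp
qed

lemma orthonormal_tendsto_left: "orthonormal e \<Longrightarrow> (\<lambda>i. cinner z (e i)) \<longlonglongrightarrow> 0"
  by (intro tendsto_square_summable summable_Bessel)

lemma bounded_operatorsD: "T \<in> bounded_operators \<Longrightarrow> blinfun_apply T (c *\<^sub>C x) = c *\<^sub>C blinfun_apply T x"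
  by (simp add: bounded_operators_def)

text \<open>This is Bessel's inequality for the adjoint applied to \<open>y\<close>, obtained
  without the adjoint: testing \<open>T\<close> on the finite sum \<open>z\<close> with coefficients
  conjugate to the entries gives \<open>s = \<langle>T z, y\<rangle>\<close>, hence \<open>s\<close>
  is at most \<open>norm T * norm y * sqrt s\<close>.\<close>

lemma orthonormal_image_weakly_tendsto:
  fixes T :: "'h::chilbert_space \<Rightarrow>\<^sub>L 'h"
  assumes e: "orthonormal e" and T: "T \<in> bounded_operators"
  shows "(\<lambda>i. cinner (T (e i)) y) \<longlonglongrightarrow> 0"
proof (rule tendsto_square_summable, rule summableI_nonneg_bounded)
  fix n
  let ?a = "\<lambda>i. cnj (cinner (T (e i)) y)"
  define z where "z = (\<Sum>i<n. ?a i *\<^sub>C e i)"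
  define s where "s = (\<Sum>i<n. (cmod (cinner (T (e i)) y))\<^sup>2)"
  have nz: "(norm z)\<^sup>2 = s"
    unfolding z_def s_def by (subst norm_orthonormal_sum[OF e]) auto
  have "cinner (T z) y = (\<Sum>i<n. ?a i * cinner (T (e i)) y)"
    by (simp add: z_def blinfun.sum_right cinner_sum_left bounded_operatorsD[OF T] cinner_simps)
  also have "\<dots> = of_real s"
    by (simp add: s_def mult.commute[of "cnj _"] complex_norm_square del: of_real_power)
  finally have "cmod (cinner (T z) y) = \<bar>s\<bar>"
    by (simp only: norm_of_real real_norm_def)
  then have "cmod (cinner (T z) y) = s"
    by (simp add: s_def sum_nonneg)
  moreover have "cmod (cinner (T z) y) \<le> norm T * norm z * norm y"
    by (rule order_trans[OF Cauchy_Schwarz]) (simp add: mult_right_mono norm_blinfun)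
  moreover have "norm z = sqrt s" using nz by (metis norm_ge_zero real_sqrt_unique)
  ultimately have "s \<le> (norm T * norm y) * sqrt s" by (simp add: mult_ac)
  then show "(\<Sum>i<n. (cmod (cinner (T (e i)) y))\<^sup>2) \<le> (norm T * norm y)\<^sup>2"
    unfolding s_def[symmetric] by (rule le_square_if_le_mult_sqrt[rotated]) (auto simp: s_def sum_nonneg)
qed auto

lemma summable_orthonormal:
  fixes u :: "nat \<Rightarrow> 'a::chilbert_space"
  assumes u: "orthonormal u" and a: "summable (\<lambda>k. (cmod (a k))\<^sup>2)"
  shows "summable (\<lambda>k. a k *\<^sub>C u k)" and "(norm (\<Sum>k. a k *\<^sub>C u k))\<^sup>2 = (\<Sum>k. (cmod (a k))\<^sup>2)"
proof -
  show sm: "summable (\<lambda>k. a k *\<^sub>C u k)"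
    unfolding summable_Cauchy
  proof (intro allI impI)
    fix e :: real assume "e > 0"
    then have "e\<^sup>2 > 0" by simp
    then obtain N where N: "\<And>m n. m \<ge> N \<Longrightarrow> norm (\<Sum>k\<in>{m..<n}. (cmod (a k))\<^sup>2) < e\<^sup>2"
      using a unfolding summable_Cauchy by blast
    have "norm (\<Sum>k\<in>{m..<n}. a k *\<^sub>C u k) < e" if "m \<ge> N" for m n
    proof -
      have "(norm (\<Sum>k\<in>{m..<n}. a k *\<^sub>C u k))\<^sup>2 < e\<^sup>2"
        using N[OF that, of n] by (simp add: norm_orthonormal_sum[OF u])
      then show ?thesis using \<open>e > 0\<close> by (simp add: power2_less_imp_less)
    qed
    then show "\<exists>N. \<forall>m\<ge>N. \<forall>n. norm (\<Sum>k\<in>{m..<n}. a k *\<^sub>C u k) < e" by blast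
  qed
  have "(\<lambda>n. (norm (\<Sum>k<n. a k *\<^sub>C u k))\<^sup>2) \<longlonglongrightarrow> (norm (\<Sum>k. a k *\<^sub>C u k))\<^sup>2"
    by (intro tendsto_intros summable_LIMSEQ sm)
  moreover have "(\<lambda>n. (norm (\<Sum>k<n. a k *\<^sub>C u k))\<^sup>2) \<longlonglongrightarrow> (\<Sum>k. (cmod (a k))\<^sup>2)"
    using summable_LIMSEQ[OF a] by (simp add: norm_orthonormal_sum[OF u])
  ultimately show "(norm (\<Sum>k. a k *\<^sub>C u k))\<^sup>2 = (\<Sum>k. (cmod (a k))\<^sup>2)"
    by (rule LIMSEQ_unique)
qed

text \<open>Weighted partial isometry taking \<open>v k\<close> to \<open>c k *\<^sub>C u k\<close>;
  it supplies the shifts and all maps between orthonormal sequences used below.\<close>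

definition osum :: "(nat \<Rightarrow> complex) \<Rightarrow> (nat \<Rightarrow> 'a) \<Rightarrow> (nat \<Rightarrow> 'a) \<Rightarrow> 'a::chilbert_space \<Rightarrow>\<^sub>L 'a" where
  "osum c u v = Blinfun (\<lambda>z. \<Sum>k. (c k * cinner z (v k)) *\<^sub>C u k)"

context
  fixes c :: "nat \<Rightarrow> complex" and C and u v :: "nat \<Rightarrow> 'a::chilbert_space"
  assumes u: "orthonormal u" and v: "orthonormal v" and c: "\<And>k. cmod (c k) \<le> C"
begin

lemma osum_coeff: "summable (\<lambda>k. (cmod (c k * cinner z (v k)))\<^sup>2)"
  "(\<Sum>k. (cmod (c k * cinner z (v k)))\<^sup>2) \<le> C\<^sup>2 * (norm z)\<^sup>2"
proof -
  have le: "(cmod (c k * cinner z (v k)))\<^sup>2 \<le> C\<^sup>2 * (cmod (cinner z (v k)))\<^sup>2" for k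
    using c[of k] by (simp add: norm_mult power_mult_distrib mult_right_mono power_mono)
  note s = summable_mult[OF summable_Bessel(1)[OF v], of "C\<^sup>2" z]
  show sm: "summable (\<lambda>k. (cmod (c k * cinner z (v k)))\<^sup>2)"
    by (rule summable_comparison_test'[OF s, of 0]) (use le in auto)
  have "(\<Sum>k. (cmod (c k * cinner z (v k)))\<^sup>2) \<le> (\<Sum>k. C\<^sup>2 * (cmod (cinner z (v k)))\<^sup>2)"
    by (rule suminf_le[OF le sm s])
  also have "\<dots> = C\<^sup>2 * (\<Sum>k. (cmod (cinner z (v k)))\<^sup>2)"
    by (rule suminf_mult[OF summable_Bessel(1)[OF v]])
  also have "\<dots> \<le> C\<^sup>2 * (norm z)\<^sup>2"
    by (intro mult_left_mono summable_Bessel v) auto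
  finally show "(\<Sum>k. (cmod (c k * cinner z (v k)))\<^sup>2) \<le> C\<^sup>2 * (norm z)\<^sup>2" .
qed

lemma osum_summable: "summable (\<lambda>k. (c k * cinner z (v k)) *\<^sub>C u k)"
  by (intro summable_orthonormal u osum_coeff)

lemma osum_bounded_linear: "bounded_linear (\<lambda>z. \<Sum>k. (c k * cinner z (v k)) *\<^sub>C u k)"
proof (rule bounded_linear_intro[where K = C])
  show "(\<Sum>k. (c k * cinner (x + y) (v k)) *\<^sub>C u k) =
      (\<Sum>k. (c k * cinner x (v k)) *\<^sub>C u k) + (\<Sum>k. (c k * cinner y (v k)) *\<^sub>C u k)" for x y
    by (subst suminf_add[OF osum_summable osum_summable])
      (simp add: cinner_simps distrib_left scaleC_add_left)
  show "(\<Sum>k. (c k * cinner (r *\<^sub>R x) (v k)) *\<^sub>C u k) = r *\<^sub>R (\<Sum>k. (c k * cinner x (v k)) *\<^sub>C u k)" for r x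
    by (subst suminf_scaleR_right[OF osum_summable])
      (simp add: cinner_simps scaleR_scaleC mult_ac)
  have C: "0 \<le> C" using c[of 0] norm_ge_zero order_trans by blast
  fix x
  have "(norm (\<Sum>k. (c k * cinner x (v k)) *\<^sub>C u k))\<^sup>2 \<le> (norm x * C)\<^sup>2"
    unfolding summable_orthonormal(2)[OF u osum_coeff(1)] power_mult_distrib
    using osum_coeff(2) by (simp add: mult.commute)
  then show "norm (\<Sum>k. (c k * cinner x (v k)) *\<^sub>C u k) \<le> norm x * C"
    by (rule power2_le_imp_le) (simp add: C)
qed

lemma osum_apply: "osum c u v z = (\<Sum>k. (c k * cinner z (v k)) *\<^sub>C u k)"
  by (simp add: osum_def bounded_linear_Blinfun_apply osum_bounded_linear)

lemma osum_sums: "(\<lambda>k. (c k * cinner z (v k)) *\<^sub>C u k) sums osum c u v z"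
  unfolding osum_apply by (rule summable_sums[OF osum_summable])

lemma norm_osum_le: "norm (osum c u v) \<le> C"
proof (rule norm_blinfun_bound)
  show C: "0 \<le> C" using c[of 0] norm_ge_zero order_trans by blast
  fix x
  have "(norm (osum c u v x))\<^sup>2 \<le> (C * norm x)\<^sup>2"
    unfolding osum_apply summable_orthonormal(2)[OF u osum_coeff(1)] power_mult_distrib
    using osum_coeff(2) by simp
  then show "norm (osum c u v x) \<le> C * norm x"
    by (rule power2_le_imp_le) (simp add: C)
qed

lemma osum_bounded_operators: "osum c u v \<in> bounded_operators"
proof -
  have "osum c u v (d *\<^sub>C x) = d *\<^sub>C osum c u v x" for d x
  proof -
    have "(\<lambda>k. d *\<^sub>C ((c k * cinner x (v k)) *\<^sub>C u k)) sums (d *\<^sub>C osum c u v x)"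
      by (rule bounded_linear.sums[OF bounded_linear_scaleC osum_sums])
    moreover have "d *\<^sub>C ((c k * cinner x (v k)) *\<^sub>C u k) = (c k * cinner (d *\<^sub>C x) (v k)) *\<^sub>C u k" for k
      by (simp add: cinner_simps mult_ac)
    ultimately have "(\<lambda>k. (c k * cinner (d *\<^sub>C x) (v k)) *\<^sub>C u k) sums (d *\<^sub>C osum c u v x)"
      by (simp only:)
    then show ?thesis
      by (rule sums_unique2[OF osum_sums])
  qed
  then show ?thesis by (simp add: bounded_operators_def)
qed

lemma osum_basis: "osum c u v (v j) = c j *\<^sub>C u j"
proof -
  have "(\<lambda>k. (c k * cinner (v j) (v k)) *\<^sub>C u k) = (\<lambda>k. if k = j then c k *\<^sub>C u k else 0)"
    by (auto simp: orthonormalD[OF v] fun_eq_iff)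
  then show ?thesis
    using osum_sums[of "v j"] sums_single[of j "\<lambda>k. c k *\<^sub>C u k"] by (simp add: sums_unique2)
qed

lemma cinner_osum: "cinner (osum c u v z) (u j) = c j * cinner z (v j)"
proof -
  have "(\<lambda>k. cinner ((c k * cinner z (v k)) *\<^sub>C u k) (u j)) sums cinner (osum c u v z) (u j)"
    by (rule bounded_linear.sums[OF bounded_linear_cinner_left osum_sums])
  moreover have "(\<lambda>k. cinner ((c k * cinner z (v k)) *\<^sub>C u k) (u j))
      = (\<lambda>k. if k = j then c k * cinner z (v k) else 0)"
    by (auto simp: cinner_simps orthonormalD[OF u] fun_eq_iff)
  ultimately show ?thesis
    using sums_single[of j "\<lambda>k. c k * cinner z (v k)"] by (simp add: sums_unique2)
qed

end

text \<open>Serves to check term by term that an operator given by a series leaves a nest member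
  invariant.\<close>

lemma sums_in_closed_csubspace:
  fixes K :: "'a::complex_inner set"
  assumes "csubspace K" "closed K" "f sums s" "\<And>k. f k \<in> K"
  shows "s \<in> K"
proof (rule closed_sequentially[OF assms(2)])
  show "(\<lambda>n. sum f {..<n}) \<longlonglongrightarrow> s" using assms(3) by (simp add: sums_def)
  show "\<And>n. sum f {..<n} \<in> K" by (intro complex_vector.subspace_sum[OF assms(1)] assms(4))
qed

section \<open>Closed unital operator algebras and Neumann series\<close>

lemmas compose_simps =
  bounded_bilinear.add_left[OF bounded_bilinear_blinfun_compose]
  bounded_bilinear.add_right[OF bounded_bilinear_blinfun_compose]
  bounded_bilinear.diff_left[OF bounded_bilinear_blinfun_compose]
  bounded_bilinear.diff_right[OF bounded_bilinear_blinfun_compose]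

lemma compose_id [simp]: "id_blinfun o\<^sub>L T = T" "T o\<^sub>L id_blinfun = T"
  by (auto intro!: blinfun_eqI)

lemma compose_assoc: "(R o\<^sub>L S) o\<^sub>L T = R o\<^sub>L (S o\<^sub>L T)"
  by (auto intro!: blinfun_eqI)

locale operator_algebra =
  fixes A :: "('h::chilbert_space \<Rightarrow>\<^sub>L 'h) set"
  assumes csubspace: "csubspace A"
    and closed: "closed A"
    and id: "id_blinfun \<in> A"
    and compose: "S \<in> A \<Longrightarrow> T \<in> A \<Longrightarrow> S o\<^sub>L T \<in> A"
    and bounded_operators: "A \<subseteq> bounded_operators"
begin

lemma add: "S \<in> A \<Longrightarrow> T \<in> A \<Longrightarrow> S + T \<in> A"
  and diff: "S \<in> A \<Longrightarrow> T \<in> A \<Longrightarrow> S - T \<in> A"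
  and scale: "S \<in> A \<Longrightarrow> c *\<^sub>C S \<in> A"
  and uminus: "S \<in> A \<Longrightarrow> - S \<in> A"
  and zero: "0 \<in> A"
  by (simp_all add: csubspace csubspace_add csubspace_diff
      csubspace_scale csubspace_0 complex_vector.subspace_neg)

lemma apply_scaleC: "T \<in> A \<Longrightarrow> blinfun_apply T (c *\<^sub>C x) = c *\<^sub>C blinfun_apply T x"
  using bounded_operators bounded_operatorsD by blast

lemma compose_scaleC: "S \<in> A \<Longrightarrow> S o\<^sub>L (c *\<^sub>C T) = c *\<^sub>C (S o\<^sub>L T)"
  by (auto intro!: blinfun_eqI simp: apply_scaleC)

definition inverse_of :: "('h \<Rightarrow>\<^sub>L 'h) \<Rightarrow> ('h \<Rightarrow>\<^sub>L 'h) \<Rightarrow> bool" where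
  "inverse_of X Y \<longleftrightarrow> Y \<in> A \<and> X o\<^sub>L Y = id_blinfun \<and> Y o\<^sub>L X = id_blinfun"

text \<open>The one-sided inverses are fixed points of the contractions
  \<open>Y \<mapsto> 1 + U Y\<close> and \<open>Y \<mapsto> 1 + Y U\<close> of the complete set
  \<open>A\<close>, so they lie in \<open>A\<close>; associativity identifies them.\<close>

lemma Neumann:
  assumes U: "U \<in> A" and nU: "norm U < 1"
  shows "\<exists>Y. inverse_of (id_blinfun - U) Y"
proof -
  have cA: "complete A" using closed by (simp add: complete_eq_closed)
  have ne: "A \<noteq> {}" using zero by auto
  have "\<exists>!Y\<in>A. id_blinfun + (U o\<^sub>L Y) = Y"
  proof (rule Banach_fix[OF cA ne norm_ge_zero nU])
    show "(\<lambda>Y. id_blinfun + (U o\<^sub>L Y)) ` A \<subseteq> A"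
      using add id compose U by auto
    show "dist (id_blinfun + (U o\<^sub>L x)) (id_blinfun + (U o\<^sub>L y)) \<le> norm U * dist x y" for x y
      using norm_blinfun_compose[of U "x - y"] by (simp add: dist_norm compose_simps)
  qed
  then obtain Y where Y: "Y \<in> A" "id_blinfun + (U o\<^sub>L Y) = Y" by blast
  have "\<exists>!Y\<in>A. id_blinfun + (Y o\<^sub>L U) = Y"
  proof (rule Banach_fix[OF cA ne norm_ge_zero nU])
    show "(\<lambda>Y. id_blinfun + (Y o\<^sub>L U)) ` A \<subseteq> A"
      using add id compose U by auto
    show "dist (id_blinfun + (x o\<^sub>L U)) (id_blinfun + (y o\<^sub>L U)) \<le> norm U * dist x y" for x y
      using norm_blinfun_compose[of "x - y" U] by (simp add: dist_norm compose_simps mult.commute)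
  qed
  then obtain Z where Z: "Z \<in> A" "id_blinfun + (Z o\<^sub>L U) = Z" by blast
  have 1: "(id_blinfun - U) o\<^sub>L Y = id_blinfun"
    using Y(2) by (simp add: compose_simps algebra_simps)
  have 2: "Z o\<^sub>L (id_blinfun - U) = id_blinfun"
    using Z(2) by (simp add: compose_simps algebra_simps)
  have "Z = Z o\<^sub>L ((id_blinfun - U) o\<^sub>L Y)" by (simp add: 1)
  also have "\<dots> = Y" by (simp add: compose_assoc[symmetric] 2)
  finally show ?thesis using 1 2 Y(1) unfolding inverse_of_def by blast
qed

end

section \<open>Perturbation of the spectrum by single elements\<close>

context operator_algebra
begin

lemma inverse_of_unique: "inverse_of X Y \<Longrightarrow> inverse_of X Z \<Longrightarrow> Y = Z"
  unfolding inverse_of_def by (metis compose_assoc compose_id)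

lemma inverse_of_compose: "inverse_of X Y \<Longrightarrow> inverse_of X' Y' \<Longrightarrow> inverse_of (X o\<^sub>L X') (Y' o\<^sub>L Y)"
  unfolding inverse_of_def by (metis compose_assoc compose_id compose)

lemma inverse_of_scale:
  assumes "inverse_of X Y" "c \<noteq> 0" "X \<in> A"
  shows "inverse_of (c *\<^sub>C X) (inverse c *\<^sub>C Y)"
  using assms by (auto simp: inverse_of_def scale blinfun_compose_scaleC_left compose_scaleC)

text \<open>Complement of the spectrum relative to \<open>A\<close>: the inverse must belong to
  \<open>A\<close>, not merely be a bounded operator.\<close>

definition regular :: "('h \<Rightarrow>\<^sub>L 'h) \<Rightarrow> complex \<Rightarrow> bool" where
  "regular X l \<longleftrightarrow> (\<exists>Y. inverse_of (l *\<^sub>C id_blinfun - X) Y)"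

definition resolvent :: "('h \<Rightarrow>\<^sub>L 'h) \<Rightarrow> complex \<Rightarrow> 'h \<Rightarrow>\<^sub>L 'h" where
  "resolvent X l = (THE Y. inverse_of (l *\<^sub>C id_blinfun - X) Y)"

lemma resolvent: "regular X l \<Longrightarrow> inverse_of (l *\<^sub>C id_blinfun - X) (resolvent X l)"
  unfolding regular_def resolvent_def using inverse_of_unique by (metis theI)

lemma resolvent_in: "regular X l \<Longrightarrow> resolvent X l \<in> A"
  using resolvent inverse_of_def by blast

lemma resolvent_mult:
  assumes "regular X l"
  shows "l *\<^sub>C resolvent X l - (X o\<^sub>L resolvent X l) = id_blinfun"
    and "l *\<^sub>C resolvent X l - (resolvent X l o\<^sub>L X) = id_blinfun"
proof -
  note r = resolvent[OF assms, unfolded inverse_of_def]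
  show "l *\<^sub>C resolvent X l - (X o\<^sub>L resolvent X l) = id_blinfun"
    using r by (simp add: compose_simps blinfun_compose_scaleC_left)
  show "l *\<^sub>C resolvent X l - (resolvent X l o\<^sub>L X) = id_blinfun"
    using r by (simp add: compose_simps compose_scaleC[OF resolvent_in[OF assms]])
qed

lemma regular_of_norm:
  assumes X: "X \<in> A" and l: "norm X < cmod l"
  shows "regular X l"
proof -
  have l0: "l \<noteq> 0" using l by (metis norm_ge_zero norm_zero not_less)
  have "norm (inverse l *\<^sub>C X) < 1"
    using l l0 by (simp add: norm_scaleC_blinfun norm_inverse norm_divide field_simps)
  then obtain Y where Y: "inverse_of (id_blinfun - inverse l *\<^sub>C X) Y"
    using Neumann scale X by blast
  have "inverse_of (l *\<^sub>C (id_blinfun - inverse l *\<^sub>C X)) (inverse l *\<^sub>C Y)"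
    by (rule inverse_of_scale[OF Y l0 diff[OF id scale[OF X]]])
  moreover have "l *\<^sub>C (id_blinfun - inverse l *\<^sub>C X) = l *\<^sub>C id_blinfun - X"
    using l0 by (simp add: complex_vector.scale_right_diff_distrib)
  ultimately show ?thesis unfolding regular_def by auto
qed

lemma norm_resolvent_le:
  assumes "norm X < cmod l" "regular X l"
  shows "norm (resolvent X l) \<le> 1 / (cmod l - norm X)"
proof -
  let ?R = "resolvent X l"
  have "norm (l *\<^sub>C ?R) = norm (id_blinfun + (X o\<^sub>L ?R))"
    using resolvent_mult(1)[OF assms(2)] by (metis diff_add_cancel)
  also have "\<dots> \<le> 1 + norm X * norm ?R"
    by (intro norm_triangle_le add_mono norm_blinfun_id_le norm_blinfun_compose)
  finally have "norm ?R * (cmod l - norm X) \<le> 1"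
    by (simp add: norm_scaleC_blinfun algebra_simps)
  then show ?thesis
    using assms(1) by (simp add: pos_le_divide_eq)
qed

text \<open>Factor \<open>m - X = (l - X) (1 - (l - m) R)\<close> with \<open>R\<close> the
  resolvent at \<open>l\<close>; a Neumann series inverts the second factor.\<close>

lemma regular_perturb:
  assumes l: "regular X l" and X: "X \<in> A" and m: "cmod (m - l) * norm (resolvent X l) < 1"
  shows "regular X m"
proof -
  let ?R = "resolvent X l"
  have "norm ((l - m) *\<^sub>C ?R) < 1"
    using m by (simp add: norm_scaleC_blinfun norm_minus_commute)
  then obtain Y where Y: "inverse_of (id_blinfun - (l - m) *\<^sub>C ?R) Y"
    using Neumann scale resolvent_in[OF l] by blast
  have lX: "l *\<^sub>C id_blinfun - X \<in> A" by (intro diff scale id X)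
  have "(l *\<^sub>C id_blinfun - X) o\<^sub>L (id_blinfun - (l - m) *\<^sub>C ?R)
      = (l *\<^sub>C id_blinfun - X) - (l - m) *\<^sub>C ((l *\<^sub>C id_blinfun - X) o\<^sub>L ?R)"
    by (subst bounded_bilinear.diff_right[OF bounded_bilinear_blinfun_compose])
      (simp add: compose_scaleC[OF lX])
  also have "\<dots> = m *\<^sub>C id_blinfun - X"
    using resolvent[OF l] by (simp add: inverse_of_def complex_vector.scale_left_diff_distrib)
  finally show ?thesis
    using inverse_of_compose[OF resolvent[OF l] Y] unfolding regular_def by auto
qed

lemma open_regular:
  assumes X: "X \<in> A"
  shows "open (Collect (regular X))"
  unfolding open_dist
proof safe
  fix l assume l: "regular X l"
  show "\<exists>e>0. \<forall>y. dist y l < e \<longrightarrow> y \<in> Collect (regular X)"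
  proof (intro exI[of _ "1 / (norm (resolvent X l) + 1)"] conjI allI impI)
    show "0 < 1 / (norm (resolvent X l) + 1)" by (simp add: add_nonneg_pos)
    fix m assume "dist m l < 1 / (norm (resolvent X l) + 1)"
    then have "cmod (m - l) * (norm (resolvent X l) + 1) < 1"
      by (simp add: dist_norm pos_less_divide_eq add_nonneg_pos)
    then have "cmod (m - l) * norm (resolvent X l) < 1"
      by (simp add: distrib_left) (smt (verit) norm_ge_zero)
    then show "m \<in> Collect (regular X)" using regular_perturb[OF l X] by simp
  qed
qed

lemma resolvent_identity:
  assumes "regular X l" "regular X m" and X: "X \<in> A"
  shows "resolvent X m - resolvent X l = (l - m) *\<^sub>C (resolvent X m o\<^sub>L resolvent X l)"
proof -
  let ?R = "resolvent X l" and ?S = "resolvent X m"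
  note r = resolvent[OF assms(1), unfolded inverse_of_def] and s = resolvent[OF assms(2), unfolded inverse_of_def]
  have "?S - ?R = (?S o\<^sub>L ((l *\<^sub>C id_blinfun - X) o\<^sub>L ?R)) - ((?S o\<^sub>L (m *\<^sub>C id_blinfun - X)) o\<^sub>L ?R)"
    using r s by simp
  also have "\<dots> = ?S o\<^sub>L (((l *\<^sub>C id_blinfun - X) - (m *\<^sub>C id_blinfun - X)) o\<^sub>L ?R)"
    by (simp only: compose_assoc compose_simps)
  also have "\<dots> = (l - m) *\<^sub>C (?S o\<^sub>L ?R)"
    using s by (simp add: complex_vector.scale_left_diff_distrib[symmetric] blinfun_compose_scaleC_left compose_scaleC)
  finally show ?thesis .
qed

lemma resolvent_tendsto:
  assumes l: "regular X l" and X: "X \<in> A"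
  shows "(resolvent X \<longlongrightarrow> resolvent X l) (at l)"
proof -
  let ?R = "resolvent X l"
  define K where "K = norm ?R"
  \<comment> \<open>The radius ensures \<open>cmod (m - l) * K \<le> 1 / 2\<close>; absorbing half
    of the norm of the resolvent at \<open>m\<close> then bounds it by \<open>2 * K\<close>.\<close>
  have "\<forall>\<^sub>F m in at l. dist m l < 1 / (2 * (K + 1))"
    by (rule eventually_at_ball'[of _ l UNIV, THEN eventually_mono])
      (auto simp: K_def add_nonneg_pos dist_commute)
  then have ev: "\<forall>\<^sub>F m in at l. norm (resolvent X m - ?R) \<le> cmod (m - l) * (2 * K * K)"
  proof eventually_elim
    case (elim m)
    have "K \<ge> 0" by (simp add: K_def)
    then have "cmod (m - l) * (2 * (K + 1)) < 1"
      using elim by (simp add: dist_norm pos_less_divide_eq)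
    moreover have "cmod (m - l) * (2 * (K + 1)) = 2 * (cmod (m - l) * K) + 2 * cmod (m - l)"
      by (simp add: algebra_simps)
    ultimately have mK: "cmod (m - l) * K \<le> 1 / 2"
      using norm_ge_zero[of "m - l"] by linarith
    then have m: "regular X m"
      using regular_perturb[OF l X, of m] by (simp add: K_def)
    let ?S = "resolvent X m"
    have le: "norm (?S - ?R) \<le> cmod (m - l) * (norm ?S * K)"
      unfolding resolvent_identity[OF l m X] norm_scaleC_blinfun K_def
      by (simp add: norm_minus_commute mult_left_mono norm_blinfun_compose)
    have "norm ?S \<le> norm (?S - ?R) + K"
      unfolding K_def by (metis diff_add_cancel norm_triangle_ineq)
    also have "norm (?S - ?R) \<le> (cmod (m - l) * K) * norm ?S"
      using le by (simp add: mult_ac)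
    also have "\<dots> \<le> 1 / 2 * norm ?S"
      by (intro mult_right_mono mK) simp
    finally have "norm ?S \<le> 2 * K" by simp
    then have "cmod (m - l) * (norm ?S * K) \<le> cmod (m - l) * (2 * K * K)"
      using \<open>K \<ge> 0\<close> by (intro mult_left_mono mult_right_mono) auto
    with le show ?case by simp
  qed
  have "((\<lambda>m. cmod (m - l) * (2 * K * K)) \<longlongrightarrow> cmod (l - l) * (2 * K * K)) (at l)"
    by (intro tendsto_intros)
  then have "((\<lambda>m. cmod (m - l) * (2 * K * K)) \<longlongrightarrow> 0) (at l)" by simp
  then have "((\<lambda>m. resolvent X m - ?R) \<longlongrightarrow> 0) (at l)"
    by (rule Lim_null_comparison[OF ev])
  then show ?thesis by (simp add: LIM_zero_iff)
qed

text \<open>By the resolvent identity the difference quotient equals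
  \<open>- \<phi> (resolvent X m o\<^sub>L resolvent X l)\<close>, which converges because the
  resolvent is continuous.\<close>

lemma resolvent_holomorphic:
  fixes \<phi> :: "('h \<Rightarrow>\<^sub>L 'h) \<Rightarrow> complex"
  assumes X: "X \<in> A" and \<phi>: "bounded_linear \<phi>" "\<And>c Y. \<phi> (c *\<^sub>C Y) = c * \<phi> Y"
  shows "(\<lambda>l. \<phi> (resolvent X l)) holomorphic_on Collect (regular X)"
  unfolding holomorphic_on_open[OF open_regular[OF X]]
proof safe
  fix l assume l: "regular X l"
  let ?R = "resolvent X l"
  have "((\<lambda>m. - \<phi> (resolvent X m o\<^sub>L ?R)) \<longlongrightarrow> - \<phi> (?R o\<^sub>L ?R)) (at l)"
    by (intro tendsto_minus bounded_linear.tendsto[OF \<phi>(1)]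
        bounded_bilinear.tendsto[OF bounded_bilinear_blinfun_compose] resolvent_tendsto[OF l X] tendsto_const)
  moreover have "\<forall>\<^sub>F m in at l. - \<phi> (resolvent X m o\<^sub>L ?R) = (\<phi> (resolvent X m) - \<phi> ?R) / (m - l)"
  proof -
    have "\<forall>\<^sub>F m in at l. m \<in> Collect (regular X) \<and> m \<noteq> l"
      using eventually_at_in_open[OF open_regular[OF X], of l] l by simp
    then show ?thesis
    proof eventually_elim
      case (elim m)
      then have m: "regular X m" by simp
      have "\<phi> (resolvent X m) - \<phi> ?R = (l - m) * \<phi> (resolvent X m o\<^sub>L ?R)"
        using arg_cong[OF resolvent_identity[OF l m X], of \<phi>]
        by (simp add: \<phi>(2) linear_diff[OF bounded_linear.linear[OF \<phi>(1)]])
      then show ?case using elim by (simp add: field_simps)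
    qed
  qed
  ultimately have "((\<lambda>m. (\<phi> (resolvent X m) - \<phi> ?R) / (m - l)) \<longlongrightarrow> - \<phi> (?R o\<^sub>L ?R)) (at l)"
    by (simp add: tendsto_cong)
  then show "\<exists>f'. ((\<lambda>l. \<phi> (resolvent X l)) has_field_derivative f') (at l)"
    by (auto simp: has_field_derivative_iff)
qed

text \<open>Boundedness and complex linearity of \<open>\<phi>\<close> are demanded so that
  \<open>\<phi> (resolvent X l)\<close> is a holomorphic function of \<open>l\<close>.\<close>

definition single :: "('h \<Rightarrow>\<^sub>L 'h) \<Rightarrow> bool" where
  "single Q \<longleftrightarrow> Q \<in> A \<and> (\<exists>\<phi>. bounded_linear \<phi> \<and> (\<forall>c Y. \<phi> (c *\<^sub>C Y) = c * \<phi> Y) \<and>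
     (\<forall>Y\<in>A. Q o\<^sub>L Y o\<^sub>L Q = \<phi> Y *\<^sub>C Q))"

lemma single_scale: "single Q \<Longrightarrow> single (c *\<^sub>C Q)"
  unfolding single_def
proof (elim conjE exE, intro conjI)
  fix \<phi> :: "('h \<Rightarrow>\<^sub>L 'h) \<Rightarrow> complex"
  assume Q: "Q \<in> A" and \<phi>: "bounded_linear \<phi>" "\<forall>c Y. \<phi> (c *\<^sub>C Y) = c * \<phi> Y" "\<forall>Y\<in>A. Q o\<^sub>L Y o\<^sub>L Q = \<phi> Y *\<^sub>C Q"
  show "c *\<^sub>C Q \<in> A" using Q by (rule scale)
  have "(c *\<^sub>C Q) o\<^sub>L Y o\<^sub>L (c *\<^sub>C Q) = (c * \<phi> Y) *\<^sub>C (c *\<^sub>C Q)" if "Y \<in> A" for Y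
    using \<phi>(3) that compose_scaleC[OF compose[OF Q that], of c Q]
    by (simp add: blinfun_compose_scaleC_left mult_ac)
  then show "\<exists>\<phi>. bounded_linear \<phi> \<and> (\<forall>c Y. \<phi> (c *\<^sub>C Y) = c * \<phi> Y) \<and>
      (\<forall>Y\<in>A. (c *\<^sub>C Q) o\<^sub>L Y o\<^sub>L (c *\<^sub>C Q) = \<phi> Y *\<^sub>C c *\<^sub>C Q)"
    using \<phi> by (intro exI[of _ "\<lambda>Y. c * \<phi> Y"]) (auto intro: bounded_linear_const_mult simp: mult_ac)
qed

lemma single_zero_product:
  assumes "Q \<in> A" "\<And>Y. Y \<in> A \<Longrightarrow> Q o\<^sub>L Y o\<^sub>L Q = 0"
  shows "single Q"
  unfolding single_def using assms by (intro conjI exI[of _ "\<lambda>_. 0"]) auto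

lemma single_rank_one:
  assumes Q: "Q \<in> A" and u: "\<And>z. \<exists>c. blinfun_apply Q z = c *\<^sub>C u"
  shows "single Q"
  unfolding single_def
proof (intro conjI Q exI ballI allI)
  \<comment> \<open>The coordinate of \<open>Q (Y u)\<close> along \<open>u\<close>. For
    \<open>u = 0\<close> the quotient is 0, in accordance with \<open>Q = 0\<close>.\<close>
  let ?\<phi> = "\<lambda>Y. cinner (blinfun_apply Q (blinfun_apply Y u)) u / of_real ((norm u)\<^sup>2)"
  have "bounded_linear (\<lambda>Y. cinner (blinfun_apply Q (blinfun_apply Y u)) u)"
    by (rule bounded_linear_compose[OF bounded_linear_cinner_left],
        rule bounded_linear_compose[OF blinfun.bounded_linear_right blinfun.bounded_linear_left])
  then show "bounded_linear ?\<phi>"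
    by (rule bounded_linear_compose[OF bounded_linear_divide])
  show "?\<phi> (c *\<^sub>C Y) = c * ?\<phi> Y" for c Y
    by (simp add: apply_scaleC[OF Q] cinner_simps)
  fix Y assume Y: "Y \<in> A"
  show "Q o\<^sub>L Y o\<^sub>L Q = ?\<phi> Y *\<^sub>C Q"
  proof (rule blinfun_eqI)
    fix z
    obtain c where c: "blinfun_apply Q z = c *\<^sub>C u" using u by blast
    obtain d where d: "blinfun_apply Q (blinfun_apply Y u) = d *\<^sub>C u" using u by blast
    have "(Q o\<^sub>L Y o\<^sub>L Q) z = (c * d) *\<^sub>C u"
      by (simp add: c d apply_scaleC[OF Q] apply_scaleC[OF Y])
    moreover have "?\<phi> Y *\<^sub>C (c *\<^sub>C u) = (c * d) *\<^sub>C u"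
      by (cases "u = 0") (simp_all add: d cinner_simps cinner_self mult_ac)
    ultimately show "(Q o\<^sub>L Y o\<^sub>L Q) z = (?\<phi> Y *\<^sub>C Q) z"
      by (simp only: scaleC_blinfun_apply c)
  qed
qed

text \<open>With \<open>F = R Q\<close> one has \<open>l - (X + Q) = (l - X) (1 - F)\<close> and
  \<open>F F = c F\<close>, so \<open>1 + F / (1 - c)\<close> inverts \<open>1 - F\<close>.\<close>

lemma regular_add_single:
  assumes "Q \<in> A" "Q o\<^sub>L resolvent X l o\<^sub>L Q = c *\<^sub>C Q" "c \<noteq> 1" and l: "regular X l" and X: "X \<in> A"
  shows "regular (X + Q) l"
proof -
  let ?R = "resolvent X l"
  define F where "F = ?R o\<^sub>L Q"
  define a where "a = inverse (1 - c)"
  have F: "F \<in> A" using resolvent_in[OF l] assms(1) by (auto simp: F_def compose)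
  have FF: "F o\<^sub>L F = c *\<^sub>C F"
    using assms(2) compose_scaleC[OF resolvent_in[OF l], of c Q] by (simp add: F_def compose_assoc)
  have a: "a = 1 + a * c" using assms(3) by (simp add: a_def field_simps)
  have aF: "a *\<^sub>C F = F + (a * c) *\<^sub>C F"
    by (metis a scaleC_add_left scaleC_one)
  have "inverse_of (id_blinfun - F) (id_blinfun + a *\<^sub>C F)"
    unfolding inverse_of_def
  proof (intro conjI)
    show "id_blinfun + a *\<^sub>C F \<in> A" by (intro add id scale F)
    have "(id_blinfun - F) o\<^sub>L (id_blinfun + a *\<^sub>C F) = id_blinfun + a *\<^sub>C F - (F + (a * c) *\<^sub>C F)"
      by (simp add: compose_simps compose_scaleC[OF F] FF)
    then show "(id_blinfun - F) o\<^sub>L (id_blinfun + a *\<^sub>C F) = id_blinfun"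
      by (simp add: aF[symmetric])
    have "(id_blinfun + a *\<^sub>C F) o\<^sub>L (id_blinfun - F) = id_blinfun + a *\<^sub>C F - (F + (a * c) *\<^sub>C F)"
      by (simp add: compose_simps blinfun_compose_scaleC_left FF)
    then show "(id_blinfun + a *\<^sub>C F) o\<^sub>L (id_blinfun - F) = id_blinfun"
      by (simp add: aF[symmetric])
  qed
  from inverse_of_compose[OF resolvent[OF l] this]
  have "inverse_of ((l *\<^sub>C id_blinfun - X) o\<^sub>L (id_blinfun - F)) ((id_blinfun + a *\<^sub>C F) o\<^sub>L ?R)" .
  moreover have "(l *\<^sub>C id_blinfun - X) o\<^sub>L (id_blinfun - F) = l *\<^sub>C id_blinfun - (X + Q)"
  proof -
    have "(l *\<^sub>C id_blinfun - X) o\<^sub>L F = Q"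
      using resolvent[OF l] by (simp add: F_def inverse_of_def compose_assoc[symmetric])
    then have "(l *\<^sub>C id_blinfun - X) o\<^sub>L (id_blinfun - F) = (l *\<^sub>C id_blinfun - X) - Q"
      by (subst bounded_bilinear.diff_right[OF bounded_bilinear_blinfun_compose]) simp
    then show ?thesis by simp
  qed
  ultimately show ?thesis unfolding regular_def by auto
qed

text \<open>Outside the old singular points, \<open>regular_add_single\<close> allows new ones only
  at zeros of the holomorphic function \<open>1 - \<phi> (resolvent X l)\<close>. It remains to see
  that this function is not identically zero on a connected domain.\<close>

lemma countable_singular_add_single:
  assumes X: "X \<in> A" and Q: "single Q" and r: "r \<ge> 0"
    and c: "countable {l. r < cmod l \<and> \<not> regular X l}"
  shows "countable {l. r < cmod l \<and> \<not> regular (X + Q) l}"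
proof -
  obtain \<phi> where \<phi>: "bounded_linear \<phi>" "\<And>c Y. \<phi> (c *\<^sub>C Y) = c * \<phi> Y"
      "\<And>Y. Y \<in> A \<Longrightarrow> Q o\<^sub>L Y o\<^sub>L Q = \<phi> Y *\<^sub>C Q" and QA: "Q \<in> A"
    using Q unfolding single_def by blast
  define V where "V = {l. r < cmod l \<and> regular X l}"
  have D: "- cball 0 r = {l. r < cmod l}" by (auto simp: dist_norm)
  have V1: "V = - cball 0 r - {l. r < cmod l \<and> \<not> regular X l}" by (auto simp: V_def dist_norm)
  have oV: "open V"
  proof -
    have "V = - cball 0 r \<inter> Collect (regular X)" by (auto simp: V_def dist_norm)
    then show ?thesis using open_regular[OF X] by auto
  qed
  \<comment> \<open>Connectedness lets one nonzero value, found far out, exclude vanishing on all of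
    \<open>V\<close>. It holds because the exterior of a disc in the plane stays connected when
    countably many points are removed.\<close>
  have cV: "connected V"
    unfolding V1 by (rule connected_open_diff_countable)
      (auto intro: connected_complement_bounded_convex c)
  define g where "g l = 1 - \<phi> (resolvent X l)" for l
  have hol: "g holomorphic_on V"
    unfolding g_def
    by (intro holomorphic_intros holomorphic_on_subset[OF resolvent_holomorphic[OF X \<phi>(1,2)]])
      (auto simp: V_def)
  obtain B where B: "B > 0" "\<And>Y. cmod (\<phi> Y) \<le> norm Y * B"
    using bounded_linear.pos_bounded[OF \<phi>(1)] by blast
  \<comment> \<open>Then \<open>cmod l0 - norm X = r + B + 1\<close>, so \<open>\<phi>\<close> of
    the resolvent at \<open>l0\<close> is at most \<open>B / (r + B + 1) < 1\<close> in
    modulus.\<close>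
  define l0 where "l0 = complex_of_real (norm X + r + B + 1)"
  have nl0: "cmod l0 = norm X + r + B + 1"
    unfolding l0_def norm_of_real using B(1) r by simp
  have reg: "regular X l0"
    by (rule regular_of_norm[OF X]) (use nl0 B(1) r in simp)
  have l0V: "l0 \<in> V"
    using reg nl0 B(1) by (simp add: V_def) (smt (verit) norm_ge_zero)
  have "norm (resolvent X l0) \<le> 1 / (cmod l0 - norm X)"
    by (rule norm_resolvent_le[OF _ reg]) (use nl0 B(1) r in simp)
  then have "norm (resolvent X l0) * B \<le> 1 / (r + B + 1) * B"
    using B(1) by (intro mult_right_mono) (simp_all add: nl0 add.assoc)
  also have "\<dots> < 1" using B(1) r by (simp add: field_simps)
  finally have "cmod (\<phi> (resolvent X l0)) < 1" using B(2) by (rule le_less_trans[rotated])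
  then have g0: "g l0 \<noteq> 0" by (auto simp: g_def)
  have "countable {l\<in>V. g l = 0}"
  proof (cases "g constant_on V")
    case True
    then have *: "{l\<in>V. g l = 0} = {}" using l0V g0 by (auto simp: constant_on_def)
    show ?thesis unfolding * by simp
  next
    case False
    have "fsigma V"
      unfolding fsigma_Union_compact using open_Union_compact_subsets[OF oV] by (metis image_subset_iff mem_Collect_eq)
    then show ?thesis
      using False by (intro holomorphic_countable_zeros hol oV cV)
  qed
  then have "countable ({l. r < cmod l \<and> \<not> regular X l} \<union> {l\<in>V. g l = 0})"
    using c by simp
  moreover have "{l. r < cmod l \<and> \<not> regular (X + Q) l} \<subseteq> {l. r < cmod l \<and> \<not> regular X l} \<union> {l\<in>V. g l = 0}"
    using regular_add_single[OF QA \<phi>(3)[OF resolvent_in] _ _ X] by (auto simp: V_def g_def)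
  ultimately show ?thesis by (rule countable_subset[rotated])
qed

text \<open>For given \<open>r > 0\<close> write \<open>T = (T - s) + s\<close> with
  \<open>s\<close> in the span and \<open>norm (T - s) < r\<close>. The first summand has no
  singular points beyond radius \<open>r\<close>, and the terms of \<open>s\<close> are added one at
  a time. Countably many radii exhaust the nonzero \<open>l\<close>.\<close>

lemma countable_singular_closure_span:
  assumes S: "\<And>Q. Q \<in> \<Q> \<Longrightarrow> single Q" and T: "T \<in> closure (cspan \<Q>)" "T \<in> A"
  shows "countable {l. l \<noteq> 0 \<and> \<not> regular T l}"
proof -
  have *: "countable {l. r < cmod l \<and> \<not> regular T l}" if r: "r > 0" for r :: real
  proof -
    obtain s where s: "s \<in> cspan \<Q>" "dist s T < r"
      using T(1) r unfolding closure_approachable by blast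
    have sA: "x \<in> A" if "x \<in> cspan \<Q>" for x
      using complex_vector.span_minimal[of \<Q> A] S csubspace that by (auto simp: single_def)
    have TA: "T - s \<in> A" using diff T(2) s sA by blast
    have "s' \<in> A \<and> countable {l. r < cmod l \<and> \<not> regular ((T - s) + s') l}" if "s' \<in> cspan \<Q>" for s'
      using that
    proof (induction rule: complex_vector.span_induct_alt)
      case base
      have "regular (T - s) l" if "r < cmod l" for l
        by (rule regular_of_norm[OF TA]) (use that s(2) in \<open>simp add: dist_norm norm_minus_commute\<close>)
      then have *: "{l. r < cmod l \<and> \<not> regular ((T - s) + 0) l} = {}" by auto
      show ?case unfolding * by (simp add: zero)
    next
      case (step c x y)
      have "countable {l. r < cmod l \<and> \<not> regular (((T - s) + y) + c *\<^sub>C x) l}"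
        by (rule countable_singular_add_single) (use step r TA S in \<open>auto intro: add single_scale\<close>)
      moreover have "c *\<^sub>C x + y \<in> A"
        using step S by (intro add scale) (auto simp: single_def)
      ultimately show ?case by (simp add: add_ac)
    qed
    from this[OF s(1)] show ?thesis by simp
  qed
  have "{l. l \<noteq> 0 \<and> \<not> regular T l} \<subseteq> (\<Union>n. {l. 1 / real (Suc n) < cmod l \<and> \<not> regular T l})"
  proof
    fix l assume l: "l \<in> {l. l \<noteq> 0 \<and> \<not> regular T l}"
    then obtain n where "inverse (real (Suc n)) < cmod l"
      using reals_Archimedean[of "cmod l"] by auto
    then show "l \<in> (\<Union>n. {l. 1 / real (Suc n) < cmod l \<and> \<not> regular T l})"
      using l by (auto simp: inverse_eq_divide)
  qed
  moreover have "countable (\<Union>n. {l. 1 / real (Suc n) < cmod l \<and> \<not> regular T l})"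
    by (intro countable_UN *) auto
  ultimately show ?thesis by (rule countable_subset)
qed

end

section \<open>Ideals and quotients of operator algebras, spectra\<close>

text \<open>Passing to an ideal changes only the carrier, so one shape of record covers the nest
  algebra and all its ideals.\<close>

definition op_alg :: "('h::chilbert_space \<Rightarrow>\<^sub>L 'h) set \<Rightarrow> ('h \<Rightarrow>\<^sub>L 'h) normed_algebra" where
  "op_alg C = \<lparr>acarrier = C, azero = 0, aadd = (+), ascale = scaleC, amult = (o\<^sub>L), anorm = norm\<rparr>"

lemma op_alg_simps [simp]:
  "acarrier (op_alg C) = C" "azero (op_alg C) = 0" "aadd (op_alg C) = (+)"
  "ascale (op_alg C) = scaleC" "amult (op_alg C) = (o\<^sub>L)" "anorm (op_alg C) = norm"
  by (simp_all add: op_alg_def)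

lemma nest_algebra_eq_op_alg: "nest_algebra \<N> = op_alg (acarrier (nest_algebra \<N>))"
  by (simp add: nest_algebra_def op_alg_def scaleC_blinfun_def fun_eq_iff)

lemma ideal_algebra_op_alg: "ideal_algebra (op_alg C) J = op_alg J"
  by (simp add: ideal_algebra_def op_alg_def)

lemma aminus_op_alg [simp]: "aminus (op_alg C) x y = x - y"
  by (simp add: aminus_def)

lemma alg_subspace_op_alg: "alg_subspace (op_alg C) S \<longleftrightarrow> S \<subseteq> C \<and> csubspace S"
  by (auto simp: alg_subspace_def complex_vector.subspace_def)

lemma closedin_op_alg:
  "closedin (atopology (op_alg C)) S \<longleftrightarrow> closedin (top_of_set C) S"
proof -
  have d: "adist (op_alg C) x y = dist x y" if "x \<in> C" "y \<in> C" for x y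
    using that by (simp add: adist_def dist_norm)
  interpret M: Metric_space C "adist (op_alg C)"
    by standard (auto simp: adist_def norm_minus_commute dist_norm[symmetric] dist_triangle)
  have ball: "M.mball x r \<subseteq> U \<longleftrightarrow> (\<forall>y\<in>C. dist y x < r \<longrightarrow> y \<in> U)" if "x \<in> C" for x r U
    unfolding subset_iff M.in_mball using that d by (metis dist_commute)
  have "openin (atopology (op_alg C)) U \<longleftrightarrow> openin (top_of_set C) U" for U
  proof -
    have "openin (atopology (op_alg C)) U \<longleftrightarrow> U \<subseteq> C \<and> (\<forall>x\<in>U. \<exists>r>0. M.mball x r \<subseteq> U)"
      by (simp add: atopology_def M.openin_mtopology) blast
    also have "\<dots> \<longleftrightarrow> U \<subseteq> C \<and> (\<forall>x\<in>U. \<exists>r>0. \<forall>y\<in>C. dist y x < r \<longrightarrow> y \<in> U)"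
      by (meson ball subsetD)
    finally show ?thesis by (simp add: openin_euclidean_subtopology_iff)
  qed
  then have "atopology (op_alg C) = top_of_set C"
    by (simp add: topology_eq)
  then show "closedin (atopology (op_alg C)) S \<longleftrightarrow> closedin (top_of_set C) S" by simp
qed

lemma closed_ideal_op_alg:
  assumes "closed C"
  shows "closed_ideal (op_alg C) I \<longleftrightarrow> I \<subseteq> C \<and> csubspace I \<and> closed I \<and>
    (\<forall>a\<in>C. \<forall>x\<in>I. a o\<^sub>L x \<in> I \<and> x o\<^sub>L a \<in> I)"
  using assms closedin_closed_eq[of C I]
  by (auto simp: closed_ideal_def alg_subspace_op_alg closedin_op_alg)

text \<open>Quotient operations are unions over representatives; if every representative yields the
  same coset, the union collapses to it.\<close>

lemma UN_eq_const:
  "x0 \<in> X \<Longrightarrow> (\<And>x. x \<in> X \<Longrightarrow> f x = c) \<Longrightarrow> (\<Union>x\<in>X. f x) = c"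
  "x0 \<in> X \<Longrightarrow> y0 \<in> Y \<Longrightarrow> (\<And>x y. x \<in> X \<Longrightarrow> y \<in> Y \<Longrightarrow> g x y = c) \<Longrightarrow> (\<Union>x\<in>X. \<Union>y\<in>Y. g x y) = c"
  by blast+

section \<open>Quotient algebras and their compact and finite rank elements\<close>

locale quotient_by_ideal =
  fixes J I :: "('h::chilbert_space \<Rightarrow>\<^sub>L 'h) set"
  assumes J: "csubspace J" and mult: "\<And>x y. x \<in> J \<Longrightarrow> y \<in> J \<Longrightarrow> x o\<^sub>L y \<in> J"
    and linear: "J \<subseteq> bounded_operators"
    and I: "csubspace I" "closed I" "I \<subseteq> J"
    and ideal: "\<And>a x. a \<in> J \<Longrightarrow> x \<in> I \<Longrightarrow> a o\<^sub>L x \<in> I" "\<And>a x. a \<in> J \<Longrightarrow> x \<in> I \<Longrightarrow> x o\<^sub>L a \<in> I"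
begin

abbreviation "coset \<equiv> acoset (op_alg J) I"
abbreviation "quot \<equiv> quotient_algebra (op_alg J) I"

lemma I0: "0 \<in> I" using I csubspace_0 by blast
lemma I_add: "x \<in> I \<Longrightarrow> y \<in> I \<Longrightarrow> x + y \<in> I" using I csubspace_add by blast
lemma I_diff: "x \<in> I \<Longrightarrow> y \<in> I \<Longrightarrow> x - y \<in> I" using I csubspace_diff by blast
lemma I_scale: "x \<in> I \<Longrightarrow> c *\<^sub>C x \<in> I" using I csubspace_scale by blast
lemma I_minus: "- x \<in> I \<longleftrightarrow> x \<in> I" using I_diff[OF I0] by fastforce

lemma coset: "coset a = {a + i | i. i \<in> I}"
  by (auto simp: acoset_def)

lemma mem_coset: "x \<in> coset a \<longleftrightarrow> x - a \<in> I"
  by (force simp: coset)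

lemma coset_eq_iff: "coset a = coset b \<longleftrightarrow> a - b \<in> I"
proof
  assume "coset a = coset b"
  then have "a \<in> coset b" using mem_coset[of a a] I0 by simp
  then show "a - b \<in> I" by (simp add: mem_coset)
next
  assume ab: "a - b \<in> I"
  have "x - a \<in> I \<longleftrightarrow> x - b \<in> I" for x
    using I_add[OF _ ab, of "x - a"] I_diff[OF _ ab, of "x - b"] by auto
  then show "coset a = coset b" by (auto simp: mem_coset)
qed

lemma self_mem_coset: "a \<in> coset a" by (simp add: mem_coset I0)

lemma quot_carrier: "acarrier quot = coset ` J"
  and quot_zero: "azero quot = I"
  by (simp_all add: quotient_algebra_def)

lemma coset_eq_zero_iff: "coset a = azero quot \<longleftrightarrow> a \<in> I"
  using coset_eq_iff[of a 0] by (simp add: quot_zero coset)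

lemma quot_add: "aadd quot (coset a) (coset b) = coset (a + b)"
proof -
  have "coset (x + y) = coset (a + b)" if "x \<in> coset a" "y \<in> coset b" for x y
    using that I_add[of "x - a" "y - b"] by (simp add: mem_coset coset_eq_iff algebra_simps)
  then have "(\<Union>x\<in>coset a. \<Union>y\<in>coset b. coset (x + y)) = coset (a + b)"
    by (rule UN_eq_const(2)[OF self_mem_coset self_mem_coset])
  then show ?thesis by (simp add: quotient_algebra_def)
qed

lemma quot_scale: "ascale quot c (coset a) = coset (c *\<^sub>C a)"
proof -
  have "coset (c *\<^sub>C x) = coset (c *\<^sub>C a)" if "x \<in> coset a" for x
    using that I_scale[of "x - a" c] by (simp add: mem_coset coset_eq_iff complex_vector.scale_right_diff_distrib)
  then have "(\<Union>x\<in>coset a. coset (c *\<^sub>C x)) = coset (c *\<^sub>C a)"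
    by (rule UN_eq_const(1)[OF self_mem_coset])
  then show ?thesis by (simp add: quotient_algebra_def)
qed

lemma quot_mult:
  assumes "a \<in> J" "b \<in> J"
  shows "amult quot (coset a) (coset b) = coset (a o\<^sub>L b)"
proof -
  have "coset (x o\<^sub>L y) = coset (a o\<^sub>L b)" if xy: "x \<in> coset a" "y \<in> coset b" for x y
  proof -
    have "x \<in> J"
      using that csubspace_add[OF J assms(1), of "x - a"] I by (auto simp: mem_coset)
    then have "(x o\<^sub>L (y - b)) + ((x - a) o\<^sub>L b) \<in> I"
      using xy assms by (intro I_add ideal) (auto simp: mem_coset)
    then show ?thesis by (simp add: coset_eq_iff compose_simps)
  qed
  then have "(\<Union>x\<in>coset a. \<Union>y\<in>coset b. coset (x o\<^sub>L y)) = coset (a o\<^sub>L b)"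
    by (rule UN_eq_const(2)[OF self_mem_coset self_mem_coset])
  then show ?thesis by (simp add: quotient_algebra_def)
qed

lemma quot_norm: "anorm quot (coset a) = infdist a I"
proof -
  have "norm ` coset a = dist a ` I"
  proof (intro set_eqI iffI)
    fix r assume "r \<in> norm ` coset a"
    then obtain i where "i \<in> I" "r = norm (a + i)" by (auto simp: coset)
    then have "r = dist a (- i)" "- i \<in> I" by (simp_all add: dist_norm I_minus)
    then show "r \<in> dist a ` I" by blast
  next
    fix r assume "r \<in> dist a ` I"
    then obtain i where "i \<in> I" "r = norm (a + (- i))" by (auto simp: dist_norm)
    then show "r \<in> norm ` coset a" using I_minus unfolding coset by blast
  qed
  then show ?thesis
    using I0 by (simp add: quotient_algebra_def infdist_notempty[of I a] ex_in_conv[symmetric] exI[of _ 0])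
qed

lemma quot_minus: "aminus quot (coset a) (coset b) = coset (a - b)"
  by (simp add: aminus_def quot_scale quot_add)

lemma quot_dist:
  "a \<in> J \<Longrightarrow> b \<in> J \<Longrightarrow> adist quot (coset a) (coset b) = infdist (a - b) I"
  by (simp add: adist_def quot_carrier quot_minus quot_norm)

lemma infdist_less_iff: "infdist x I < e \<longleftrightarrow> (\<exists>q\<in>I. norm (x - q) < e)"
proof -
  have "I \<noteq> {}" using I0 by auto
  moreover have "bdd_below (dist x ` I)" by (rule bdd_belowI2[of _ 0]) simp
  ultimately show ?thesis
    using cINF_less_iff[of I "dist x" e] by (simp add: infdist_notempty dist_norm)
qed

lemma infdist_add: "infdist (a + b) I \<le> infdist a I + infdist b I"
proof (rule field_le_epsilon)
  fix e :: real assume e: "0 < e"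
  obtain p where p: "p \<in> I" "norm (a - p) < infdist a I + e / 2"
    using infdist_less_iff[of a "infdist a I + e / 2"] e by auto
  obtain q where q: "q \<in> I" "norm (b - q) < infdist b I + e / 2"
    using infdist_less_iff[of b "infdist b I + e / 2"] e by auto
  have "infdist (a + b) I \<le> norm (a + b - (p + q))"
    using infdist_le[OF I_add[OF p(1) q(1)], of "a + b"] by (simp add: dist_norm)
  also have "\<dots> \<le> norm (a - p) + norm (b - q)"
    using norm_triangle_ineq[of "a - p" "b - q"] by (simp add: algebra_simps)
  finally show "infdist (a + b) I \<le> infdist a I + infdist b I + e" using p q by simp
qed

lemma infdist_uminus: "infdist (- a) I = infdist a I"
proof -
  have "dist (- a) ` I = dist a ` I"
  proof -
    have "dist (- a) i = dist a (- i)" for i by (metis dist_minus minus_minus)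
    then show ?thesis using I_minus by (auto simp: image_iff) (metis minus_minus)+
  qed
  then show ?thesis by (simp add: infdist_def)
qed

text \<open>Closedness of \<open>I\<close> enters here: distance zero must force two cosets to be
  equal.\<close>

sublocale Metric_space "acarrier quot" "adist quot"
proof
  show "0 \<le> adist quot x y" for x y
    by (cases "x \<in> coset ` J \<and> y \<in> coset ` J")
      (auto simp: quot_dist infdist_nonneg, auto simp: adist_def quot_carrier)
  show "adist quot x y = adist quot y x" for x y
  proof (cases "x \<in> coset ` J \<and> y \<in> coset ` J")
    case True
    then obtain a b where "x = coset a" "y = coset b" "a \<in> J" "b \<in> J" by blast
    then show ?thesis using infdist_uminus[of "a - b"] by (simp add: quot_dist)
  qed (auto simp: adist_def quot_carrier)
  fix x y assume "x \<in> acarrier quot" "y \<in> acarrier quot"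
  then obtain a b where ab: "x = coset a" "y = coset b" "a \<in> J" "b \<in> J" by (auto simp: quot_carrier)
  then show "(adist quot x y = 0) = (x = y)"
    using in_closed_iff_infdist_zero[OF I(2), of "a - b"] I0 by (auto simp: quot_dist coset_eq_iff)
  fix z assume "z \<in> acarrier quot"
  then obtain c where c: "z = coset c" "c \<in> J" by (auto simp: quot_carrier)
  then show "adist quot x z \<le> adist quot x y + adist quot y z"
    using ab infdist_add[of "a - b" "b - c"] by (simp add: quot_dist)
qed

lemma two_sided_mult_quot:
  "a \<in> J \<Longrightarrow> x \<in> J \<Longrightarrow> two_sided_mult quot (coset a) (coset x) = coset (a o\<^sub>L x o\<^sub>L a)"
  by (simp add: two_sided_mult_def quot_mult mult)

context
  fixes Q
  assumes Q: "Q \<in> J" "\<And>x. x \<in> J \<Longrightarrow> \<exists>c. Q o\<^sub>L x o\<^sub>L Q = c *\<^sub>C Q"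
begin

lemma finite_rank_element_single: "finite_rank_element quot (coset Q)"
  unfolding finite_rank_element_def finite_rank_operator_def
proof (intro conjI exI[of _ "{coset Q}"])
  show "coset Q \<in> acarrier quot" using Q by (simp add: quot_carrier)
  then show "{coset Q} \<subseteq> acarrier quot" by simp
  show "two_sided_mult quot (coset Q) ` acarrier quot \<subseteq> alg_span quot {coset Q}"
  proof
    fix y assume "y \<in> two_sided_mult quot (coset Q) ` acarrier quot"
    then obtain x where x: "x \<in> J" "y = coset (Q o\<^sub>L x o\<^sub>L Q)"
      using Q by (auto simp: quot_carrier two_sided_mult_quot)
    obtain c where "Q o\<^sub>L x o\<^sub>L Q = c *\<^sub>C Q" using Q x by blast
    then have "y = ascale quot c (coset Q)" by (simp add: x quot_scale)
    then show "y \<in> alg_span quot {coset Q}" by (auto simp: alg_span_def alg_subspace_def)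
  qed
qed simp

text \<open>The image of the unit ball consists of classes of multiples of \<open>Q\<close> with
  bounded scalars, so it lies in the continuous image of a closed disc.\<close>

lemma compact_element_single: "compact_element quot (coset Q)"
proof (cases "Q = 0")
  case True
  let ?T = "two_sided_mult quot (coset Q) ` {x \<in> acarrier quot. anorm quot x \<le> 1}"
  have "?T \<subseteq> {coset 0}"
    using Q True by (auto simp: quot_carrier two_sided_mult_quot)
  moreover have "coset 0 \<in> acarrier quot" using Q True by (simp add: quot_carrier)
  ultimately have "compactin mtopology {coset 0}" and "?T \<subseteq> {coset 0}"
    by auto
  then have "compactin mtopology (mtopology closure_of ?T)"
    by (meson closed_compactin closedin_closure_of closure_of_minimal compactin_imp_closedin Hausdorff_space_mtopology)
  then show ?thesis
    using \<open>coset 0 \<in> acarrier quot\<close> True by (simp add: compact_element_def compact_operator_def atopology_def)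
next
  case Q0: False
  \<comment> \<open>A class of quotient norm at most 1 need not have a representative of norm at
    most 1, but it has one of norm below 2. For it, \<open>cmod c * norm Q\<close> is at most
    \<open>norm Q * 2 * norm Q\<close>.\<close>
  define K where "K = (\<lambda>c. coset (c *\<^sub>C Q)) ` cball 0 (2 * norm Q)"
  have cJ: "c *\<^sub>C Q \<in> J" for c using J Q csubspace_scale by blast
  have "compactin mtopology K"
    unfolding compactin_sequentially
  proof (intro conjI allI impI)
    show "K \<subseteq> acarrier quot" using cJ by (auto simp: K_def quot_carrier)
    fix \<sigma> :: "nat \<Rightarrow> _" assume "range \<sigma> \<subseteq> K"
    then have "\<forall>n. \<exists>c. c \<in> cball 0 (2 * norm Q) \<and> \<sigma> n = coset (c *\<^sub>C Q)"
      unfolding K_def by (meson imageE rangeI subsetD)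
    then obtain c where c: "\<And>n. c n \<in> cball 0 (2 * norm Q)" "\<And>n. \<sigma> n = coset (c n *\<^sub>C Q)" by metis
    obtain l r where lr: "l \<in> cball 0 (2 * norm Q)" "strict_mono r" "(c \<circ> r) \<longlonglongrightarrow> l"
      using compact_cball[of "0::complex" "2 * norm Q"] c(1) unfolding compact_def by metis
    have "limitin mtopology (\<sigma> \<circ> r) (coset (l *\<^sub>C Q)) sequentially"
      unfolding limitin_metric
    proof (intro conjI allI impI)
      show "coset (l *\<^sub>C Q) \<in> acarrier quot" using cJ by (auto simp: quot_carrier)
      fix e :: real assume e: "0 < e"
      then have "\<forall>\<^sub>F n in sequentially. dist ((c \<circ> r) n) l < e / norm Q"
        using tendstoD[OF lr(3), of "e / norm Q"] Q0 by simp
      then show "\<forall>\<^sub>F n in sequentially. (\<sigma> \<circ> r) n \<in> acarrier quot \<and> adist quot ((\<sigma> \<circ> r) n) (coset (l *\<^sub>C Q)) < e"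
      proof eventually_elim
        case (elim n)
        have "infdist (c (r n) *\<^sub>C Q - l *\<^sub>C Q) I \<le> norm (c (r n) *\<^sub>C Q - l *\<^sub>C Q)"
          using infdist_le[OF I0] by (simp add: dist_norm)
        also have "\<dots> < e"
          using elim Q0 by (simp add: complex_vector.scale_left_diff_distrib[symmetric] norm_scaleC_blinfun dist_norm pos_less_divide_eq)
        finally show ?case using cJ by (auto simp: c quot_dist quot_carrier)
      qed
    qed
    then show "\<exists>l r. l \<in> K \<and> strict_mono r \<and> limitin mtopology (\<sigma> \<circ> r) l sequentially"
      using lr K_def by blast
  qed
  moreover have "two_sided_mult quot (coset Q) ` {x \<in> acarrier quot. anorm quot x \<le> 1} \<subseteq> K"
  proof
    fix y assume "y \<in> two_sided_mult quot (coset Q) ` {x \<in> acarrier quot. anorm quot x \<le> 1}"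
    then obtain x where x: "x \<in> J" "infdist x I \<le> 1" "y = two_sided_mult quot (coset Q) (coset x)"
      by (auto simp: quot_carrier quot_norm)
    then obtain q where q: "q \<in> I" "norm (x - q) < 2"
      using infdist_less_iff[of x 2] by auto
    have xq: "x - q \<in> J" using x q I J csubspace_diff by blast
    have "coset x = coset (x - q)" using q by (simp add: coset_eq_iff)
    then have y: "y = coset (Q o\<^sub>L (x - q) o\<^sub>L Q)"
      using x xq Q by (simp add: two_sided_mult_quot)
    obtain c where c: "Q o\<^sub>L (x - q) o\<^sub>L Q = c *\<^sub>C Q" using Q xq by blast
    have "cmod c * norm Q = norm (Q o\<^sub>L (x - q) o\<^sub>L Q)" by (simp add: c norm_scaleC_blinfun)
    also have "\<dots> \<le> (norm Q * norm (x - q)) * norm Q"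
      by (meson norm_blinfun_compose mult_right_mono norm_ge_zero order_trans)
    also have "\<dots> \<le> (norm Q * 2) * norm Q"
      using q by (intro mult_right_mono mult_left_mono) auto
    finally have "cmod c \<le> 2 * norm Q" using Q0 by simp
    then show "y \<in> K" unfolding K_def y c by auto
  qed
  ultimately have "compactin mtopology (mtopology closure_of (two_sided_mult quot (coset Q) ` {x \<in> acarrier quot. anorm quot x \<le> 1}))"
    by (meson closed_compactin closedin_closure_of closure_of_minimal compactin_imp_closedin Hausdorff_space_mtopology)
  then show ?thesis
    using Q by (simp add: compact_element_def compact_operator_def atopology_def quot_carrier)
qed

end

context
  fixes b X \<delta> C
  assumes b: "b \<in> J" and X: "\<And>i::nat. X i \<in> J" "\<And>i. norm (X i) \<le> C" and \<delta>: "\<delta> > 0"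
    and sep: "\<And>F c q i. finite F \<Longrightarrow> q \<in> I \<Longrightarrow> i \<in> F \<Longrightarrow>
      \<delta> * cmod (c i) \<le> norm ((\<Sum>i\<in>F. c i *\<^sub>C (b o\<^sub>L X i o\<^sub>L b)) - q)"
begin

text \<open>The hypothesis \<open>sep\<close> makes the infinitely many classes of
  \<open>b (X i) b\<close> linearly independent modulo \<open>I\<close>, which is impossible inside
  the image of a finite-dimensional span.\<close>

lemma not_finite_rank_element: "\<not> finite_rank_element quot (coset b)"
proof
  assume "finite_rank_element quot (coset b)"
  then obtain F where F: "finite F" "F \<subseteq> coset ` J"
      "two_sided_mult quot (coset b) ` acarrier quot \<subseteq> alg_span quot F"
    unfolding finite_rank_element_def finite_rank_operator_def quot_carrier by blast
  obtain F' where F': "finite F'" "F' \<subseteq> J" "F = coset ` F'"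
    using finite_subset_image[OF F(1,2)] by blast
  have "alg_subspace quot (coset ` cspan F')"
    unfolding alg_subspace_def
  proof (intro conjI ballI allI)
    show "coset ` cspan F' \<subseteq> acarrier quot"
      using complex_vector.span_minimal[OF F'(2) J] by (auto simp: quot_carrier)
    show "azero quot \<in> coset ` cspan F'"
      using coset_eq_zero_iff[of 0] I0 complex_vector.span_zero by (metis imageI)
    show "aadd quot x y \<in> coset ` cspan F'" if "x \<in> coset ` cspan F'" "y \<in> coset ` cspan F'" for x y
      using that by (auto simp: quot_add intro!: imageI complex_vector.span_add)
    show "ascale quot c x \<in> coset ` cspan F'" if "x \<in> coset ` cspan F'" for c x
      using that by (auto simp: quot_scale intro!: imageI complex_vector.span_scale)
  qed
  then have sub: "alg_span quot F \<subseteq> coset ` cspan F'"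
    unfolding alg_span_def using F' complex_vector.span_superset by blast
  have "\<exists>s\<in>cspan F'. (b o\<^sub>L X i o\<^sub>L b) - s \<in> I" for i
  proof -
    have "two_sided_mult quot (coset b) (coset (X i)) \<in> alg_span quot F"
      using F(3) X(1) by (auto simp: quot_carrier)
    then have "coset (b o\<^sub>L X i o\<^sub>L b) \<in> coset ` cspan F'"
      using sub b X(1) by (auto simp: two_sided_mult_quot)
    then show ?thesis using coset_eq_iff by blast
  qed
  then obtain s where s: "\<And>i. s i \<in> cspan F'" "\<And>i. (b o\<^sub>L X i o\<^sub>L b) - s i \<in> I" by metis
  \<comment> \<open>Each \<open>s i\<close> differs from \<open>b (X i) b\<close> by an element of
    \<open>I\<close>, so a relation among the \<open>s i\<close> puts the same combination of the
    \<open>b (X i) b\<close> into \<open>I\<close>. Taking this combination as \<open>q\<close> in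
    \<open>sep\<close> forces its coefficients to vanish.\<close>
  have z: "c i = 0" if "finite G" "i \<in> G" "(\<Sum>i\<in>G. c i *\<^sub>C s i) = 0" for G c i
  proof -
    have "(\<Sum>i\<in>G. c i *\<^sub>C ((b o\<^sub>L X i o\<^sub>L b) - s i)) \<in> I"
      by (intro complex_vector.subspace_sum I I_scale s)
    then have "(\<Sum>i\<in>G. c i *\<^sub>C (b o\<^sub>L X i o\<^sub>L b)) \<in> I"
      using that(3) by (simp add: complex_vector.scale_right_diff_distrib sum_subtractf)
    from sep[OF that(1) this that(2), of c] show ?thesis
      using \<delta> by (simp add: mult_le_0_iff)
  qed
  have inj: "inj s"
  proof (rule injI, rule ccontr)
    fix i j assume ij: "s i = s j" "i \<noteq> j"
    have "(\<Sum>k\<in>{i, j}. (if k = i then 1 else - 1) *\<^sub>C s k) = 0"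
      using ij by simp
    from z[OF _ _ this, of i] show False by simp
  qed
  have "complex_vector.independent (range s)"
    unfolding complex_vector.independent_explicit_finite_subsets
  proof (intro allI impI ballI)
    fix S c v assume S: "S \<subseteq> range s" "finite S" "(\<Sum>v\<in>S. c v *\<^sub>C v) = 0" "v \<in> S"
    define G where "G = s -` S"
    have G: "finite G" "S = s ` G" using S inj by (auto simp: G_def finite_vimageI)
    have "(\<Sum>i\<in>G. c (s i) *\<^sub>C s i) = 0"
      using S(3) inj unfolding G(2) by (subst (asm) sum.reindex) (auto intro: inj_on_subset)
    from z[OF G(1) _ this] show "c v = 0" using S(4) G(2) by auto
  qed
  then have "finite (range s)"
    using complex_vector.independent_span_bound[OF F'(1), of "range s"] s(1) by auto
  then show False using inj finite_imageD by blast
qed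

text \<open>After scaling into the unit ball the classes of \<open>b (X i) b\<close> stay a fixed
  distance apart, by \<open>sep\<close> for differences of two terms; no subsequence
  converges.\<close>

lemma not_compact_element: "\<not> compact_element quot (coset b)"
proof
  assume "compact_element quot (coset b)"
  then have cp: "compactin mtopology (mtopology closure_of (two_sided_mult quot (coset b) ` {x \<in> acarrier quot. anorm quot x \<le> 1}))"
    by (simp add: compact_element_def compact_operator_def atopology_def)
  \<comment> \<open>The 1 keeps the divisor positive.\<close>
  define D where "D = max C 1"
  have D: "D > 0" "C \<le> D" by (auto simp: D_def)
  define Y where "Y i = inverse (complex_of_real D) *\<^sub>C X i" for i
  have YJ: "Y i \<in> J" for i using X(1) J csubspace_scale unfolding Y_def by blast
  have "norm (Y i) \<le> 1" for i
    using X(2)[of i] D by (simp add: Y_def norm_scaleC_blinfun norm_inverse norm_divide field_simps)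
  then have nY: "infdist (Y i) I \<le> 1" for i
    using infdist_le2[OF I0, of "Y i" 1] by simp
  define p where "p i = b o\<^sub>L Y i o\<^sub>L b" for i
  have pJ: "p i \<in> J" for i using mult b YJ by (simp add: p_def)
  have "range (\<lambda>i. coset (p i)) \<subseteq> two_sided_mult quot (coset b) ` {x \<in> acarrier quot. anorm quot x \<le> 1}"
  proof
    fix x assume "x \<in> range (\<lambda>i. coset (p i))"
    then obtain i where "x = coset (p i)" by blast
    then have "x = two_sided_mult quot (coset b) (coset (Y i))"
      using b YJ by (simp add: two_sided_mult_quot p_def)
    then show "x \<in> two_sided_mult quot (coset b) ` {x \<in> acarrier quot. anorm quot x \<le> 1}"
      using YJ nY by (auto simp: quot_carrier quot_norm)
  qed
  also have "\<dots> \<subseteq> mtopology closure_of \<dots>"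
  proof (rule closure_of_subset)
    show "two_sided_mult quot (coset b) ` {x \<in> acarrier quot. anorm quot x \<le> 1} \<subseteq> topspace mtopology"
      unfolding topspace_mtopology using b by (auto simp: quot_carrier two_sided_mult_quot mult)
  qed
  finally obtain l r where lr: "strict_mono r" "limitin mtopology ((\<lambda>i. coset (p i)) \<circ> r) l sequentially"
    using cp unfolding compactin_sequentially by meson
  define e where "e = \<delta> / D"
  have e: "e > 0" using \<delta> D by (simp add: e_def)
  have lA: "l \<in> acarrier quot" using lr(2) by (simp add: limitin_metric)
  obtain N where N: "\<And>n. n \<ge> N \<Longrightarrow> adist quot (coset (p (r n))) l < e / 2"
    using lr(2) half_gt_zero[OF e] unfolding limitin_metric eventually_sequentially o_def by meson
  define i j where "i = r N" and "j = r (Suc N)"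
  have ij: "i \<noteq> j" using strict_monoD[OF lr(1), of N "Suc N"] by (auto simp: i_def j_def)
  have "adist quot (coset (p i)) (coset (p j)) \<le> adist quot (coset (p i)) l + adist quot l (coset (p j))"
    using pJ lA by (intro triangle) (auto simp: quot_carrier)
  also have "\<dots> < e"
    using N[of N] N[of "Suc N"] commute[of l "coset (p j)"] by (simp add: i_def j_def)
  finally have "infdist (p i - p j) I < e" using pJ by (simp add: quot_dist)
  then obtain q where q: "q \<in> I" "norm (p i - p j - q) < e" using infdist_less_iff by blast
  \<comment> \<open>Opposite coefficients of modulus \<open>1 / D\<close> turn the combination into
    \<open>p i - p j\<close>, so \<open>sep\<close> gives the lower bound
    \<open>\<delta> / D = e\<close>.\<close>
  define c where "c k = (if k = i then inverse (complex_of_real D) else - inverse (complex_of_real D))" for k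
  have bl: "b o\<^sub>L (d *\<^sub>C x) = d *\<^sub>C (b o\<^sub>L x)" for d x
    using b linear bounded_operatorsD by (intro blinfun_eqI) auto
  have "(\<Sum>k\<in>{i, j}. c k *\<^sub>C (b o\<^sub>L X k o\<^sub>L b)) = p i - p j"
    using ij by (simp add: c_def p_def Y_def bl blinfun_compose_scaleC_left)
  then have "\<delta> * cmod (c i) \<le> norm (p i - p j - q)"
    using sep[of "{i, j}" q i c] q(1) by simp
  moreover have "\<delta> * cmod (c i) = e" using D by (simp add: c_def e_def norm_inverse divide_inverse)
  ultimately show False using q(2) by simp
qed

end

end

section \<open>Spectra in ideals with or without a unit\<close>

lemma is_unit_of_unique: "is_unit_of A e \<Longrightarrow> is_unit_of A f \<Longrightarrow> e = f"
  unfolding is_unit_of_def by metis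

lemma aone_eq: "is_unit_of A e \<Longrightarrow> aone A = e"
  unfolding aone_def by (rule the_equality) (auto intro: is_unit_of_unique)

lemma aone_unitization:
  assumes "csubspace J"
  shows "aone (unitization (op_alg J)) = (0, 1)"
  by (rule aone_eq) (auto simp: is_unit_of_def unitization_def csubspace_0[OF assms])

lemma unital_spectrum_op_alg:
  assumes "is_unit_of (op_alg J) e"
  shows "unital_spectrum (op_alg J) T = {l. \<not> (l *\<^sub>C e - T \<in> J \<and>
    (\<exists>y\<in>J. (l *\<^sub>C e - T) o\<^sub>L y = e \<and> y o\<^sub>L (l *\<^sub>C e - T) = e))}"
  by (simp add: unital_spectrum_def ainvertible_def aone_eq[OF assms])

text \<open>The inverse of \<open>(- T, l)\<close> is sought as \<open>(y, t)\<close>: the scalar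
  coordinate of each product must be 1 and its algebra coordinate 0.\<close>

lemma unital_spectrum_unitization:
  assumes J: "csubspace J" and T: "T \<in> J"
  shows "unital_spectrum (unitization (op_alg J)) (T, 0) = {l. \<not> (\<exists>y\<in>J. \<exists>t. l * t = 1 \<and>
    (t *\<^sub>C - T) + (l *\<^sub>C y - (T o\<^sub>L y)) = 0 \<and> (t *\<^sub>C - T) + (l *\<^sub>C y - (y o\<^sub>L T)) = 0)}"
proof -
  have m: "- T \<in> J" using J T complex_vector.subspace_neg by blast
  have um: "(- T) o\<^sub>L y = - (T o\<^sub>L y)" "y o\<^sub>L (- T) = - (y o\<^sub>L T)" for y
    by (auto intro!: blinfun_eqI simp: blinfun.bilinear_simps)
  have sm: "(-1) *\<^sub>C T = - T"
    using complex_vector.scale_minus_left[of 1 T] by simp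
  have "ainvertible (unitization (op_alg J)) (- T, l) \<longleftrightarrow> (\<exists>y\<in>J. \<exists>t. l * t = 1 \<and>
    (t *\<^sub>C - T) + (l *\<^sub>C y - (T o\<^sub>L y)) = 0 \<and> (t *\<^sub>C - T) + (l *\<^sub>C y - (y o\<^sub>L T)) = 0)" for l
    using m unfolding ainvertible_def aone_unitization[OF J]
    by (auto simp: unitization_def um mult.commute algebra_simps)
  moreover have "aminus (unitization (op_alg J)) (ascale (unitization (op_alg J)) l (aone (unitization (op_alg J)))) (T, 0) = (- T, l)" for l
    unfolding aone_unitization[OF J] by (simp add: aminus_def unitization_def sm)
  ultimately show ?thesis unfolding unital_spectrum_def by simp
qed

text \<open>The inverse \<open>R\<close> of \<open>l - T\<close> in \<open>A\<close> is cut down to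
  \<open>J\<close>. If \<open>J\<close> has a unit \<open>e\<close>, then \<open>e R\<close> inverts
  \<open>l e - T\<close>; otherwise \<open>R - 1/l = (1/l) T R\<close> lies in \<open>J\<close> and
  yields the inverse in the unitization.\<close>

lemma (in operator_algebra) aspectrum_ideal_subset:
  assumes J: "csubspace J" "J \<subseteq> A" "\<And>a x. a \<in> A \<Longrightarrow> x \<in> J \<Longrightarrow> a o\<^sub>L x \<in> J" "\<And>a x. a \<in> A \<Longrightarrow> x \<in> J \<Longrightarrow> x o\<^sub>L a \<in> J"
    and T: "T \<in> J"
  shows "aspectrum (op_alg J) T \<subseteq> insert 0 {l. l \<noteq> 0 \<and> \<not> regular T l}"
proof
  fix l assume l: "l \<in> aspectrum (op_alg J) T"
  have False if l0: "l \<noteq> 0" and reg: "regular T l"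
  proof -
    define R where "R = resolvent T l"
    have RA: "R \<in> A" using resolvent_in[OF reg] by (simp add: R_def)
    have R: "(l *\<^sub>C id_blinfun - T) o\<^sub>L R = id_blinfun" "R o\<^sub>L (l *\<^sub>C id_blinfun - T) = id_blinfun"
      using resolvent[OF reg] by (simp_all add: R_def inverse_of_def)
    show False
    proof (cases "unital (op_alg J)")
      case True
      then obtain e where e: "is_unit_of (op_alg J) e" by (auto simp: unital_def)
      then have eJ: "e \<in> J" and ee: "e o\<^sub>L e = e" and eT: "e o\<^sub>L T = T" "T o\<^sub>L e = T"
        using T by (auto simp: is_unit_of_def)
      have eA: "e \<in> A" using eJ J by blast
      have 1: "l *\<^sub>C e - T = e o\<^sub>L (l *\<^sub>C id_blinfun - T)"
        by (simp add: compose_simps eT compose_scaleC[OF eA])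
      have 2: "l *\<^sub>C e - T = (l *\<^sub>C id_blinfun - T) o\<^sub>L e"
        by (simp add: compose_simps eT blinfun_compose_scaleC_left)
      \<comment> \<open>As \<open>e\<close> commutes with \<open>l - T\<close>, it commutes with the
        inverse.\<close>
      have eR: "e o\<^sub>L R = R o\<^sub>L e"
      proof -
        have "e o\<^sub>L R = R o\<^sub>L ((l *\<^sub>C id_blinfun - T) o\<^sub>L e) o\<^sub>L R"
          by (simp add: compose_assoc[symmetric] R)
        also have "\<dots> = R o\<^sub>L e o\<^sub>L ((l *\<^sub>C id_blinfun - T) o\<^sub>L R)"
          using 1 2 by (simp add: compose_assoc)
        finally show ?thesis by (simp add: R)
      qed
      have "(l *\<^sub>C e - T) o\<^sub>L (e o\<^sub>L R) = e"
        unfolding 1 eR by (simp add: compose_assoc R) (simp add: compose_assoc[symmetric] R ee)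
      moreover have "(e o\<^sub>L R) o\<^sub>L (l *\<^sub>C e - T) = e"
        unfolding 2 by (simp add: compose_assoc) (simp add: compose_assoc[symmetric] R ee)
      moreover have "l *\<^sub>C e - T \<in> J"
        using J(1) eJ T by (intro csubspace_diff csubspace_scale)
      moreover have "e o\<^sub>L R \<in> J" using J(4)[OF RA eJ] .
      ultimately show False
        using l True unfolding aspectrum_def unital_spectrum_op_alg[OF e] by auto
    next
      case False
      define y where "y = R - inverse l *\<^sub>C id_blinfun"
      have "l *\<^sub>C R = id_blinfun + (T o\<^sub>L R)"
        using resolvent_mult(1)[OF reg] by (simp add: R_def algebra_simps)
      then have "inverse l *\<^sub>C l *\<^sub>C R = inverse l *\<^sub>C (id_blinfun + (T o\<^sub>L R))" by simp
      then have "R = inverse l *\<^sub>C id_blinfun + inverse l *\<^sub>C (T o\<^sub>L R)"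
        using l0 by (simp add: complex_vector.scale_right_distrib)
      then have "y = inverse l *\<^sub>C (T o\<^sub>L R)"
        unfolding y_def by (metis add_diff_cancel_left')
      then have yJ: "y \<in> J"
        using J(4)[OF RA T] J(1) csubspace_scale by auto
      have TA: "T \<in> A" using T J by blast
      have "(inverse l *\<^sub>C - T) + (l *\<^sub>C y - (T o\<^sub>L y)) = 0"
        using resolvent_mult(1)[OF reg] l0
        by (simp add: y_def R_def compose_simps compose_scaleC[OF TA] complex_vector.scale_right_diff_distrib algebra_simps)
      moreover have "(inverse l *\<^sub>C - T) + (l *\<^sub>C y - (y o\<^sub>L T)) = 0"
        using resolvent_mult(2)[OF reg] l0
        by (simp add: y_def R_def compose_simps blinfun_compose_scaleC_left complex_vector.scale_right_diff_distrib algebra_simps)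
      ultimately show False
        using l False yJ l0 unfolding aspectrum_def unital_spectrum_unitization[OF J(1) T]
        by (auto dest!: bspec[of _ _ y] spec[of _ "inverse l"])
    qed
  qed
  then show "l \<in> insert 0 {l. l \<noteq> 0 \<and> \<not> regular T l}" by blast
qed

text \<open>An eigenvector excludes a left inverse, and an eigenvector of the adjoint, expressed
  through the inner product, excludes a right inverse. If \<open>J\<close> has a unit
  \<open>e\<close>, then \<open>e S = S = S e\<close> shows that \<open>e\<close>, respectively its
  adjoint, fixes the vector.\<close>

lemma eigenvalue_in_aspectrum:
  assumes J: "csubspace J" "J \<subseteq> bounded_operators" and S: "S \<in> J" and l: "l \<noteq> 0"
    and ev: "(\<exists>v. v \<noteq> 0 \<and> blinfun_apply S v = l *\<^sub>C v) \<or> (\<exists>w. w \<noteq> 0 \<and> (\<forall>z. cinner (blinfun_apply S z) w = l * cinner z w))"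
  shows "l \<in> aspectrum (op_alg J) S"
proof (cases "unital (op_alg J)")
  case True
  then obtain e where e: "is_unit_of (op_alg J) e" by (auto simp: unital_def)
  then have eJ: "e \<in> J" and eS: "e o\<^sub>L S = S" "S o\<^sub>L e = S"
    using S by (auto simp: is_unit_of_def)
  have False if y: "y \<in> J" "(l *\<^sub>C e - S) o\<^sub>L y = e" "y o\<^sub>L (l *\<^sub>C e - S) = e" for y
    using ev
  proof (elim disjE exE conjE)
    fix v assume v: "v \<noteq> 0" "blinfun_apply S v = l *\<^sub>C v"
    have "e (S v) = S v" using arg_cong[OF eS(1), of "\<lambda>T. blinfun_apply T v"] by simp
    then have "l *\<^sub>C e v = l *\<^sub>C v"
      using v J eJ bounded_operatorsD by (metis subsetD)
    then have ev: "e v = v" using l by simp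
    then have "(l *\<^sub>C e - S) v = 0" using v by (simp add: blinfun.diff_left)
    then have "e v = 0" using arg_cong[OF y(3), of "\<lambda>T. blinfun_apply T v"] by simp
    then show False using ev v by simp
  next
    fix w assume w: "w \<noteq> 0" "\<forall>z. cinner (blinfun_apply S z) w = l * cinner z w"
    have "l * cinner (e z) w = l * cinner z w" for z
      using w(2) arg_cong[OF eS(2), of "\<lambda>T. blinfun_apply T z"] by (metis blinfun_apply_blinfun_compose)
    then have e1: "cinner (e z) w = cinner z w" for z using l by simp
    have "cinner (e z) w = cinner ((l *\<^sub>C e - S) (y z)) w" for z
      using arg_cong[OF y(2), of "\<lambda>T. blinfun_apply T z"] by simp
    also have "\<dots> z = 0" for z
      using w(2) e1 by (simp add: blinfun.diff_left cinner_simps)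
    finally have "cinner w w = 0" using e1 by metis
    then show False using w cinner_eq_zero_iff by blast
  qed
  then show ?thesis using True unfolding aspectrum_def unital_spectrum_op_alg[OF e] by auto
next
  case False
  have False if y: "y \<in> J" "l * t = 1" "(t *\<^sub>C - S) + (l *\<^sub>C y - (S o\<^sub>L y)) = 0"
      "(t *\<^sub>C - S) + (l *\<^sub>C y - (y o\<^sub>L S)) = 0" for y t
    using ev
  proof (elim disjE exE conjE)
    fix v assume v: "v \<noteq> 0" "blinfun_apply S v = l *\<^sub>C v"
    have "((t *\<^sub>C - S) + (l *\<^sub>C y - (y o\<^sub>L S))) v = - ((l * t) *\<^sub>C v)"
      using v y(1) J(2) bounded_operatorsD[of y] by (auto simp: blinfun.bilinear_simps mult.commute)
    then show False using y v by simp
  next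
    fix w assume w: "w \<noteq> 0" "\<forall>z. cinner (blinfun_apply S z) w = l * cinner z w"
    have "cinner (((t *\<^sub>C - S) + (l *\<^sub>C y - (S o\<^sub>L y))) w) w = - (l * t) * cinner w w"
      using w(2) by (simp add: blinfun.bilinear_simps cinner_simps)
    then show False using y w cinner_eq_zero_iff by auto
  qed
  then show ?thesis using False unfolding aspectrum_def unital_spectrum_unitization[OF J(1) S] by auto
qed

section \<open>Factorization of a shift through a nest algebra element\<close>

locale nest_alg =
  fixes \<N> :: "'h::chilbert_space set set"
  assumes nest: "nest \<N>"
begin

abbreviation "Alg \<equiv> acarrier (nest_algebra \<N>)"

lemma nest_csubspace: "N \<in> \<N> \<Longrightarrow> csubspace N"
  and nest_closed: "N \<in> \<N> \<Longrightarrow> closed N"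
  and nest_linear: "M \<in> \<N> \<Longrightarrow> N \<in> \<N> \<Longrightarrow> M \<subseteq> N \<or> N \<subseteq> M"
  and nest_zero: "{0} \<in> \<N>"
  and nest_UNIV: "UNIV \<in> \<N>"
  and nest_Inter: "F \<subseteq> \<N> \<Longrightarrow> \<Inter>F \<in> \<N>"
  and nest_Sup: "F \<subseteq> \<N> \<Longrightarrow> closure (cspan (\<Union>F)) \<in> \<N>"
  using nest unfolding nest_def by auto

lemma mem_Alg: "T \<in> Alg \<longleftrightarrow> T \<in> bounded_operators \<and> (\<forall>N\<in>\<N>. \<forall>x\<in>N. blinfun_apply T x \<in> N)"
  by (auto simp: nest_algebra_def image_subset_iff)

sublocale operator_algebra Alg
proof
  show "csubspace Alg"
    unfolding complex_vector.subspace_def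
    by (auto simp: mem_Alg bounded_operators_def blinfun.bilinear_simps complex_vector.scale_right_distrib mult.commute
        intro: csubspace_0 csubspace_add csubspace_scale nest_csubspace)
  show "closed Alg" by (rule closed_nest_algebra[OF nest])
qed (auto simp: mem_Alg bounded_operators_def)

lemma Alg_apply: "T \<in> Alg \<Longrightarrow> N \<in> \<N> \<Longrightarrow> x \<in> N \<Longrightarrow> blinfun_apply T x \<in> N"
  by (simp add: mem_Alg)

text \<open>Exactly the condition that the rank one operator
  \<open>z \<mapsto> \<langle>z, v\<rangle> u\<close> belong to the nest algebra.\<close>

definition adm :: "'h \<Rightarrow> 'h \<Rightarrow> bool" where
  "adm u v \<longleftrightarrow> (\<forall>N\<in>\<N>. u \<in> N \<or> v \<in> orthocomp N)"

lemma osum_in_Alg: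
  assumes u: "orthonormal u" and v: "orthonormal v" and c: "\<And>k. cmod (c k) \<le> C"
    and a: "\<And>k. adm (u k) (v k)"
  shows "osum c u v \<in> Alg"
  unfolding mem_Alg
proof (intro conjI ballI)
  show "osum c u v \<in> bounded_operators" by (rule osum_bounded_operators[OF u v c])
  fix N x assume N: "N \<in> \<N>" "x \<in> N"
  show "osum c u v x \<in> N"
  proof (rule sums_in_closed_csubspace[OF nest_csubspace[OF N(1)] nest_closed[OF N(1)] osum_sums[OF u v c]])
    fix k
    have "u k \<in> N \<or> cinner x (v k) = 0"
      using a[of k] N orthocompD(2) unfolding adm_def by blast
    then show "(c k * cinner x (v k)) *\<^sub>C u k \<in> N"
      using csubspace_scale[OF nest_csubspace[OF N(1)]] csubspace_0[OF nest_csubspace[OF N(1)]] by auto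
  qed
qed

lemma osum_osum:
  assumes "orthonormal p" "orthonormal g" "orthonormal h"
  shows "osum (\<lambda>_. 1) p g (osum (\<lambda>_. 1) g h z) = osum (\<lambda>_. 1) p h z"
proof -
  have "osum (\<lambda>_. 1) p g (osum (\<lambda>_. 1) g h z) = (\<Sum>k. (1 * cinner (osum (\<lambda>_. 1) g h z) (g k)) *\<^sub>C p k)"
    by (rule osum_apply[OF assms(1,2), of _ 1]) simp
  also have "\<dots> = (\<Sum>k. (1 * cinner z (h k)) *\<^sub>C p k)"
    by (simp add: cinner_osum[OF assms(2,3), of _ 1])
  also have "\<dots> = osum (\<lambda>_. 1) p h z"
    by (rule osum_apply[OF assms(1,3), of _ 1, symmetric]) simp
  finally show ?thesis .
qed

text \<open>
  With \<open>Y\<^sub>0\<close> mapping \<open>y k\<close> to \<open>g k\<close> up to the scalar \<open>\<langle>b (x k), y k\<rangle>\<close> and \<open>R\<close> mapping \<open>h k\<close> to \<open>x k\<close>, the operator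
  \<open>Y\<^sub>0 b R\<close> is \<open>1 + U\<close> times the wanted shift, where \<open>U\<close> collects the small off-diagonal entries.
\<close>

lemma factor_shift:
  assumes b: "b \<in> Alg" and x: "orthonormal x" and y: "orthonormal y" and g: "orthonormal g" and h: "orthonormal h"
    and e: "e > 0" "\<And>k. e \<le> cmod (cinner (blinfun_apply b (x k)) (y k))"
    and a: "\<And>k. adm (g k) (y k)" "\<And>k. adm (x k) (h k)"
      "\<And>k j. k \<noteq> j \<Longrightarrow> adm (g k) (g j) \<or> cinner (blinfun_apply b (x j)) (y k) = 0"
    and small: "\<And>k j. k \<noteq> j \<Longrightarrow> cmod (cinner (blinfun_apply b (x j)) (y k)) \<le> e / 16 * (1/2)^j * (1/2)^k"
  shows "\<exists>L\<in>Alg. \<exists>R\<in>Alg. L o\<^sub>L b o\<^sub>L R = osum (\<lambda>_. 1) g h"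
proof -
  define t where "t k j = cinner (blinfun_apply b (x j)) (y k)" for k j
  have tkk: "e \<le> cmod (t k k)" for k using e(2) by (simp add: t_def)
  have t0: "t k k \<noteq> 0" for k using tkk[of k] e(1) by auto
  have ti: "cmod (inverse (t k k)) \<le> inverse e" for k
    using tkk[of k] e(1) by (simp add: norm_inverse le_imp_inverse_le)
  define Y0 where "Y0 = osum (\<lambda>k. inverse (t k k)) g y"
  define R where "R = osum (\<lambda>_. 1) x h"
  define X' where "X' = osum (\<lambda>_. 1) x g"
  define P' where "P' = osum (\<lambda>_. 1) g g"
  define S where "S = osum (\<lambda>_. 1) g h"
  define U where "U = (Y0 o\<^sub>L b o\<^sub>L X') - P'"
  define w where "w j = Y0 (b (x j)) - g j" for j
  have one: "cmod ((\<lambda>_. 1) k) \<le> 1" for k :: nat by simp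
  have Y0A: "Y0 \<in> Alg" unfolding Y0_def by (rule osum_in_Alg[OF g y ti a(1)])
  have RA: "R \<in> Alg" unfolding R_def by (rule osum_in_Alg[OF x h one a(2)])
  have w_sums: "(\<lambda>k. (if k = j then 0 else inverse (t k k) * t k j) *\<^sub>C g k) sums w j" for j
  proof -
    have "(\<lambda>k. (inverse (t k k) * cinner (b (x j)) (y k)) *\<^sub>C g k - (if k = j then g k else 0)) sums w j"
      unfolding w_def Y0_def
      by (rule sums_diff[OF osum_sums[OF g y ti] sums_single])
    moreover have "(inverse (t k k) * cinner (b (x j)) (y k)) *\<^sub>C g k - (if k = j then g k else 0)
        = (if k = j then 0 else inverse (t k k) * t k j) *\<^sub>C g k" for k
      using t0[of k] by (auto simp: t_def[symmetric])
    ultimately show ?thesis by simp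
  qed
  have half: "summable (\<lambda>k. (1/2::real)^k)" "(\<Sum>k. (1/2::real)^k) = 2"
    using suminf_geometric[of "1/2::real"] by (auto intro: summable_geometric)
  \<comment> \<open>Dividing the bound \<open>e / 16\<close> by diagonal entries of modulus at least
    \<open>e\<close> leaves 1/16. Summing over \<open>k\<close> doubles it to 1/8, and summing over
    \<open>j\<close> in \<open>nU\<close> doubles it again to 1/4, below 1 as the Neumann series
    requires.\<close>
  have nw: "norm (w j) \<le> (1/8) * (1/2)^j" for j
  proof -
    have "norm ((if k = j then 0 else inverse (t k k) * t k j) *\<^sub>C g k) \<le> (1/16) * (1/2)^j * (1/2)^k" for k
    proof (cases "k = j")
      case False
      have "cmod (inverse (t k k)) * cmod (t k j) \<le> inverse e * (e / 16 * (1/2)^j * (1/2)^k)"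
        using small[OF False] e(1) by (intro mult_mono ti) (auto simp: t_def)
      also have "\<dots> = (1/16) * (1/2)^j * (1/2)^k" using e(1) by simp
      finally show ?thesis using False by (simp add: norm_scaleC orthonormal_norm[OF g] norm_mult)
    qed simp
    then have "norm (\<Sum>k. (if k = j then 0 else inverse (t k k) * t k j) *\<^sub>C g k) \<le> (\<Sum>k. (1/16) * (1/2)^j * (1/2)^k)"
      by (intro norm_suminf_le summable_mult half)
    also have "\<dots> = (1/16) * (1/2)^j * 2"
      using suminf_mult[OF half(1), of "(1/16) * (1/2)^j"] half(2) by simp
    finally show ?thesis using sums_unique[OF w_sums[of j]] by simp
  qed
  have U_sums: "(\<lambda>j. cinner z (g j) *\<^sub>C w j) sums U z" for z
  proof -
    have "(\<lambda>j. (1 * cinner z (g j)) *\<^sub>C x j) sums X' z"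
      unfolding X'_def by (rule osum_sums[OF x g one])
    then have "(\<lambda>j. (Y0 o\<^sub>L b) ((1 * cinner z (g j)) *\<^sub>C x j)) sums (Y0 o\<^sub>L b) (X' z)"
      by (rule bounded_linear.sums[OF blinfun.bounded_linear_right])
    then have 1: "(\<lambda>j. cinner z (g j) *\<^sub>C Y0 (b (x j))) sums (Y0 o\<^sub>L b) (X' z)"
      by (simp add: apply_scaleC b Y0A)
    have "(\<lambda>j. (1 * cinner z (g j)) *\<^sub>C g j) sums P' z"
      unfolding P'_def by (rule osum_sums[OF g g one])
    then have "(\<lambda>j. cinner z (g j) *\<^sub>C Y0 (b (x j)) - cinner z (g j) *\<^sub>C g j) sums ((Y0 o\<^sub>L b) (X' z) - P' z)"
      using 1 by (intro sums_diff) simp_all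
    then show ?thesis
      by (simp add: U_def w_def complex_vector.scale_right_diff_distrib blinfun.diff_left)
  qed
  have nU: "norm U \<le> 1/4"
  proof (rule norm_blinfun_bound)
    fix z
    have "norm (cinner z (g j) *\<^sub>C w j) \<le> (norm z * (1/8)) * (1/2)^j" for j
      unfolding norm_scaleC mult.assoc
      using Cauchy_Schwarz[of z "g j"] by (intro mult_mono nw) (auto simp: orthonormal_norm[OF g])
    then have "norm (\<Sum>j. cinner z (g j) *\<^sub>C w j) \<le> (\<Sum>j. (norm z * (1/8)) * (1/2)^j)"
      by (intro norm_suminf_le summable_mult half)
    also have "\<dots> = 1/4 * norm z"
      using suminf_mult[OF half(1), of "norm z * (1/8)"] half(2) by simp
    finally show "norm (U z) \<le> 1/4 * norm z" using sums_unique[OF U_sums[of z]] by simp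
  qed simp
  \<comment> \<open>The pairs \<open>x k\<close>, \<open>g k\<close> in \<open>X'\<close> and
    \<open>g k\<close>, \<open>g k\<close> in \<open>P'\<close> are not assumed admissible, so
    membership is checked on the entries of \<open>U\<close>. Only off-diagonal ones occur, and by
    \<open>a(3)\<close> each of them is zero or has \<open>adm (g k) (g j)\<close>.\<close>
  have UA: "U \<in> Alg"
    unfolding mem_Alg
  proof (intro conjI ballI)
    have "X' \<in> bounded_operators" "P' \<in> bounded_operators" "Y0 \<in> bounded_operators" "b \<in> bounded_operators"
      using b Y0A mem_Alg osum_bounded_operators[OF x g one] osum_bounded_operators[OF g g one]
      by (auto simp: X'_def P'_def)
    then show "U \<in> bounded_operators"
      by (simp add: bounded_operators_def U_def blinfun.diff_left complex_vector.scale_right_diff_distrib)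
    fix N z assume N: "N \<in> \<N>" "z \<in> N"
    note cs = nest_csubspace[OF N(1)] and cl = nest_closed[OF N(1)]
    show "U z \<in> N"
    proof (rule sums_in_closed_csubspace[OF cs cl U_sums])
      fix j
      show "cinner z (g j) *\<^sub>C w j \<in> N"
      proof (cases "g j \<in> orthocomp N")
        case True
        then show ?thesis
          using orthocompD(2)[OF True N(2)] csubspace_0[OF cs] by simp
      next
        case False
        have "w j \<in> N"
        proof (rule sums_in_closed_csubspace[OF cs cl w_sums])
          fix k
          show "(if k = j then 0 else inverse (t k k) * t k j) *\<^sub>C g k \<in> N"
          proof (cases "k = j \<or> t k j = 0")
            case True
            then show ?thesis using csubspace_0[OF cs] by auto
          next
            case kj: False
            then have "g k \<in> N" using a(3)[of k j] False N(1) by (auto simp: t_def adm_def)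
            then show ?thesis using csubspace_scale[OF cs] kj by simp
          qed
        qed
        then show ?thesis by (rule csubspace_scale[OF cs])
      qed
    qed
  qed
  obtain V where V: "V \<in> Alg" "V o\<^sub>L (id_blinfun - (- U)) = id_blinfun"
    using Neumann[OF uminus[OF UA]] nU by (auto simp: inverse_of_def)
  \<comment> \<open>\<open>S\<close> has its range where \<open>P'\<close> is the identity, and
    \<open>X'\<close> carries the \<open>g k\<close> to the \<open>x k\<close>.\<close>
  have "(id_blinfun + U) o\<^sub>L S = Y0 o\<^sub>L b o\<^sub>L R"
  proof (rule blinfun_eqI)
    fix z
    have "X' (S z) = R z" "P' (S z) = S z"
      unfolding X'_def P'_def R_def S_def using osum_osum x g h by auto
    then show "((id_blinfun + U) o\<^sub>L S) z = (Y0 o\<^sub>L b o\<^sub>L R) z"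
      by (simp add: U_def blinfun.bilinear_simps)
  qed
  then have "V o\<^sub>L (Y0 o\<^sub>L b o\<^sub>L R) = S"
    using V(2) by (metis compose_assoc compose_id(1) diff_minus_eq_add)
  then have "(V o\<^sub>L Y0) o\<^sub>L b o\<^sub>L R = S" by (simp add: compose_assoc)
  then show ?thesis using compose[OF V(1) Y0A] RA unfolding S_def by blast
qed

text \<open>Rows and columns of the matrix of entries both tend to 0, the former by Bessel for
  \<open>y\<close>, the latter by \<open>orthonormal_image_weakly_tendsto\<close>, so indices can be
  picked greedily.\<close>

lemma almost_diagonal_subsequence:
  fixes x y :: "nat \<Rightarrow> 'h"
  assumes b: "b \<in> bounded_operators" and x: "orthonormal x" and y: "orthonormal y" and e: "e > 0"
  shows "\<exists>r. strict_mono r \<and> (\<forall>j k. j \<noteq> k \<longrightarrow>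
    cmod (cinner (blinfun_apply b (x (r j))) (y (r k))) \<le> e * (1/2)^j * (1/2)^k)"
proof -
  define t where "t j k = cmod (cinner (blinfun_apply b (x j)) (y k))" for j k
  \<comment> \<open>The base 1/4 leaves a factor 1/2 for each of the two indices:
    \<open>(1/4)^k \<le> (1/2)^j * (1/2)^k\<close> for \<open>j < k\<close>.\<close>
  have "\<exists>n. \<forall>k\<ge>n. \<forall>j\<le>m. t j k \<le> e * (1/4)^Suc m \<and> t k j \<le> e * (1/4)^Suc m" for m
  proof -
    have "\<forall>\<^sub>F k in sequentially. t j k < e * (1/4)^Suc m \<and> t k j < e * (1/4)^Suc m" for j
    proof (rule eventually_conj)
      have "(\<lambda>k. t j k) \<longlonglongrightarrow> 0"
        unfolding t_def using tendsto_norm[OF orthonormal_tendsto_left[OF y]] by simp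
      then show "\<forall>\<^sub>F k in sequentially. t j k < e * (1/4)^Suc m"
        using e by (intro order_tendstoD) auto
      have "(\<lambda>k. t k j) \<longlonglongrightarrow> 0"
        unfolding t_def using tendsto_norm[OF orthonormal_image_weakly_tendsto[OF x b]] by simp
      then show "\<forall>\<^sub>F k in sequentially. t k j < e * (1/4)^Suc m"
        using e by (intro order_tendstoD) auto
    qed
    then have "\<forall>\<^sub>F k in sequentially. \<forall>j\<in>{..m}. t j k < e * (1/4)^Suc m \<and> t k j < e * (1/4)^Suc m"
      by (intro eventually_ball_finite) auto
    then obtain n where "\<And>k j. k \<ge> n \<Longrightarrow> j \<le> m \<Longrightarrow> t j k < e * (1/4)^Suc m \<and> t k j < e * (1/4)^Suc m"
      unfolding eventually_sequentially by (auto simp del: power_Suc)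
    then show ?thesis by (intro exI[of _ n]) (auto intro: less_imp_le simp del: power_Suc)
  qed
  then obtain n where n: "\<And>m k j. k \<ge> n m \<Longrightarrow> j \<le> m \<Longrightarrow> t j k \<le> e * (1/4)^Suc m \<and> t k j \<le> e * (1/4)^Suc m"
    by metis
  define r where "r = rec_nat 0 (\<lambda>_ m. max (n m) (Suc m))"
  have r: "r (Suc k) = max (n (r k)) (Suc (r k))" for k by (simp add: r_def)
  have mono: "strict_mono r" by (rule strict_mono_Suc_iff[THEN iffD2]) (simp add: r less_max_iff_disj)
  have *: "t (r j) (r k) \<le> e * (1/2)^j * (1/2)^k \<and> t (r k) (r j) \<le> e * (1/2)^j * (1/2)^k" if jk: "j < k" for j k
  proof -
    obtain k' where k': "k = Suc k'" using jk by (cases k) auto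
    have "r j \<le> r k'" using jk k' mono by (simp add: strict_mono_less_eq)
    moreover have "r k \<ge> n (r k')" by (simp add: k' r)
    ultimately have 1: "t (r j) (r k) \<le> e * (1/4)^Suc (r k') \<and> t (r k) (r j) \<le> e * (1/4)^Suc (r k')"
      by (rule n[rotated])
    have "k \<le> Suc (r k')" using strict_mono_imp_increasing[OF mono, of k'] k' by simp
    then have "(1/4::real)^Suc (r k') \<le> (1/4)^k" by (intro power_decreasing) auto
    also have "(1/4::real)^k = (1/2)^k * (1/2)^k" by (simp add: power_mult_distrib[symmetric])
    also have "\<dots> \<le> (1/2)^j * (1/2)^k" using that by (intro mult_right_mono power_decreasing) auto
    finally have "e * (1/4)^Suc (r k') \<le> e * ((1/2)^j * (1/2)^k)"
      using e by (intro mult_left_mono) auto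
    then show ?thesis using 1 by (simp only: mult.assoc) linarith
  qed
  show ?thesis
  proof (intro exI[of _ r] conjI mono allI impI)
    fix j k :: nat assume "j \<noteq> k"
    then show "cmod (cinner (blinfun_apply b (x (r j))) (y (r k))) \<le> e * (1/2)^j * (1/2)^k"
      using *[of j k] *[of k j] unfolding t_def[symmetric]
      by (cases "j < k") (auto simp: mult_ac)
  qed
qed

text \<open>The operator taking \<open>h k\<close> to \<open>g k\<close> is the backward shift along
  \<open>f\<close> in the first alternative and the forward shift in the second. The tail condition
  is what makes entries of corner operators vanish far out along \<open>f\<close>.\<close>

definition shift_data :: "(nat \<Rightarrow> 'h) \<Rightarrow> (nat \<Rightarrow> 'h) \<Rightarrow> (nat \<Rightarrow> 'h) \<Rightarrow> bool" where
  "shift_data f g h \<longleftrightarrow> orthonormal f \<and> (\<forall>k. adm (g k) (h k)) \<and>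
     (g = f \<and> h = f \<circ> Suc \<or> g = f \<circ> Suc \<and> h = f) \<and>
     (\<forall>N\<in>\<N>. (\<forall>\<^sub>F k in sequentially. f k \<in> N) \<or> (\<forall>\<^sub>F k in sequentially. f k \<in> orthocomp N))"

text \<open>Read \<open>lt i j\<close> as saying that \<open>x i\<close> lies below
  \<open>x j\<close> in the nest. Sequences going up and going down are thus handled together, and
  the shift produced always sends the upper neighbour to the lower one.\<close>

lemma shift_factorization:
  fixes x y :: "nat \<Rightarrow> 'h" and lt :: "nat \<Rightarrow> nat \<Rightarrow> bool"
  assumes b: "b \<in> Alg" and x: "orthonormal x" and y: "orthonormal y"
    and e: "e > 0" "\<And>k. e \<le> cmod (cinner (blinfun_apply b (x k)) (y k))"
    and lt: "lt = (<) \<or> lt = (>)"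
    and a: "\<And>i j. lt i j \<Longrightarrow> adm (x i) (x j)" "\<And>i j. lt i j \<Longrightarrow> adm (x i) (y j)"
      "\<And>i j. lt i j \<Longrightarrow> cinner (blinfun_apply b (x i)) (y j) = 0"
    and tail: "\<And>N. N \<in> \<N> \<Longrightarrow> (\<forall>\<^sub>F k in sequentially. x k \<in> N) \<or> (\<forall>\<^sub>F k in sequentially. x k \<in> orthocomp N)"
  shows "\<exists>f g h. shift_data f g h \<and> (\<exists>L\<in>Alg. \<exists>R\<in>Alg. L o\<^sub>L b o\<^sub>L R = osum (\<lambda>_. 1) g h)"
proof -
  have bb: "b \<in> bounded_operators" using b mem_Alg by blast
  have "e / 16 > 0" using e by simp
  then obtain r where r: "strict_mono r"
    "\<And>j k. j \<noteq> k \<Longrightarrow> cmod (cinner (blinfun_apply b (x (r j))) (y (r k))) \<le> e / 16 * (1/2)^j * (1/2)^k"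
    using almost_diagonal_subsequence[OF bb x y] by metis
  txt \<open>Interleaving the indices makes room for \<open>g k\<close> and \<open>h k\<close> on either side of \<open>x\<close> and \<open>y\<close> in the nest.\<close>
  define f where "f = (\<lambda>k. x (r (2 * k)))"
  define p where "p = (\<lambda>k. x (r (2 * k + 1)))"
  define q where "q = (\<lambda>k. y (r (2 * k + 1)))"
  define g where "g = (if lt = (<) then f else f \<circ> Suc)"
  define h where "h = (if lt = (<) then f \<circ> Suc else f)"
  have inj: "inj (\<lambda>k. r (2 * k))" "inj (\<lambda>k. r (2 * k + 1))" "inj (\<lambda>k. r (2 * Suc k))"
    by (auto simp: inj_on_def strict_mono_eq[OF r(1)])
  have f: "orthonormal f" and p: "orthonormal p" and q: "orthonormal q" and fS: "orthonormal (f \<circ> Suc)"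
    unfolding f_def p_def q_def o_def
    using orthonormal_compose[OF x inj(1)] orthonormal_compose[OF x inj(2)]
      orthonormal_compose[OF y inj(2)] orthonormal_compose[OF x inj(3)] by simp_all
  have gh: "orthonormal g" "orthonormal h" using f fS by (auto simp: g_def h_def)
  have lt_r: "lt (r i) (r j) \<longleftrightarrow> lt i j" for i j using lt r(1) by (auto simp: strict_mono_less)
  note defs = f_def p_def q_def g_def h_def
  have ax: "lt i j \<Longrightarrow> adm (x (r i)) (x (r j))" and ay: "lt i j \<Longrightarrow> adm (x (r i)) (y (r j))" for i j
    by (simp_all add: a lt_r)
  have gt: "lt = (>)" if "lt \<noteq> (<)" using lt that by blast
  have 1: "adm (g k) (q k)" for k
    using ay[of "2 * k" "2 * k + 1"] ay[of "2 * Suc k" "2 * k + 1"] gt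
    by (cases "lt = (<)") (simp_all add: defs)
  have 2: "adm (p k) (h k)" for k
    using ax[of "2 * k + 1" "2 * Suc k"] ax[of "2 * k + 1" "2 * k"] gt
    by (cases "lt = (<)") (simp_all add: defs)
  have 3: "adm (g k) (g j) \<or> cinner (blinfun_apply b (p j)) (q k) = 0" if "k \<noteq> j" for k j
  proof (cases "lt k j")
    case True
    then have "adm (g k) (g j)"
      using ax[of "2 * k" "2 * j"] ax[of "2 * Suc k" "2 * Suc j"] gt
      by (cases "lt = (<)") (simp_all add: defs)
    then show ?thesis by simp
  next
    case False
    \<comment> \<open>For distinct indices the failure of \<open>lt k j\<close> means
      \<open>lt j k\<close>, where the entry is zero by hypothesis.\<close>
    then have "lt (r (2 * j + 1)) (r (2 * k + 1))"
      using lt that unfolding lt_r by auto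
    then show ?thesis unfolding defs using a(3) by blast
  qed
  have 4: "cmod (cinner (blinfun_apply b (p j)) (q k)) \<le> e / 16 * (1/2)^j * (1/2)^k" if "k \<noteq> j" for k j
  proof -
    have "cmod (cinner (blinfun_apply b (p j)) (q k)) \<le> e / 16 * (1/2)^(2*j+1) * (1/2)^(2*k+1)"
      unfolding p_def q_def using that by (intro r(2)) auto
    also have "\<dots> \<le> e / 16 * (1/2)^j * (1/2)^k"
      using e(1) by (intro mult_mono power_decreasing mult_left_mono) auto
    finally show ?thesis .
  qed
  have 5: "\<exists>L\<in>Alg. \<exists>R\<in>Alg. L o\<^sub>L b o\<^sub>L R = osum (\<lambda>_. 1) g h"
    by (rule factor_shift[OF b p q gh e(1) _ 1 2 3 4]) (auto simp: p_def q_def e(2))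
  have "adm (g k) (h k)" for k
    using ax[of "2 * k" "2 * Suc k"] ax[of "2 * Suc k" "2 * k"] gt
    by (cases "lt = (<)") (simp_all add: defs)
  moreover have "(\<forall>\<^sub>F k in sequentially. f k \<in> N) \<or> (\<forall>\<^sub>F k in sequentially. f k \<in> orthocomp N)" if "N \<in> \<N>" for N
  proof -
    have "filterlim (\<lambda>k. r (2 * k)) sequentially sequentially"
      using r(1) by (intro filterlim_subseq) (auto simp: strict_mono_def)
    then show ?thesis
      using tail[OF that] eventually_compose_filterlim[of "\<lambda>k. x k \<in> N"]
        eventually_compose_filterlim[of "\<lambda>k. x k \<in> orthocomp N"] unfolding f_def by blast
  qed
  ultimately have "shift_data f g h"
    unfolding shift_data_def using f by (auto simp: g_def h_def)
  then show ?thesis using 5 by blast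
qed

end

section \<open>The closed span of the elementary operators of an ideal\<close>

locale nest_ideal = nest_alg \<N> for \<N> :: "'h::chilbert_space set set" +
  fixes J :: "('h \<Rightarrow>\<^sub>L 'h) set"
  assumes J: "csubspace J" "closed J" "J \<subseteq> Alg"
    and ideal: "\<And>a x. a \<in> Alg \<Longrightarrow> x \<in> J \<Longrightarrow> a o\<^sub>L x \<in> J" "\<And>a x. a \<in> Alg \<Longrightarrow> x \<in> J \<Longrightarrow> x o\<^sub>L a \<in> J"
begin

text \<open>Range inside \<open>M\<close> together with vanishing on \<open>M\<close> expresses
  \<open>Q = P Q (1 - P)\<close> for the projection \<open>P\<close> onto \<open>M\<close>.\<close>

definition elementary :: "('h \<Rightarrow>\<^sub>L 'h) set" where
  "elementary = {Q \<in> J. (\<exists>M\<in>\<N>. (\<forall>z. blinfun_apply Q z \<in> M) \<and> (\<forall>z\<in>M. blinfun_apply Q z = 0)) \<or>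
     (\<exists>u. \<forall>z. \<exists>c. blinfun_apply Q z = c *\<^sub>C u)}"

lemma elementaryI_rank_one:
  "Q \<in> J \<Longrightarrow> (\<And>z. \<exists>c. blinfun_apply Q z = c *\<^sub>C u) \<Longrightarrow> Q \<in> elementary"
  unfolding elementary_def by blast

definition core :: "('h \<Rightarrow>\<^sub>L 'h) set" where
  "core = closure (cspan elementary)"

lemma elementary_J: "elementary \<subseteq> J" by (auto simp: elementary_def)

lemma core_closed: "closed core" by (simp add: core_def)

lemma core_csubspace: "csubspace core"
  unfolding core_def by (intro csubspace_closure complex_vector.subspace_span bounded_linear_scaleC_blinfun)

lemma elementary_core: "elementary \<subseteq> core"
  unfolding core_def using complex_vector.span_superset closure_subset by blast

lemma core_J: "core \<subseteq> J"
  unfolding core_def by (intro closure_minimal complex_vector.span_minimal elementary_J J)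

lemma elementary_compose:
  assumes a: "a \<in> Alg" and Q: "Q \<in> elementary"
  shows "a o\<^sub>L Q \<in> elementary" "Q o\<^sub>L a \<in> elementary"
proof -
  have QJ: "Q \<in> J" using Q elementary_J by blast
  have QJ': "a o\<^sub>L Q \<in> J" "Q o\<^sub>L a \<in> J" using ideal a QJ by blast+
  from Q consider M where "M \<in> \<N>" "\<And>z. blinfun_apply Q z \<in> M" "\<And>z. z \<in> M \<Longrightarrow> blinfun_apply Q z = 0"
    | u where "\<And>z. \<exists>c. blinfun_apply Q z = c *\<^sub>C u"
    unfolding elementary_def by blast
  then have "a o\<^sub>L Q \<in> elementary \<and> Q o\<^sub>L a \<in> elementary"
  proof cases
    case 1
    have "(\<forall>z. (a o\<^sub>L Q) z \<in> M) \<and> (\<forall>z\<in>M. (a o\<^sub>L Q) z = 0)"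
      "(\<forall>z. (Q o\<^sub>L a) z \<in> M) \<and> (\<forall>z\<in>M. (Q o\<^sub>L a) z = 0)"
      using 1 Alg_apply[OF a 1(1)] by (auto simp: blinfun.zero_right)
    then show ?thesis
      unfolding elementary_def using QJ' 1(1) by blast+
  next
    case 2
    have "\<exists>c. (a o\<^sub>L Q) z = c *\<^sub>C a u" "\<exists>c. (Q o\<^sub>L a) z = c *\<^sub>C u" for z
      using 2[of z] 2[of "a z"] by (auto simp: apply_scaleC[OF a])
    then show ?thesis
      unfolding elementary_def using QJ' by blast+
  qed
  then show "a o\<^sub>L Q \<in> elementary" "Q o\<^sub>L a \<in> elementary" by auto
qed

lemma image_core:
  assumes "bounded_linear F" "\<And>c T. T \<in> J \<Longrightarrow> F (c *\<^sub>C T) = c *\<^sub>C F T" "\<And>Q. Q \<in> elementary \<Longrightarrow> F Q \<in> elementary"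
    and x: "x \<in> core"
  shows "F x \<in> core"
proof -
  have spJ: "cspan elementary \<subseteq> J" by (intro complex_vector.span_minimal elementary_J J)
  have sp: "F y \<in> cspan elementary" if "y \<in> cspan elementary" for y
  proof -
    have "y \<in> J \<and> F y \<in> cspan elementary"
      using that
    proof (induction rule: complex_vector.span_induct_alt)
      case base
      then show ?case
        using J(1) csubspace_0 complex_vector.span_zero linear_0[OF bounded_linear.linear[OF assms(1)]] by metis
    next
      case (step c y z)
      have yJ: "y \<in> J" using step elementary_J by blast
      have "c *\<^sub>C y + z \<in> J"
        using step J(1) yJ by (intro csubspace_add csubspace_scale) auto
      moreover have "F (c *\<^sub>C y + z) = c *\<^sub>C F y + F z"
        by (simp add: linear_add[OF bounded_linear.linear[OF assms(1)]] assms(2)[OF yJ])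
      ultimately show ?case
        using step assms(3) by (auto intro!: complex_vector.span_add complex_vector.span_scale intro: complex_vector.span_base)
    qed
    then show ?thesis by blast
  qed
  obtain f where f: "\<And>n. f n \<in> cspan elementary" "f \<longlonglongrightarrow> x"
    using x by (auto simp: core_def closure_sequential)
  have "(\<lambda>n. F (f n)) \<longlonglongrightarrow> F x" by (rule bounded_linear.tendsto[OF assms(1) f(2)])
  then show ?thesis unfolding core_def closure_sequential
    by (intro exI[of _ "\<lambda>n. F (f n)"] conjI allI sp f(1))
qed

lemma core_ideal:
  assumes "a \<in> Alg" "x \<in> core"
  shows "a o\<^sub>L x \<in> core" "x o\<^sub>L a \<in> core"
proof -
  show "a o\<^sub>L x \<in> core"
    by (rule image_core[OF bounded_bilinear.bounded_linear_right[OF bounded_bilinear_blinfun_compose] _ _ assms(2)])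
      (simp_all add: compose_scaleC[OF assms(1)] elementary_compose assms(1))
  show "x o\<^sub>L a \<in> core"
    by (rule image_core[OF bounded_bilinear.bounded_linear_left[OF bounded_bilinear_blinfun_compose] _ _ assms(2)])
      (simp_all add: blinfun_compose_scaleC_left elementary_compose assms(1))
qed

text \<open>In the corner case \<open>Q Y Q = 0\<close>: \<open>Y\<close> keeps the range of
  \<open>Q\<close> inside \<open>M\<close>, and \<open>Q\<close> kills \<open>M\<close>.\<close>

lemma single_elementary:
  assumes "Q \<in> elementary"
  shows "single Q"
proof -
  have QA: "Q \<in> Alg" using assms elementary_J J by blast
  from assms consider M where "M \<in> \<N>" "\<And>z. blinfun_apply Q z \<in> M" "\<And>z. z \<in> M \<Longrightarrow> blinfun_apply Q z = 0"
    | u where "\<And>z. \<exists>c. blinfun_apply Q z = c *\<^sub>C u"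
    unfolding elementary_def by blast
  then show ?thesis
  proof cases
    case 1
    show ?thesis
    proof (rule single_zero_product[OF QA])
      fix Y assume "Y \<in> Alg"
      then show "Q o\<^sub>L Y o\<^sub>L Q = 0"
        using 1 Alg_apply by (intro blinfun_eqI) auto
    qed
  next
    case 2
    then show ?thesis by (rule single_rank_one[OF QA])
  qed
qed

lemma J_mult: "x \<in> J \<Longrightarrow> y \<in> J \<Longrightarrow> x o\<^sub>L y \<in> J"
  using ideal J by blast

lemma quotient_by_ideal:
  assumes "closed_ideal (op_alg J) I"
  shows "quotient_by_ideal J I"
  using assms J J_mult bounded_operators
  by unfold_locales (auto simp: closed_ideal_op_alg)

lemma closed_ideal_core: "closed_ideal (op_alg J) core"
  using J core_J core_csubspace core_closed core_ideal by (auto simp: closed_ideal_op_alg)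

text \<open>A closed ideal of \<open>J\<close> that contains all elementary operators contains
  \<open>core\<close> and hence \<open>J\<close>. So a proper one misses some elementary
  \<open>Q\<close>, whose class is the nonzero element sought.\<close>

lemma hypofinite_hypocompact_if:
  assumes "J \<subseteq> core"
  shows "hypofinite (op_alg J)" "hypocompact (op_alg J)"
proof -
  have "\<exists>Q. Q \<in> J \<and> (\<forall>x\<in>J. \<exists>c. Q o\<^sub>L x o\<^sub>L Q = c *\<^sub>C Q) \<and> Q \<notin> I"
    if I: "closed_ideal (op_alg J) I" "I \<noteq> J" for I
  proof -
    have I': "I \<subseteq> J" "csubspace I" "closed I" using I J by (auto simp: closed_ideal_op_alg)
    have "\<not> elementary \<subseteq> I"
    proof
      assume "elementary \<subseteq> I"
      then have "core \<subseteq> I" unfolding core_def using I' by (intro closure_minimal complex_vector.span_minimal)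
      then show False using assms I' I by blast
    qed
    then obtain Q where Q: "Q \<in> elementary" "Q \<notin> I" by blast
    have "\<forall>x\<in>J. \<exists>c. Q o\<^sub>L x o\<^sub>L Q = c *\<^sub>C Q"
      using single_elementary[OF Q(1)] J unfolding single_def by blast
    then show ?thesis using Q elementary_J by blast
  qed
  note ex = this
  show "hypofinite (op_alg J)"
    unfolding hypofinite_def
  proof (intro allI impI)
    fix I assume "closed_ideal (op_alg J) I \<and> I \<noteq> acarrier (op_alg J)"
    then have cI: "closed_ideal (op_alg J) I" "I \<noteq> J" by auto
    interpret quotient_by_ideal J I by (rule quotient_by_ideal[OF cI(1)])
    from ex[OF cI] obtain Q where "Q \<in> J" "\<And>x. x \<in> J \<Longrightarrow> \<exists>c. Q o\<^sub>L x o\<^sub>L Q = c *\<^sub>C Q" "Q \<notin> I" by blast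
    then show "\<exists>a. finite_rank_element (quotient_algebra (op_alg J) I) a \<and> a \<noteq> azero (quotient_algebra (op_alg J) I)"
      using finite_rank_element_single[of Q] coset_eq_zero_iff[of Q] by blast
  qed
  show "hypocompact (op_alg J)"
    unfolding hypocompact_def
  proof (intro allI impI)
    fix I assume "closed_ideal (op_alg J) I \<and> I \<noteq> acarrier (op_alg J)"
    then have cI: "closed_ideal (op_alg J) I" "I \<noteq> J" by auto
    interpret quotient_by_ideal J I by (rule quotient_by_ideal[OF cI(1)])
    from ex[OF cI] obtain Q where "Q \<in> J" "\<And>x. x \<in> J \<Longrightarrow> \<exists>c. Q o\<^sub>L x o\<^sub>L Q = c *\<^sub>C Q" "Q \<notin> I" by blast
    then show "\<exists>a. compact_element (quotient_algebra (op_alg J) I) a \<and> a \<noteq> azero (quotient_algebra (op_alg J) I)"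
      using compact_element_single[of Q] coset_eq_zero_iff[of Q] by blast
  qed
qed

lemma scattered_if:
  assumes "J \<subseteq> core"
  shows "scattered (op_alg J)"
  unfolding scattered_def
proof
  fix T assume "T \<in> acarrier (op_alg J)"
  then have T: "T \<in> J" by simp
  have "countable {l. l \<noteq> 0 \<and> \<not> regular T l}"
    by (rule countable_singular_closure_span[of elementary])
      (use T assms J in \<open>auto simp: single_elementary core_def\<close>)
  then show "countable (aspectrum (op_alg J) T)"
    by (intro countable_subset[OF aspectrum_ideal_subset[OF J(1,3) ideal T]]) auto
qed

section \<open>Consequences of a shift factorization\<close>

context
  fixes b f g h L R
  assumes b: "b \<in> J" and sd: "shift_data f g h" and LR: "L \<in> Alg" "R \<in> Alg" "L o\<^sub>L b o\<^sub>L R = osum (\<lambda>_. 1) g h"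
begin

lemma shift_orthonormal: "orthonormal f" "orthonormal g" "orthonormal h"
proof -
  show f: "orthonormal f" using sd by (simp add: shift_data_def)
  have "orthonormal (f \<circ> Suc)" using f by (simp add: orthonormal_def)
  then show "orthonormal g" "orthonormal h" using f sd by (auto simp: shift_data_def)
qed

abbreviation "shift_op \<equiv> osum (\<lambda>_. 1) g h"

lemma shift_in_J: "shift_op \<in> J"
  using LR ideal b by metis

text \<open>Geometric vectors \<open>\<Sum>k. m^k *\<^sub>C f k\<close> do it: \<open>m = l\<close>
  gives an eigenvector of the backward shift, \<open>m = cnj l\<close> an eigenvector of the adjoint
  of the forward shift.\<close>

lemma shift_eigenvalue:
  assumes l: "cmod l < 1"
  shows "(\<exists>v. v \<noteq> 0 \<and> blinfun_apply shift_op v = l *\<^sub>C v) \<or> (\<exists>w. w \<noteq> 0 \<and> (\<forall>z. cinner (blinfun_apply shift_op z) w = l * cinner z w))"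
proof -
  note f = shift_orthonormal(1) and g = shift_orthonormal(2) and h = shift_orthonormal(3)
  have S_sums: "(\<lambda>k. cinner z (h k) *\<^sub>C g k) sums shift_op z" for z
    using osum_sums[OF g h, of "\<lambda>_. 1" 1 z] by simp
  have geo: "\<exists>v. (\<lambda>k. m^k *\<^sub>C f k) sums v \<and> (\<forall>j. cinner v (f j) = m^j)" if "cmod m < 1" for m
  proof -
    have "summable (\<lambda>k. ((cmod m)\<^sup>2)^k)"
      using that by (intro summable_geometric) (simp add: power_less_one_iff abs_square_less_1)
    then have "summable (\<lambda>k. (cmod (m^k))\<^sup>2)"
      by (simp add: norm_power power_mult[symmetric] mult.commute)
    then have "(\<lambda>k. m^k *\<^sub>C f k) sums (\<Sum>k. m^k *\<^sub>C f k)"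
      by (intro summable_sums summable_orthonormal f)
    moreover have "cinner v (f j) = m^j" if v: "(\<lambda>k. m^k *\<^sub>C f k) sums v" for v j
    proof -
      have "(\<lambda>k. cinner (m^k *\<^sub>C f k) (f j)) sums cinner v (f j)"
        by (rule bounded_linear.sums[OF bounded_linear_cinner_left v])
      moreover have "(\<lambda>k. cinner (m^k *\<^sub>C f k) (f j)) = (\<lambda>k. if k = j then m^k else 0)"
        by (auto simp: cinner_simps orthonormalD[OF f])
      ultimately show ?thesis using sums_single[of j "\<lambda>k. m^k"] by (simp add: sums_unique2)
    qed
    ultimately show ?thesis by blast
  qed
  from sd consider "g = f" "h = f \<circ> Suc" | "g = f \<circ> Suc" "h = f" by (auto simp: shift_data_def)
  then show ?thesis
  proof cases
    case 1
    obtain v where v: "(\<lambda>k. l^k *\<^sub>C f k) sums v" "\<And>j. cinner v (f j) = l^j" using geo[OF l] by blast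
    have "(\<lambda>k. l *\<^sub>C (l^k *\<^sub>C f k)) sums (l *\<^sub>C v)"
      by (rule bounded_linear.sums[OF bounded_linear_scaleC v(1)])
    then have "(\<lambda>k. cinner v (h k) *\<^sub>C g k) sums (l *\<^sub>C v)" using v(2) 1 by simp
    then have "shift_op v = l *\<^sub>C v" by (rule sums_unique2[OF S_sums])
    moreover have "v \<noteq> 0" using v(2)[of 0] by auto
    ultimately show ?thesis by blast
  next
    case 2
    have "cmod (cnj l) < 1" using l by simp
    from geo[OF this] obtain w where w: "(\<lambda>k. cnj l^k *\<^sub>C f k) sums w" "\<And>j. cinner w (f j) = cnj l^j" by blast
    have fw: "cinner (f j) w = l^j" for j
      using w(2)[of j] cinner_commute[of "f j" w] by simp
    have "cinner (shift_op z) w = l * cinner z w" for z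
    proof -
      have "(\<lambda>k. cinner (cinner z (h k) *\<^sub>C g k) w) sums cinner (shift_op z) w"
        by (rule bounded_linear.sums[OF bounded_linear_cinner_left S_sums])
      then have 3: "(\<lambda>k. cinner z (f k) * (l * l^k)) sums cinner (shift_op z) w"
        using 2 fw by (simp add: cinner_simps)
      have "(\<lambda>k. cinner z (cnj l^k *\<^sub>C f k)) sums cinner z w"
        by (rule bounded_linear.sums[OF bounded_linear_cinner_right w(1)])
      then have "(\<lambda>k. l * (l^k * cinner z (f k))) sums (l * cinner z w)"
        by (intro sums_mult) (simp add: cinner_simps)
      then have "(\<lambda>k. cinner z (f k) * (l * l^k)) sums (l * cinner z w)"
        by (simp add: mult_ac)
      then show ?thesis using 3 sums_unique2 by blast
    qed
    moreover have "w \<noteq> 0" using w(2)[of 0] by auto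
    ultimately show ?thesis by blast
  qed
qed

text \<open>The eigenvalue criterion asks for nonzero \<open>l\<close>, whence the punctured disc,
  which is still uncountable.\<close>

lemma not_scattered_if_shift: "\<not> scattered (op_alg J)"
proof
  assume "scattered (op_alg J)"
  then have "countable (aspectrum (op_alg J) shift_op)" using shift_in_J by (simp add: scattered_def)
  moreover have "l \<in> aspectrum (op_alg J) shift_op" if "l \<in> ball 0 1 - {0}" for l
    by (rule eigenvalue_in_aspectrum[OF J(1) _ shift_in_J _ shift_eigenvalue])
      (use that J(3) bounded_operators in auto)
  ultimately have "countable (ball (0::complex) 1 - {0})"
    by (meson countable_subset subsetI)
  then have "countable (ball (0::complex) 1)" by (simp add: countable_Diff_eq)
  then show False using uncountable_ball[of 1 "0::complex"] by simp
qed

text \<open>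
  The matrix entries of \<open>L (b (X i) b) R\<close> on one fixed diagonal are the indicator of the \<open>i\<close>-th member of a partition
  of the indices into infinite sets, whereas those of elements of \<open>core\<close> tend to \<open>0\<close>.
\<close>

lemma separated_two_sided_mult:
  "\<exists>X C \<delta>. (\<forall>i::nat. X i \<in> J \<and> norm (X i) \<le> C) \<and> \<delta> > 0 \<and> (\<forall>F c q i. finite F \<longrightarrow> q \<in> core \<longrightarrow> i \<in> F \<longrightarrow>
      \<delta> * cmod (c i) \<le> norm ((\<Sum>i\<in>F. c i *\<^sub>C (b o\<^sub>L X i o\<^sub>L b)) - q))"
proof -
  note f = shift_orthonormal(1) and g = shift_orthonormal(2) and h = shift_orthonormal(3)
  \<comment> \<open>Class \<open>i\<close> consists of the codes of pairs with first entry
    \<open>i\<close>; these classes are infinite and disjoint.\<close>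
  define \<Lambda> where "\<Lambda> i k = (if fst (prod_decode k) = i then 1 else 0 :: complex)" for i k
  define D where "D i = osum (\<Lambda> i) g h" for i
  have \<Lambda>1: "cmod (\<Lambda> i k) \<le> 1" for i k by (simp add: \<Lambda>_def)
  have DA: "D i \<in> Alg" for i
    unfolding D_def by (rule osum_in_Alg[OF g h \<Lambda>1]) (use sd in \<open>simp add: shift_data_def\<close>)
  have nD: "norm (D i) \<le> 1" for i unfolding D_def by (rule norm_osum_le[OF g h \<Lambda>1])
  have SJ: "shift_op \<in> J" by (rule shift_in_J)
  then have SA: "shift_op \<in> Alg" using J by blast
  have nS: "norm shift_op \<le> 1" by (rule norm_osum_le[OF g h]) simp
  have Sh: "shift_op (h k) = g k" for k using osum_basis[OF g h, of "\<lambda>_. 1" 1 k] by simp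
  have Dh: "D i (h k) = \<Lambda> i k *\<^sub>C g k" for i k unfolding D_def by (rule osum_basis[OF g h \<Lambda>1])
  \<comment> \<open>The factor \<open>shift_op\<close> brings \<open>X i\<close> into
    \<open>J\<close>, as \<open>D i\<close> is only known to be in the algebra. Both copies of
    \<open>L b R\<close> in \<open>L (b (X i) b) R\<close> then become shifts.\<close>
  define X where "X i = R o\<^sub>L D i o\<^sub>L shift_op o\<^sub>L L" for i
  have XJ: "X i \<in> J" for i
    unfolding X_def by (intro ideal(2) LR ideal(1)[OF compose] DA SJ)
  have nX: "norm (X i) \<le> norm R * norm L" for i
  proof -
    have "norm (X i) \<le> ((norm R * norm (D i)) * norm shift_op) * norm L"
      unfolding X_def by (intro order_trans[OF norm_blinfun_compose] mult_right_mono) auto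
    also have "\<dots> \<le> ((norm R * 1) * 1) * norm L"
      by (intro mult_mono nD nS) auto
    finally show ?thesis by simp
  qed
  have LXR: "L o\<^sub>L (b o\<^sub>L X i o\<^sub>L b) o\<^sub>L R = shift_op o\<^sub>L D i o\<^sub>L shift_op o\<^sub>L shift_op" for i
    unfolding X_def LR(3)[symmetric] by (simp only: compose_assoc)
  \<comment> \<open>Four unit shifts are composed, hence the offset 4. The weight is applied after
    two of them: going backward from \<open>f (m + 4)\<close> this is at
    \<open>f (m + 2) = h (m + 1)\<close>, so \<open>d = 1\<close>; going forward from
    \<open>f m\<close> it is at \<open>f (m + 2) = h (m + 2)\<close>, so
    \<open>d = 2\<close>.\<close>
  obtain p q d where pq: "orthonormal p" "orthonormal q"
    "\<And>i m. blinfun_apply (shift_op o\<^sub>L D i o\<^sub>L shift_op o\<^sub>L shift_op) (p m) = \<Lambda> i (m + d) *\<^sub>C q m"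
    "p = (\<lambda>m. f (m + 4)) \<and> q = f \<or> p = f \<and> q = (\<lambda>m. f (m + 4))"
  proof -
    have f4: "orthonormal (\<lambda>m. f (m + 4))" using orthonormal_compose[OF f, of "\<lambda>m. m + 4"] by (simp add: inj_def)
    from sd consider "g = f" "h = f \<circ> Suc" | "g = f \<circ> Suc" "h = f" by (auto simp: shift_data_def)
    then show ?thesis
    proof cases
      case 1
      have s: "shift_op (f (Suc k)) = f k" "D i (f (Suc k)) = \<Lambda> i k *\<^sub>C f k" for i k
        using Sh[of k] Dh[of i k] 1 by simp_all
      have m4: "f (m + 4) = f (Suc (Suc (Suc (Suc m))))" for m by (simp add: eval_nat_numeral)
      then have "(shift_op o\<^sub>L D i o\<^sub>L shift_op o\<^sub>L shift_op) (f (m + 4)) = \<Lambda> i (m + 1) *\<^sub>C f m" for i m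
        unfolding m4 by (simp add: s apply_scaleC[OF SA])
      then show ?thesis using that[of "\<lambda>m. f (m + 4)" f 1] f f4 by simp
    next
      case 2
      have s: "shift_op (f k) = f (Suc k)" "D i (f k) = \<Lambda> i k *\<^sub>C f (Suc k)" for i k
        using Sh[of k] Dh[of i k] 2 by simp_all
      have m4: "f (m + 4) = f (Suc (Suc (Suc (Suc m))))" for m by (simp add: eval_nat_numeral)
      then have "(shift_op o\<^sub>L D i o\<^sub>L shift_op o\<^sub>L shift_op) (f m) = \<Lambda> i (m + 2) *\<^sub>C f (m + 4)" for i m
        unfolding m4 by (simp add: s apply_scaleC[OF SA])
      then show ?thesis using that[of f "\<lambda>m. f (m + 4)" 2] f f4 by simp
    qed
  qed
  define e where "e m V = cinner (blinfun_apply V (p m)) (q m)" for m and V :: "'h \<Rightarrow>\<^sub>L 'h"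
  have e_le: "cmod (e m V) \<le> norm V" for m V
  proof -
    have "cmod (e m V) \<le> norm (V (p m)) * 1"
      unfolding e_def using Cauchy_Schwarz[of "V (p m)" "q m"] by (simp add: orthonormal_norm[OF pq(2)])
    also have "\<dots> \<le> norm V"
      using norm_blinfun[of V "p m"] by (simp add: orthonormal_norm[OF pq(1)])
    finally show ?thesis .
  qed
  have e_lin: "e m (c *\<^sub>C V + W) = c * e m V + e m W" "e m (V - W) = e m V - e m W" for m c V W
    by (simp_all add: e_def blinfun.bilinear_simps cinner_simps)
  have tail: "(\<forall>\<^sub>F m in sequentially. p m \<in> N \<and> q m \<in> N) \<or> (\<forall>\<^sub>F m in sequentially. p m \<in> orthocomp N \<and> q m \<in> orthocomp N)"
    if "N \<in> \<N>" for N
  proof -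
    have shift: "(\<forall>\<^sub>F m in sequentially. f m \<in> K) \<Longrightarrow> (\<forall>\<^sub>F m in sequentially. f m \<in> K \<and> f (m + 4) \<in> K)" for K
      using eventually_conj sequentially_offset[of "\<lambda>m. f m \<in> K" 4] by fastforce
    have "(\<forall>\<^sub>F k in sequentially. f k \<in> N) \<or> (\<forall>\<^sub>F k in sequentially. f k \<in> orthocomp N)"
      using sd that by (simp add: shift_data_def)
    then show ?thesis
      using shift[of N] shift[of "orthocomp N"] pq(4) by (auto simp: conj_commute)
  qed
  \<comment> \<open>Far out, a corner operator either kills \<open>p m\<close> or has range
    orthogonal to \<open>q m\<close>; for rank one, Bessel makes the products of the range vector
    with the \<open>q m\<close> tend to 0.\<close>
  have e_elem: "(\<lambda>m. e m Q) \<longlonglongrightarrow> 0" if Q: "Q \<in> elementary" for Q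
  proof -
    from Q consider M where "M \<in> \<N>" "\<And>z. blinfun_apply Q z \<in> M" "\<And>z. z \<in> M \<Longrightarrow> blinfun_apply Q z = 0"
      | u where "\<And>z. \<exists>c. blinfun_apply Q z = c *\<^sub>C u"
      unfolding elementary_def by blast
    then show ?thesis
    proof cases
      case 1
      have "\<forall>\<^sub>F m in sequentially. e m Q = 0"
        using tail[OF 1(1)]
      proof
        assume "\<forall>\<^sub>F m in sequentially. p m \<in> M \<and> q m \<in> M"
        then show ?thesis by eventually_elim (simp add: e_def 1(3))
      next
        assume "\<forall>\<^sub>F m in sequentially. p m \<in> orthocomp M \<and> q m \<in> orthocomp M"
        then show ?thesis by eventually_elim (simp add: e_def orthocompD(2)[OF _ 1(2)])
      qed
      then show ?thesis by (rule tendsto_eventually)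
    next
      case 2
      then obtain c where c: "\<And>z. blinfun_apply Q z = c z *\<^sub>C u" by metis
      show ?thesis
      proof (cases "u = 0")
        case True
        then show ?thesis using c by (simp add: e_def)
      next
        case False
        have ev: "\<forall>\<^sub>F m in sequentially. norm (e m Q) \<le> norm Q / norm u * cmod (cinner u (q m))"
        proof (intro always_eventually allI)
          fix m
          have "cmod (c (p m)) * norm u \<le> norm Q"
            using norm_blinfun[of Q "p m"] by (simp add: c norm_scaleC orthonormal_norm[OF pq(1)])
          then have "cmod (c (p m)) \<le> norm Q / norm u" using False by (simp add: field_simps)
          then show "norm (e m Q) \<le> norm Q / norm u * cmod (cinner u (q m))"
            unfolding e_def c cinner_simps norm_mult by (rule mult_right_mono) simp
        qed
        have "(\<lambda>m. norm Q / norm u * cmod (cinner u (q m))) \<longlonglongrightarrow> norm Q / norm u * cmod 0"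
          by (intro tendsto_intros orthonormal_tendsto_left pq)
        then show ?thesis using Lim_null_comparison[OF ev] by simp
      qed
    qed
  qed
  have e_span: "(\<lambda>m. e m Q) \<longlonglongrightarrow> 0" if "Q \<in> cspan elementary" for Q
    using that
  proof (induction rule: complex_vector.span_induct_alt)
    case base
    then show ?case by (simp add: e_def)
  next
    case (step c x y)
    have "(\<lambda>m. c * e m x + e m y) \<longlonglongrightarrow> c * 0 + 0"
      by (intro tendsto_intros e_elem step)
    then show ?case by (simp add: e_lin)
  qed
  have e_core: "(\<lambda>m. e m Q) \<longlonglongrightarrow> 0" if Q: "Q \<in> core" for Q
  proof (rule tendstoI)
    fix r :: real assume "r > 0"
    then obtain Q' where Q': "Q' \<in> cspan elementary" "dist Q' Q < r / 2"
      using Q unfolding core_def closure_approachable by (meson half_gt_zero)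
    have "\<forall>\<^sub>F m in sequentially. dist (e m Q') 0 < r / 2"
      using e_span[OF Q'(1)] \<open>r > 0\<close> by (intro tendstoD) auto
    then show "\<forall>\<^sub>F m in sequentially. dist (e m Q) 0 < r"
    proof eventually_elim
      case (elim m)
      have "cmod (e m Q) \<le> cmod (e m Q') + cmod (e m (Q' - Q))"
        using norm_triangle_ineq4[of "e m Q'" "e m (Q' - Q)"] by (simp add: e_lin)
      also have "\<dots> < r / 2 + r / 2"
        using elim Q'(2) e_le[of m "Q' - Q"] by (intro add_strict_mono) (auto simp: dist_norm)
      finally show ?case by simp
    qed
  qed
  \<comment> \<open>Passing from \<open>W\<close> to \<open>L W R\<close> costs a factor
    \<open>norm L * norm R\<close>; the 1 avoids division by zero.\<close>
  define \<delta> where "\<delta> = 1 / (norm L * norm R + 1)"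
  have pos: "norm L * norm R + 1 > 0" by (simp add: add_nonneg_pos)
  have sep: "\<delta> * cmod (c i) \<le> norm ((\<Sum>i\<in>F. c i *\<^sub>C (b o\<^sub>L X i o\<^sub>L b)) - Q)"
    if F: "finite F" "Q \<in> core" "i \<in> F" for F c Q i
  proof -
    define W where "W = (\<Sum>i\<in>F. c i *\<^sub>C (b o\<^sub>L X i o\<^sub>L b)) - Q"
    have LQ: "L o\<^sub>L Q o\<^sub>L R \<in> core" using core_ideal LR F(2) by blast
    have W: "L o\<^sub>L W o\<^sub>L R = (\<Sum>i\<in>F. c i *\<^sub>C (shift_op o\<^sub>L D i o\<^sub>L shift_op o\<^sub>L shift_op)) - (L o\<^sub>L Q o\<^sub>L R)"
    proof -
      have "L o\<^sub>L (\<Sum>i\<in>F. c i *\<^sub>C (b o\<^sub>L X i o\<^sub>L b)) o\<^sub>L R = (\<Sum>i\<in>F. c i *\<^sub>C (L o\<^sub>L (b o\<^sub>L X i o\<^sub>L b) o\<^sub>L R))"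
        by (simp add: bounded_bilinear.sum_left[OF bounded_bilinear_blinfun_compose]
            bounded_bilinear.sum_right[OF bounded_bilinear_blinfun_compose] compose_scaleC[OF LR(1)] blinfun_compose_scaleC_left)
      then show ?thesis unfolding W_def LXR by (simp add: compose_simps)
    qed
    have e_sum: "e m (\<Sum>i\<in>F. c i *\<^sub>C (shift_op o\<^sub>L D i o\<^sub>L shift_op o\<^sub>L shift_op)) = (\<Sum>j\<in>F. c j * \<Lambda> j (m + d))" for m
    proof -
      have "e m (\<Sum>i\<in>F. c i *\<^sub>C (shift_op o\<^sub>L D i o\<^sub>L shift_op o\<^sub>L shift_op)) = (\<Sum>i\<in>F. cinner (c i *\<^sub>C (shift_op o\<^sub>L D i o\<^sub>L shift_op o\<^sub>L shift_op) (p m)) (q m))"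
        by (simp add: e_def blinfun.sum_left cinner_sum_left)
      also have "\<dots> = (\<Sum>j\<in>F. c j * \<Lambda> j (m + d))"
        unfolding pq(3) by (simp add: cinner_simps orthonormalD[OF pq(2)])
      finally show ?thesis .
    qed
    have bound: "cmod (c i) \<le> norm L * norm W * norm R + r" if r: "r > 0" for r
    proof -
      have "\<forall>\<^sub>F m in sequentially. dist (e m (L o\<^sub>L Q o\<^sub>L R)) 0 < r"
        by (rule tendstoD[OF e_core[OF LQ] r])
      then obtain m0 where m0: "\<And>m. m \<ge> m0 \<Longrightarrow> cmod (e m (L o\<^sub>L Q o\<^sub>L R)) < r"
        by (auto simp: eventually_sequentially)
      \<comment> \<open>An index of class \<open>i\<close> so far out that \<open>k - d\<close> is
        at least \<open>m0\<close>: there only the \<open>i\<close>-th summand contributes and the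
        entry of the \<open>core\<close> element is below \<open>r\<close>.\<close>
      define k where "k = prod_encode (i, m0 + d)"
      have k: "k \<ge> m0 + d" unfolding k_def by (rule le_prod_encode_2)
      define m where "m = k - d"
      have m: "m \<ge> m0" "m + d = k" using k by (auto simp: m_def)
      have "(\<Sum>j\<in>F. c j * \<Lambda> j (m + d)) = (\<Sum>j\<in>F. if j = i then c j else 0)"
        by (rule sum.cong) (auto simp: m(2) \<Lambda>_def k_def)
      also have "\<dots> = c i" using F by simp
      finally have "e m (L o\<^sub>L W o\<^sub>L R) = c i - e m (L o\<^sub>L Q o\<^sub>L R)"
        unfolding W e_lin(2) e_sum by simp
      then have "cmod (c i) \<le> cmod (e m (L o\<^sub>L W o\<^sub>L R)) + cmod (e m (L o\<^sub>L Q o\<^sub>L R))"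
        by (metis diff_add_cancel norm_triangle_ineq)
      also have "\<dots> \<le> norm (L o\<^sub>L W o\<^sub>L R) + r"
        using m0[OF m(1)] e_le by (intro add_mono) (auto intro: less_imp_le)
      also have "norm (L o\<^sub>L W o\<^sub>L R) \<le> norm L * norm W * norm R"
        by (meson norm_blinfun_compose mult_right_mono norm_ge_zero order_trans)
      finally show ?thesis by simp
    qed
    then have "cmod (c i) \<le> norm L * norm W * norm R" by (rule field_le_epsilon)
    also have "\<dots> \<le> norm W * (norm L * norm R + 1)" by (simp add: algebra_simps)
    finally show ?thesis unfolding W_def[symmetric] \<delta>_def using pos by (simp add: field_simps)
  qed
  have "\<delta> > 0" using pos by (simp add: \<delta>_def)
  then show ?thesis using XJ nX sep by blast
qed

end

end

section \<open>Large entries along the nest\<close>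

context nest_alg
begin

lemma csubspace_diff_space: "M \<in> \<N> \<Longrightarrow> csubspace (M \<inter> orthocomp N)"
  by (intro csubspace_Int csubspace_orthocomp nest_csubspace)

lemma closed_diff_space: "M \<in> \<N> \<Longrightarrow> closed (M \<inter> orthocomp N)"
  by (intro closed_Int closed_orthocomp nest_closed)

lemma proj_in_Alg:
  assumes M: "M \<in> \<N>"
  shows "proj M \<in> Alg"
  unfolding mem_Alg
proof (intro conjI ballI)
  note pM = nest_csubspace[OF M] nest_closed[OF M]
  show "proj M \<in> bounded_operators" by (simp add: bounded_operators_def proj_scaleC[OF pM])
  show "proj M x \<in> N" if "N \<in> \<N>" "x \<in> N" for N x
    using nest_linear[OF M that(1)] proj_in[OF pM] proj_id[OF pM] that by (metis subsetD)
qed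

lemma proj_diff_space:
  assumes "M \<in> \<N>" "N \<in> \<N>" "N \<subseteq> M"
  shows "proj (M \<inter> orthocomp N) = proj M - proj N"
proof (rule blinfun_eqI)
  fix x
  note pM = nest_csubspace[OF assms(1)] nest_closed[OF assms(1)]
    and pN = nest_csubspace[OF assms(2)] nest_closed[OF assms(2)]
  have "proj (M \<inter> orthocomp N) x = proj M x - proj N x"
  proof (rule proj_eq[OF csubspace_diff_space[OF assms(1)] closed_diff_space[OF assms(1)]])
    have "proj N x \<in> M" using proj_in[OF pN] assms(3) by blast
    then have "proj M x - proj N x \<in> M"
      by (intro csubspace_diff[OF pM(1)] proj_in[OF pM])
    moreover have "(x - proj N x) - (x - proj M x) \<in> orthocomp N"
      by (rule csubspace_diff[OF csubspace_orthocomp proj_orthocomp[OF pN]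
          subsetD[OF orthocomp_anti[OF assms(3)] proj_orthocomp[OF pM]]])
    ultimately show "proj M x - proj N x \<in> M \<inter> orthocomp N" by simp
    show "x - (proj M x - proj N x) \<in> orthocomp (M \<inter> orthocomp N)"
    proof (rule orthocompI)
      fix u assume u: "u \<in> M \<inter> orthocomp N"
      then have "cinner (x - proj M x) u = 0" "cinner (proj N x) u = 0"
        using orthocompD(1)[OF proj_orthocomp[OF pM]] orthocompD(2) proj_in[OF pN] by blast+
      then show "cinner (x - (proj M x - proj N x)) u = 0" by (simp add: cinner_simps)
    qed
  qed
  then show "proj (M \<inter> orthocomp N) x = (proj M - proj N) x" by (simp add: blinfun.diff_left)
qed

lemma proj_diff_space_in_Alg:
  "M \<in> \<N> \<Longrightarrow> N \<in> \<N> \<Longrightarrow> N \<subseteq> M \<Longrightarrow> proj (M \<inter> orthocomp N) \<in> Alg"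
  by (simp add: proj_diff_space diff proj_in_Alg)

text \<open>Take \<open>y\<close> to be the compressed image of \<open>x\<close>, so that
  \<open>\<langle>b x, y\<rangle>\<close> is the square of \<open>norm y\<close>. The homogeneous
  form allows the vectors to be approximated first and normalized afterwards.\<close>

lemma large_form_if_norm_gt:
  assumes K: "csubspace K" "closed K" and K': "csubspace K'" "closed K'"
    and e: "e \<ge> 0" "e < norm (proj K' o\<^sub>L b o\<^sub>L proj K)"
  shows "\<exists>x\<in>K. \<exists>y\<in>K'. e * norm x * norm y < cmod (cinner (blinfun_apply b x) y)"
proof -
  obtain z where z: "e * norm z < norm ((proj K' o\<^sub>L b o\<^sub>L proj K) z)"
    using norm_blinfun_bound[OF e(1), of "proj K' o\<^sub>L b o\<^sub>L proj K"] e(2) by (meson not_le)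
  define x where "x = proj K z"
  define y where "y = proj K' (b x)"
  have xK: "x \<in> K" and yK: "y \<in> K'" using proj_in[OF K] proj_in[OF K'] by (auto simp: x_def y_def)
  have "e * norm x \<le> e * norm z" using norm_proj_apply_le[OF K, of z] e by (simp add: x_def mult_left_mono)
  also have "\<dots> < norm y" using z by (simp add: x_def y_def)
  finally have 1: "e * norm x < norm y" .
  have "cinner (b x) y = cinner y y"
    using cinner_proj_left[OF K' yK, of "b x"] by (simp add: y_def)
  then have "cmod (cinner (b x) y) = norm y * norm y" by (simp add: cinner_self power2_eq_square norm_mult)
  moreover have "norm y > 0" using 1 e(1) by (smt (verit) mult_nonneg_nonneg norm_ge_zero)
  ultimately have "e * norm x * norm y < cmod (cinner (b x) y)" using 1 by simp
  then show ?thesis using xK yK by blast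
qed

text \<open>A strict inequality between continuous expressions persists under small changes of both
  vectors.\<close>

lemma large_form_approx:
  assumes "x \<in> closure D" "y \<in> closure D" "e * norm x * norm y < cmod (cinner (blinfun_apply b x) y)"
  shows "\<exists>x\<in>D. \<exists>y\<in>D. e * norm x * norm y < cmod (cinner (blinfun_apply b x) y)"
proof -
  obtain f g where f: "\<And>n. f n \<in> D" "f \<longlonglongrightarrow> x" and g: "\<And>n. g n \<in> D" "g \<longlonglongrightarrow> y"
    using assms(1,2) by (auto simp: closure_sequential)
  have "(\<lambda>n. cmod (cinner (b (f n)) (g n)) - e * norm (f n) * norm (g n)) \<longlonglongrightarrow>
      cmod (cinner (b x) y) - e * norm x * norm y"
    by (intro tendsto_intros tendsto_cinner blinfun.tendsto f g)
  then have "\<forall>\<^sub>F n in sequentially. 0 < cmod (cinner (b (f n)) (g n)) - e * norm (f n) * norm (g n)"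
    by (rule order_tendstoD) (use assms(3) in simp)
  then obtain n where "0 < cmod (cinner (b (f n)) (g n)) - e * norm (f n) * norm (g n)"
    by (auto simp: eventually_sequentially)
  then show ?thesis using f(1) g(1) by (intro bexI[of _ "f n"] bexI[of _ "g n"]) auto
qed

lemma large_form_normalize:
  assumes b: "b \<in> bounded_operators" and K: "csubspace K" "csubspace K'" and e: "e \<ge> 0"
    and xy: "x \<in> K" "y \<in> K'" "e * norm x * norm y < cmod (cinner (blinfun_apply b x) y)"
  shows "\<exists>x\<in>K. \<exists>y\<in>K'. norm x = 1 \<and> norm y = 1 \<and> e < cmod (cinner (blinfun_apply b x) y)"
proof -
  have "x \<noteq> 0" "y \<noteq> 0" using xy(3) by auto
  then have pos: "norm x > 0" "norm y > 0" by auto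
  define x' where "x' = complex_of_real (inverse (norm x)) *\<^sub>C x"
  define y' where "y' = complex_of_real (inverse (norm y)) *\<^sub>C y"
  have "x' \<in> K" "y' \<in> K'" unfolding x'_def y'_def using K xy csubspace_scale by blast+
  moreover have "norm x' = 1" "norm y' = 1" using pos by (simp_all add: x'_def y'_def norm_scaleC norm_inverse)
  moreover have "cmod (cinner (b x') y') = cmod (cinner (b x) y) / (norm x * norm y)"
    using pos by (simp add: x'_def y'_def bounded_operatorsD[OF b] cinner_simps norm_mult norm_inverse field_simps norm_divide)
  then have "e < cmod (cinner (b x') y')"
    using xy(3) pos by (simp add: pos_less_divide_eq mult.assoc)
  ultimately show ?thesis by blast
qed

lemma nest_directed: "M \<in> \<N> \<Longrightarrow> N \<in> \<N> \<Longrightarrow> M \<union> N = M \<or> M \<union> N = N"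
  using nest_linear by blast

abbreviation factors :: "('h \<Rightarrow>\<^sub>L 'h) \<Rightarrow> bool" where
  "factors b \<equiv> \<exists>f g h. shift_data f g h \<and> (\<exists>L\<in>Alg. \<exists>R\<in>Alg. L o\<^sub>L b o\<^sub>L R = osum (\<lambda>_. 1) g h)"

lemma orthonormalI_less:
  assumes "\<And>i. norm (x i) = 1" "\<And>i j. i < j \<Longrightarrow> cinner (x i) (x j) = 0"
  shows "orthonormal x"
  unfolding orthonormal_def
proof (intro allI)
  fix i j :: nat
  show "cinner (x i) (x j) = (if i = j then 1 else 0)"
    using assms(1)[of i] assms(2)[of i j] assms(2)[of j i] cinner_commute[of "x i" "x j"]
    by (cases i j rule: linorder_cases) (simp_all add: cinner_self)
qed

text \<open>Triangularity comes from the nest: for \<open>i < j\<close>, invariance keeps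
  \<open>b (x i)\<close> in \<open>M j\<close>, to which \<open>y j\<close> is orthogonal.\<close>

lemma factors_increasing:
  assumes b: "b \<in> Alg" and e: "e > 0"
    and M: "\<And>n::nat. M n \<in> \<N>" "\<And>n. M n \<subseteq> M (Suc n)"
    and x: "\<And>n. x n \<in> M (Suc n) \<inter> orthocomp (M n)" "\<And>n. norm (x n) = 1"
    and y: "\<And>n. y n \<in> M (Suc n) \<inter> orthocomp (M n)" "\<And>n. norm (y n) = 1"
    and big: "\<And>n. e \<le> cmod (cinner (blinfun_apply b (x n)) (y n))"
  shows "factors b"
proof -
  have mono: "M i \<subseteq> M j" if "i \<le> j" for i j using lift_Suc_mono_le[of M, OF M(2) that] .
  have in_M: "x i \<in> M j" "y i \<in> M j" if "i < j" for i j
    using x(1)[of i] y(1)[of i] mono[of "Suc i" j] that by auto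
  have ort: "cinner z (x j) = 0" "cinner z (y j) = 0" if "z \<in> M j" for z j
    using x(1)[of j] y(1)[of j] that orthocompD(2) by blast+
  have adm: "adm (x i) v" if "i < j" "v \<in> orthocomp (M j)" for i j v
    unfolding adm_def
  proof
    fix N assume "N \<in> \<N>"
    then show "x i \<in> N \<or> v \<in> orthocomp N"
      using nest_linear[OF M(1)[of j]] in_M(1)[OF that(1)] that(2) orthocomp_anti by blast
  qed
  show ?thesis
  proof (rule shift_factorization[where lt = "(<)", OF b _ _ e big])
    show "orthonormal x" by (rule orthonormalI_less) (simp_all add: x(2) ort in_M)
    show "orthonormal y" by (rule orthonormalI_less) (simp_all add: y(2) ort in_M)
    show "adm (x i) (x j)" "adm (x i) (y j)" if "i < j" for i j
      using adm[OF that] x(1)[of j] y(1)[of j] by auto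
    show "cinner (blinfun_apply b (x i)) (y j) = 0" if "i < j" for i j
      by (rule ort) (intro Alg_apply[OF b M(1)] in_M that)
    fix N assume N: "N \<in> \<N>"
    \<comment> \<open>A nest member contains every \<open>M k\<close> or is contained in some
      \<open>M k\<close>, to which all later \<open>x j\<close> are orthogonal.\<close>
    show "(\<forall>\<^sub>F k in sequentially. x k \<in> N) \<or> (\<forall>\<^sub>F k in sequentially. x k \<in> orthocomp N)"
    proof (cases "\<forall>k. M k \<subseteq> N")
      case True
      then have "\<And>k. x k \<in> N" using x(1) by blast
      then show ?thesis by simp
    next
      case False
      then obtain k where k: "N \<subseteq> M k" using nest_linear N M(1) by blast
      have "x j \<in> orthocomp N" if "j \<ge> k" for j
        using x(1)[of j] orthocomp_anti[of N "M j"] k mono[OF that] by blast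
      then show ?thesis by (auto simp: eventually_sequentially)
    qed
  qed simp
qed

text \<open>Mirror image of the increasing case: later vectors lie lower, so the index order is
  reversed and a forward shift results.\<close>

lemma factors_decreasing:
  assumes b: "b \<in> Alg" and e: "e > 0"
    and M: "\<And>n::nat. M n \<in> \<N>" "\<And>n. M (Suc n) \<subseteq> M n"
    and x: "\<And>n. x n \<in> M n \<inter> orthocomp (M (Suc n))" "\<And>n. norm (x n) = 1"
    and y: "\<And>n. y n \<in> M n \<inter> orthocomp (M (Suc n))" "\<And>n. norm (y n) = 1"
    and big: "\<And>n. e \<le> cmod (cinner (blinfun_apply b (x n)) (y n))"
  shows "factors b"
proof -
  have mono: "M j \<subseteq> M i" if "i \<le> j" for i j using lift_Suc_antimono_le[of M, OF M(2) that] .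
  have ort: "cinner (x j) z = 0" "cinner (y j) z = 0" "cinner z (y j) = 0" if "j < i" "z \<in> M i" for z i j
    using x(1)[of j] y(1)[of j] mono[of "Suc j" i] that orthocompD by (meson IntD2 Suc_leI subsetD)+
  have adm: "adm (x i) v" if "j < i" "v \<in> orthocomp (M (Suc j))" for i j v
    unfolding adm_def
  proof
    fix N assume "N \<in> \<N>"
    then show "x i \<in> N \<or> v \<in> orthocomp N"
      using nest_linear[OF M(1)[of i]] x(1)[of i] mono[of "Suc j" i] that orthocomp_anti by (meson IntD1 Suc_leI subsetD)
  qed
  show ?thesis
  proof (rule shift_factorization[where lt = "(>)", OF b _ _ e big])
    show "orthonormal x" by (rule orthonormalI_less) (use x(1,2) ort(1) in blast)+
    show "orthonormal y" by (rule orthonormalI_less) (use y(1,2) ort(2) in blast)+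
    show "adm (x i) (x j)" "adm (x i) (y j)" if "i > j" for i j
      using adm[OF that] x(1)[of j] y(1)[of j] by auto
    show "cinner (blinfun_apply b (x i)) (y j) = 0" if "i > j" for i j
      by (rule ort(3)[OF that]) (use x(1) Alg_apply[OF b M(1)] in blast)
    fix N assume N: "N \<in> \<N>"
    show "(\<forall>\<^sub>F k in sequentially. x k \<in> N) \<or> (\<forall>\<^sub>F k in sequentially. x k \<in> orthocomp N)"
    proof (cases "\<forall>k. N \<subseteq> M k")
      case True
      then have "x k \<in> orthocomp N" for k using x(1)[of k] orthocomp_anti[of N "M (Suc k)"] by blast
      then show ?thesis by simp
    next
      case False
      then obtain k where k: "M k \<subseteq> N" using nest_linear N M(1) by blast
      have "x j \<in> N" if "j \<ge> k" for j
        using x(1)[of j] k mono[OF that] by blast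
      then show ?thesis by (auto simp: eventually_sequentially)
    qed
  qed simp
qed

text \<open>All pairs of vectors in \<open>K\<close> are admissible, so the nest orders nothing
  inside \<open>K\<close> and one-sided vanishing of entries has to be assumed.\<close>

lemma factors_atom:
  assumes b: "b \<in> Alg" and e: "e > 0"
    and K: "\<And>N. N \<in> \<N> \<Longrightarrow> K \<subseteq> N \<or> K \<subseteq> orthocomp N"
    and x: "\<And>n. x n \<in> K" "orthonormal x" and y: "\<And>n. y n \<in> K" "orthonormal y"
    and zero: "\<And>i j. i < j \<Longrightarrow> cinner (blinfun_apply b (x i)) (y j) = 0"
    and big: "\<And>n. e \<le> cmod (cinner (blinfun_apply b (x n)) (y n))"
  shows "factors b"
proof (rule shift_factorization[where lt = "(<)", OF b _ _ e big])
  show "adm (x i) (x j)" "adm (x i) (y j)" for i j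
    using K x(1) y(1) unfolding adm_def by blast+
  fix N assume "N \<in> \<N>"
  then have "(\<forall>k. x k \<in> N) \<or> (\<forall>k. x k \<in> orthocomp N)" using K x(1) by blast
  then show "(\<forall>\<^sub>F k in sequentially. x k \<in> N) \<or> (\<forall>\<^sub>F k in sequentially. x k \<in> orthocomp N)" by auto
qed (use zero x(2) y(2) in auto)

end

section \<open>Approximation by the core on intervals of the nest\<close>

context nest_ideal
begin

context
  fixes b e
  assumes b: "b \<in> J" and e: "e > (0::real)"
begin

lemma b_Alg: "b \<in> Alg" using b J by blast

lemma b_bounded: "b \<in> bounded_operators" using b_Alg bounded_operators by blast

definition approx :: "('h \<Rightarrow>\<^sub>L 'h) \<Rightarrow> bool" where
  "approx X \<longleftrightarrow> (\<exists>j\<in>core. norm (X - j) \<le> e)"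

definition good :: "'h set \<Rightarrow> 'h set \<Rightarrow> bool" where
  "good N M \<longleftrightarrow> approx (proj (M \<inter> orthocomp N) o\<^sub>L b o\<^sub>L proj (M \<inter> orthocomp N))"

lemma approx_of_norm: "norm X \<le> e \<Longrightarrow> approx X"
  unfolding approx_def using core_csubspace csubspace_0 by (metis diff_zero)

lemma approx_add: "approx X \<Longrightarrow> j \<in> core \<Longrightarrow> approx (X + j)"
  unfolding approx_def using core_csubspace csubspace_add
  by (metis add_diff_cancel_right)

text \<open>Relative to the two adjacent intervals \<open>b\<close> is upper triangular: the lower
  corner is zero and the upper one is elementary. The diagonal errors act between orthogonal spaces,
  so their sum has norm at most the larger of the two and the tolerance \<open>e\<close> does not
  grow.\<close>

lemma good_merge:
  assumes \<N>: "N \<in> \<N>" "M \<in> \<N>" "L \<in> \<N>" and le: "N \<subseteq> M" "M \<subseteq> L"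
    and g: "good N M" "good M L"
  shows "good N L"
proof -
  let ?K1 = "M \<inter> orthocomp N" and ?K2 = "L \<inter> orthocomp M"
  note K1 = csubspace_diff_space[OF \<N>(2), of N] closed_diff_space[OF \<N>(2), of N]
    and K2 = csubspace_diff_space[OF \<N>(3), of M] closed_diff_space[OF \<N>(3), of M]
    and K = csubspace_diff_space[OF \<N>(3), of N] closed_diff_space[OF \<N>(3), of N]
  define E1 where "E1 = proj ?K1"
  define E2 where "E2 = proj ?K2"
  define E where "E = proj (L \<inter> orthocomp N)"
  have EA: "E1 \<in> Alg" "E2 \<in> Alg"
    unfolding E1_def E2_def using \<N> le by (auto intro: proj_diff_space_in_Alg)
  have E: "E = E1 + E2"
    unfolding E_def E1_def E2_def using \<N> le by (simp add: proj_diff_space)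
  have in1: "E1 z \<in> M" and in2: "E2 z \<in> orthocomp M" for z
    using proj_in[OF K1] proj_in[OF K2] by (auto simp: E1_def E2_def)
  have E2M: "E2 z = 0" if "z \<in> M" for z
    unfolding E2_def by (rule proj_zero[OF K2]) (use that orthocompD(2) in \<open>auto intro!: orthocompI\<close>)
  have idem: "E1 o\<^sub>L E1 = E1" "E2 o\<^sub>L E2 = E2"
    unfolding E1_def E2_def by (auto intro!: blinfun_eqI proj_id K1 K2 proj_in[OF K1, simplified] proj_in[OF K2, simplified] simp: proj_in[OF K1, simplified] proj_in[OF K2, simplified])
  obtain j1 j2 where j: "j1 \<in> core" "j2 \<in> core" "norm ((E1 o\<^sub>L b o\<^sub>L E1) - j1) \<le> e" "norm ((E2 o\<^sub>L b o\<^sub>L E2) - j2) \<le> e"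
    using g unfolding good_def approx_def E1_def E2_def by blast
  define D1 where "D1 = (E1 o\<^sub>L b o\<^sub>L E1) - j1"
  define D2 where "D2 = (E2 o\<^sub>L b o\<^sub>L E2) - j2"
  define Q where "Q = E1 o\<^sub>L b o\<^sub>L E2"
  have zero: "E2 o\<^sub>L b o\<^sub>L E1 = 0"
    by (rule blinfun_eqI) (simp add: E2M Alg_apply[OF b_Alg \<N>(2)] in1)
  have "Q \<in> elementary"
    unfolding elementary_def Q_def using ideal EA b in1 E2M \<N>(2)
    by (auto intro!: bexI[of _ M] simp: blinfun.zero_right)
  then have Q: "Q \<in> core" using elementary_core by blast
  \<comment> \<open>Compressing \<open>j1\<close> and \<open>j2\<close> to their own blocks makes
    the error block diagonal, which the Pythagorean estimate below requires.\<close>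
  have j_core: "(E1 o\<^sub>L j1 o\<^sub>L E1) + (E2 o\<^sub>L j2 o\<^sub>L E2) + Q \<in> core"
    by (intro csubspace_add[OF core_csubspace] core_ideal EA j Q)
  have eq1: "E1 o\<^sub>L D1 o\<^sub>L E1 = (E1 o\<^sub>L b o\<^sub>L E1) - (E1 o\<^sub>L j1 o\<^sub>L E1)"
    unfolding D1_def by (simp add: compose_simps) (metis compose_assoc idem(1))
  have eq2: "E2 o\<^sub>L D2 o\<^sub>L E2 = (E2 o\<^sub>L b o\<^sub>L E2) - (E2 o\<^sub>L j2 o\<^sub>L E2)"
    unfolding D2_def by (simp add: compose_simps) (metis compose_assoc idem(2))
  have eq: "(E o\<^sub>L b o\<^sub>L E) - ((E1 o\<^sub>L j1 o\<^sub>L E1) + (E2 o\<^sub>L j2 o\<^sub>L E2) + Q) = (E1 o\<^sub>L D1 o\<^sub>L E1) + (E2 o\<^sub>L D2 o\<^sub>L E2)"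
    unfolding eq1 eq2 using zero by (simp add: E Q_def compose_simps)
  have "norm ((E1 o\<^sub>L D1 o\<^sub>L E1) + (E2 o\<^sub>L D2 o\<^sub>L E2)) \<le> e"
  proof (rule norm_blinfun_bound)
    fix z
    have le1: "norm (E1 (D1 (E1 z))) \<le> e * norm (E1 z)"
    proof -
      have "norm (E1 (D1 (E1 z))) \<le> norm (D1 (E1 z))"
        unfolding E1_def by (rule norm_proj_apply_le[OF K1])
      also have "\<dots> \<le> norm D1 * norm (E1 z)" by (rule norm_blinfun)
      also have "\<dots> \<le> e * norm (E1 z)" using j(3) by (intro mult_right_mono) (auto simp: D1_def)
      finally show ?thesis .
    qed
    have le2: "norm (E2 (D2 (E2 z))) \<le> e * norm (E2 z)"
    proof -
      have "norm (E2 (D2 (E2 z))) \<le> norm (D2 (E2 z))"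
        unfolding E2_def by (rule norm_proj_apply_le[OF K2])
      also have "\<dots> \<le> norm D2 * norm (E2 z)" by (rule norm_blinfun)
      also have "\<dots> \<le> e * norm (E2 z)" using j(4) by (intro mult_right_mono) (auto simp: D2_def)
      finally show ?thesis .
    qed
    have "(norm (E1 (D1 (E1 z)) + E2 (D2 (E2 z))))\<^sup>2 = (norm (E1 (D1 (E1 z))))\<^sup>2 + (norm (E2 (D2 (E2 z))))\<^sup>2"
      by (rule norm_add_orthogonal[OF orthocompD(2)[OF in2 in1]])
    also have "\<dots> \<le> (e * norm (E1 z))\<^sup>2 + (e * norm (E2 z))\<^sup>2"
      by (intro add_mono power_mono le1 le2) auto
    also have "\<dots> = e\<^sup>2 * ((norm (E1 z))\<^sup>2 + (norm (E2 z))\<^sup>2)"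
      by (simp add: power_mult_distrib distrib_left)
    also have "(norm (E1 z))\<^sup>2 + (norm (E2 z))\<^sup>2 = (norm (E z))\<^sup>2"
      unfolding E using norm_add_orthogonal[OF orthocompD(2)[OF in2 in1], of z z] by (simp add: blinfun.add_left)
    also have "e\<^sup>2 * (norm (E z))\<^sup>2 \<le> e\<^sup>2 * (norm z)\<^sup>2"
      unfolding E_def by (intro mult_left_mono power_mono norm_proj_apply_le[OF K]) auto
    finally have "(norm (E1 (D1 (E1 z)) + E2 (D2 (E2 z))))\<^sup>2 \<le> (e * norm z)\<^sup>2"
      by (simp add: power_mult_distrib)
    then have "norm (E1 (D1 (E1 z)) + E2 (D2 (E2 z))) \<le> e * norm z"
      by (rule power2_le_imp_le) (use e in simp)
    then show "norm (((E1 o\<^sub>L D1 o\<^sub>L E1) + (E2 o\<^sub>L D2 o\<^sub>L E2)) z) \<le> e * norm z"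
      by (simp add: blinfun.add_left)
  qed (use e in simp)
  then show ?thesis
    unfolding good_def approx_def E_def[symmetric] using j_core eq by (intro bexI[OF _ j_core]) simp
qed

lemma large_form_if_not_good:
  assumes "M \<in> \<N>" "\<not> good N M"
  shows "\<exists>x\<in>M \<inter> orthocomp N. \<exists>y\<in>M \<inter> orthocomp N. e * norm x * norm y < cmod (cinner (blinfun_apply b x) y)"
proof (rule large_form_if_norm_gt)
  show "e < norm (proj (M \<inter> orthocomp N) o\<^sub>L b o\<^sub>L proj (M \<inter> orthocomp N))"
    using assms(2) approx_of_norm unfolding good_def by (meson not_le)
qed (use e assms in \<open>auto intro: csubspace_diff_space closed_diff_space\<close>)

text \<open>Failure on the interval from \<open>N\<close> to \<open>M\<close> gives a large entry
  there. As the union of \<open>S\<close> is dense in \<open>M\<close>, its vectors can be moved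
  below some larger \<open>N'\<close> in \<open>S\<close>; restarting from \<open>N'\<close> yields
  an increasing sequence.\<close>

lemma factors_left_limit:
  assumes S: "S \<subseteq> \<N>" "S \<noteq> {}" "M = closure (cspan (\<Union>S))" and ng: "\<And>N. N \<in> S \<Longrightarrow> \<not> good N M"
  shows "factors b"
proof -
  have MN: "M \<in> \<N>" using nest_Sup[OF S(1)] S(3) by simp
  have USsub: "csubspace (\<Union>S)"
    unfolding complex_vector.subspace_def
  proof (intro conjI ballI allI)
    show "0 \<in> \<Union>S" using S csubspace_0[OF nest_csubspace] by blast
    show "c *\<^sub>C x \<in> \<Union>S" if "x \<in> \<Union>S" for c x
      using that S csubspace_scale[OF nest_csubspace] by blast
    fix x y assume "x \<in> \<Union>S" "y \<in> \<Union>S"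
    then obtain X Y where XY: "X \<in> S" "Y \<in> S" "x \<in> X" "y \<in> Y" by blast
    then have "X \<union> Y \<in> S" using nest_directed[of X Y] S(1) by (metis subsetD)
    moreover have "x + y \<in> X \<union> Y"
      using XY S(1) \<open>X \<union> Y \<in> S\<close> by (intro csubspace_add nest_csubspace) auto
    ultimately show "x + y \<in> \<Union>S" by blast
  qed
  have M: "M = closure (\<Union>S)"
    unfolding S(3) using USsub by (metis complex_vector.span_eq_iff)
  have step: "\<exists>N'. N' \<in> S \<and> (N \<subseteq> N' \<and> (\<exists>x\<in>N' \<inter> orthocomp N. \<exists>y\<in>N' \<inter> orthocomp N.
      norm x = 1 \<and> norm y = 1 \<and> e < cmod (cinner (blinfun_apply b x) y)))" if N: "N \<in> S" for N
  proof -
    have NN: "N \<in> \<N>" using N S by blast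
    note pN = nest_csubspace[OF NN] nest_closed[OF NN]
    \<comment> \<open>Dense in the interval space: approximate a vector from the union of
      \<open>S\<close> and subtract the projection onto \<open>N\<close>.\<close>
    define D where "D = (\<Union>N'\<in>{N'\<in>S. N \<subseteq> N'}. N' \<inter> orthocomp N)"
    have cl: "M \<inter> orthocomp N \<subseteq> closure D"
    proof
      fix x assume x: "x \<in> M \<inter> orthocomp N"
      then obtain f where f: "\<And>n. f n \<in> \<Union>S" "f \<longlonglongrightarrow> x" unfolding M by (auto simp: closure_sequential)
      have "f n - proj N (f n) \<in> D" for n
      proof -
        obtain X where X: "X \<in> S" "f n \<in> X" using f(1) by blast
        have XN: "X \<union> N \<in> S" using nest_directed[of X N] X N S(1) by (metis subsetD)
        have "f n - proj N (f n) \<in> X \<union> N"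
          using X XN S(1) proj_in[OF pN, of "f n"] by (intro csubspace_diff[OF nest_csubspace]) auto
        then show ?thesis using XN proj_orthocomp[OF pN] unfolding D_def by blast
      qed
      moreover have "(\<lambda>n. f n - proj N (f n)) \<longlonglongrightarrow> x - proj N x"
        by (intro tendsto_intros f)
      moreover have "proj N x = 0" using x proj_zero[OF pN] by blast
      ultimately show "x \<in> closure D" unfolding closure_sequential
        by (intro exI[of _ "\<lambda>n. f n - proj N (f n)"]) simp
    qed
    obtain x y where "x \<in> M \<inter> orthocomp N" "y \<in> M \<inter> orthocomp N"
        "e * norm x * norm y < cmod (cinner (blinfun_apply b x) y)"
      using large_form_if_not_good[OF MN ng[OF N]] by blast
    then obtain x y where xy: "x \<in> D" "y \<in> D" "e * norm x * norm y < cmod (cinner (blinfun_apply b x) y)"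
      using large_form_approx[of x D y e b] cl by blast
    then obtain X Y where XY: "X \<in> S" "N \<subseteq> X" "x \<in> X \<inter> orthocomp N" "Y \<in> S" "N \<subseteq> Y" "y \<in> Y \<inter> orthocomp N"
      unfolding D_def by blast
    define N' where "N' = X \<union> Y"
    have N': "N' \<in> S" using XY nest_directed[of X Y] S(1) unfolding N'_def by (metis subsetD)
    have cs: "csubspace (N' \<inter> orthocomp N)" using N' S(1) by (intro csubspace_diff_space) blast
    have "\<exists>x\<in>N' \<inter> orthocomp N. \<exists>y\<in>N' \<inter> orthocomp N. norm x = 1 \<and> norm y = 1 \<and> e < cmod (cinner (blinfun_apply b x) y)"
      by (rule large_form_normalize[OF b_bounded cs cs _ _ _ xy(3)]) (use XY e in \<open>auto simp: N'_def\<close>)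
    then show ?thesis using N' XY unfolding N'_def by blast
  qed
  obtain N where N: "\<And>n. N n \<in> S" "\<And>n. N n \<subseteq> N (Suc n) \<and> (\<exists>x\<in>N (Suc n) \<inter> orthocomp (N n). \<exists>y\<in>N (Suc n) \<inter> orthocomp (N n).
      norm x = 1 \<and> norm y = 1 \<and> e < cmod (cinner (blinfun_apply b x) y))"
    using dependent_nat_choice[of "\<lambda>n N. N \<in> S" "\<lambda>n N N'. N \<subseteq> N' \<and> (\<exists>x\<in>N' \<inter> orthocomp N. \<exists>y\<in>N' \<inter> orthocomp N.
      norm x = 1 \<and> norm y = 1 \<and> e < cmod (cinner (blinfun_apply b x) y))"] S(2) step by blast
  from N(2) obtain x y where "\<And>n. x n \<in> N (Suc n) \<inter> orthocomp (N n)" "\<And>n. y n \<in> N (Suc n) \<inter> orthocomp (N n)"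
      "\<And>n. norm (x n) = 1" "\<And>n. norm (y n) = 1" "\<And>n. e < cmod (cinner (blinfun_apply b (x n)) (y n))"
    by metis
  then show ?thesis
    by (intro factors_increasing[OF b_Alg e, of N x y]) (use N S(1) in \<open>auto intro: less_imp_le\<close>)
qed

text \<open>Here the lower end of the interval is moved up from \<open>M\<close> to some
  \<open>N'\<close> in \<open>S\<close>, and the construction restarts on the part below
  \<open>N'\<close>, which yields a decreasing sequence.\<close>

lemma factors_right_limit:
  assumes S: "S \<subseteq> \<N>" "S \<noteq> {}" "M = \<Inter>S" and ng: "\<And>N. N \<in> S \<Longrightarrow> \<not> good M N"
  shows "factors b"
proof -
  have MN: "M \<in> \<N>" using nest_Inter[OF S(1)] S(3) by simp
  have step: "\<exists>N'. N' \<in> S \<and> (N' \<subseteq> N \<and> (\<exists>x\<in>N \<inter> orthocomp N'. \<exists>y\<in>N \<inter> orthocomp N'.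
      norm x = 1 \<and> norm y = 1 \<and> e < cmod (cinner (blinfun_apply b x) y)))" if N: "N \<in> S" for N
  proof -
    have NN: "N \<in> \<N>" using N S by blast
    define T where "T = {N'\<in>S. N' \<subseteq> N}"
    define D where "D = (\<Union>N'\<in>T. N \<inter> orthocomp N')"
    have T: "T \<subseteq> S" "N \<in> T" using N by (auto simp: T_def)
    have Dsub: "csubspace D"
      unfolding complex_vector.subspace_def
    proof (intro conjI ballI allI)
      note cs = csubspace_diff_space[OF NN]
      show "0 \<in> D" using T csubspace_0[OF cs] unfolding D_def by blast
      show "c *\<^sub>C x \<in> D" if "x \<in> D" for c x
        using that csubspace_scale[OF cs] unfolding D_def by blast
      fix x y assume "x \<in> D" "y \<in> D"
      then obtain X Y where XY: "X \<in> T" "Y \<in> T" "x \<in> N \<inter> orthocomp X" "y \<in> N \<inter> orthocomp Y" unfolding D_def by blast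
      then have "X \<subseteq> Y \<or> Y \<subseteq> X" using nest_linear T S(1) by blast
      then obtain Z where "Z \<in> T" "x \<in> N \<inter> orthocomp Z" "y \<in> N \<inter> orthocomp Z"
        using XY orthocomp_anti by blast
      then show "x + y \<in> D" using csubspace_add[OF cs] unfolding D_def by blast
    qed
    note cD = csubspace_closure[OF Dsub bounded_linear_scaleC] closed_closure[of D]
    have clN: "closure D \<subseteq> N"
      by (rule closure_minimal) (auto simp: D_def nest_closed[OF NN])
    have clM: "closure D \<subseteq> orthocomp M"
    proof (rule closure_minimal[OF _ closed_orthocomp])
      show "D \<subseteq> orthocomp M" unfolding D_def T_def S(3) using orthocomp_anti[OF Inter_lower[of _ S]] by blast
    qed
    \<comment> \<open>The residual \<open>r\<close> of the projection onto \<open>closure D\<close>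
      lies in every member of \<open>S\<close>: for \<open>N'\<close> below \<open>N\<close>, its
      part \<open>s\<close> orthogonal to \<open>N'\<close> belongs to \<open>D\<close> while
      \<open>r\<close> is orthogonal to \<open>D\<close>, so \<open>s = 0\<close>. Thus
      \<open>r\<close> is in \<open>M\<close> and orthogonal to \<open>M\<close>.\<close>
    have cl: "N \<inter> orthocomp M \<subseteq> closure D"
    proof
      fix x assume x: "x \<in> N \<inter> orthocomp M"
      define r where "r = x - proj (closure D) x"
      have p: "proj (closure D) x \<in> closure D" by (rule proj_in[OF cD])
      have rN: "r \<in> N"
        unfolding r_def using x p clN by (intro csubspace_diff[OF nest_csubspace[OF NN]]) auto
      have rM: "r \<in> orthocomp M"
        unfolding r_def using x p clM by (intro csubspace_diff[OF csubspace_orthocomp]) auto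
      have rD: "r \<in> orthocomp (closure D)" unfolding r_def by (rule proj_orthocomp[OF cD])
      have rT: "r \<in> N'" if N': "N' \<in> T" for N'
      proof -
        have N'N: "N' \<in> \<N>" "N' \<subseteq> N" using N' S(1) by (auto simp: T_def)
        note pN' = nest_csubspace[OF N'N(1)] nest_closed[OF N'N(1)]
        define s where "s = r - proj N' r"
        have "s \<in> N"
          unfolding s_def using rN proj_in[OF pN'] N'N by (intro csubspace_diff[OF nest_csubspace[OF NN]]) auto
        moreover have so: "s \<in> orthocomp N'" unfolding s_def by (rule proj_orthocomp[OF pN'])
        ultimately have "s \<in> closure D" using N' closure_subset[of D] unfolding D_def by blast
        then have "cinner r s = 0" using orthocompD(1)[OF rD] by blast
        moreover have "cinner (proj N' r) s = 0" using orthocompD(2)[OF so proj_in[OF pN']] .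
        moreover have "cinner s s = cinner r s - cinner (proj N' r) s"
          by (subst s_def) (simp add: cinner_simps)
        ultimately have "cinner s s = 0" by simp
        then have "s = 0" by (simp only: cinner_eq_zero_iff)
        then show ?thesis using proj_in[OF pN', of r] by (simp add: s_def)
      qed
      have "r \<in> N'" if N': "N' \<in> S" for N'
      proof (cases "N' \<subseteq> N")
        case True
        then show ?thesis using rT N' by (simp add: T_def)
      next
        case False
        then have "N \<subseteq> N'" using nest_linear NN N' S(1) by blast
        then show ?thesis using rN by blast
      qed
      then have "r \<in> M" using S(3) by blast
      then have "r = 0" using rM orthocomp_Int_self by blast
      then show "x \<in> closure D" using p by (simp add: r_def)
    qed
    obtain x y where "x \<in> N \<inter> orthocomp M" "y \<in> N \<inter> orthocomp M"
        "e * norm x * norm y < cmod (cinner (blinfun_apply b x) y)"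
      using large_form_if_not_good[OF NN ng[OF N]] by blast
    then obtain x y where xy: "x \<in> D" "y \<in> D" "e * norm x * norm y < cmod (cinner (blinfun_apply b x) y)"
      using large_form_approx[of x D y e b] cl by blast
    then obtain X Y where XY: "X \<in> T" "x \<in> N \<inter> orthocomp X" "Y \<in> T" "y \<in> N \<inter> orthocomp Y"
      unfolding D_def by blast
    then have "X \<subseteq> Y \<or> Y \<subseteq> X" using nest_linear T S(1) by blast
    then obtain Z where Z: "Z \<in> T" "x \<in> N \<inter> orthocomp Z" "y \<in> N \<inter> orthocomp Z"
      using XY orthocomp_anti by blast
    note cs = csubspace_diff_space[OF NN, of Z]
    have "\<exists>x\<in>N \<inter> orthocomp Z. \<exists>y\<in>N \<inter> orthocomp Z. norm x = 1 \<and> norm y = 1 \<and> e < cmod (cinner (blinfun_apply b x) y)"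
      by (rule large_form_normalize[OF b_bounded cs cs _ Z(2,3) xy(3)]) (use e in simp)
    then show ?thesis using Z(1) unfolding T_def by blast
  qed
  obtain N where N: "\<And>n. N n \<in> S" "\<And>n. N (Suc n) \<subseteq> N n \<and> (\<exists>x\<in>N n \<inter> orthocomp (N (Suc n)). \<exists>y\<in>N n \<inter> orthocomp (N (Suc n)).
      norm x = 1 \<and> norm y = 1 \<and> e < cmod (cinner (blinfun_apply b x) y))"
    using dependent_nat_choice[of "\<lambda>n N. N \<in> S" "\<lambda>n N N'. N' \<subseteq> N \<and> (\<exists>x\<in>N \<inter> orthocomp N'. \<exists>y\<in>N \<inter> orthocomp N'.
      norm x = 1 \<and> norm y = 1 \<and> e < cmod (cinner (blinfun_apply b x) y))"] S(2) step by blast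
  from N(2) obtain x y where "\<And>n. x n \<in> N n \<inter> orthocomp (N (Suc n))" "\<And>n. y n \<in> N n \<inter> orthocomp (N (Suc n))"
      "\<And>n. norm (x n) = 1" "\<And>n. norm (y n) = 1" "\<And>n. e < cmod (cinner (blinfun_apply b (x n)) (y n))"
    by metis
  then show ?thesis
    by (intro factors_decreasing[OF b_Alg e, of N x y]) (use N S(1) in \<open>auto intro: less_imp_le\<close>)
qed

text \<open>Every nest member either contains the range of \<open>proj L\<close> or is annihilated
  by \<open>proj L\<close>.\<close>

lemma proj_subset_atom_in_Alg:
  assumes K: "\<And>N. N \<in> \<N> \<Longrightarrow> K \<subseteq> N \<or> K \<subseteq> orthocomp N"
    and L: "csubspace L" "closed L" "L \<subseteq> K"
  shows "proj L \<in> Alg"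
  unfolding mem_Alg
proof (intro conjI ballI)
  show "proj L \<in> bounded_operators" by (simp add: bounded_operators_def proj_scaleC[OF L(1,2)])
  fix N x assume N: "N \<in> \<N>" "x \<in> N"
  show "proj L x \<in> N"
  proof (cases "K \<subseteq> N")
    case True
    then show ?thesis using proj_in[OF L(1,2)] L(3) by blast
  next
    case False
    then have "L \<subseteq> orthocomp N" using K[OF N(1)] L(3) by blast
    then have "x \<in> orthocomp L" using N(2) orthocompD(2) by (intro orthocompI) blast
    then show ?thesis using proj_zero[OF L(1,2)] csubspace_0[OF nest_csubspace[OF N(1)]] by simp
  qed
qed

text \<open>Each further orthogonality constraint lowers the projection by an operator of rank at
  most one, whose products with \<open>X\<close> are elementary.\<close>

lemma proj_diff_finite_core:
  assumes K: "\<And>N. N \<in> \<N> \<Longrightarrow> K \<subseteq> N \<or> K \<subseteq> orthocomp N" "csubspace K" "closed K"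
    and W: "finite W" and X: "X \<in> J"
  shows "(proj K - proj (K \<inter> orthocomp W)) o\<^sub>L X \<in> core \<and> X o\<^sub>L (proj K - proj (K \<inter> orthocomp W)) \<in> core"
  using W
proof (induction W rule: finite_induct)
  case empty
  have "K \<inter> orthocomp {} = K" by (simp add: orthocomp_def)
  then show ?case using csubspace_0[OF core_csubspace] by simp
next
  case (insert w W)
  define L where "L = K \<inter> orthocomp W"
  define L' where "L' = K \<inter> orthocomp (insert w W)"
  have L: "csubspace L" "closed L" and L': "csubspace L'" "closed L'"
    unfolding L_def L'_def using K by (auto intro: csubspace_Int csubspace_orthocomp closed_Int closed_orthocomp)
  have sub: "L \<subseteq> K" "L' \<subseteq> K" "L' \<subseteq> L" by (auto simp: L_def L'_def orthocomp_def)
  \<comment> \<open>On \<open>L\<close>, orthogonality to \<open>w\<close> is the same as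
    orthogonality to \<open>w'\<close>, so \<open>proj L - proj L'\<close> has range in the
    multiples of \<open>w'\<close>.\<close>
  define w' where "w' = proj L w"
  have w'L: "w' \<in> L" unfolding w'_def by (rule proj_in[OF L])
  define D where "D = proj L - proj L'"
  have rank: "\<exists>c. D z = c *\<^sub>C w'" for z
  proof -
    define c where "c = cinner (proj L z) w' / cinner w' w'"
    define p where "p = proj L z - c *\<^sub>C w'"
    have pL: "p \<in> L"
      unfolding p_def by (intro csubspace_diff csubspace_scale L proj_in[OF L] w'L)
    have "cinner p w' = 0"
      by (cases "w' = 0") (simp_all add: p_def c_def cinner_simps cinner_eq_zero_iff)
    moreover have "cinner w p = cinner w' p" unfolding w'_def by (rule cinner_proj_left[OF L pL, symmetric])
    ultimately have "cinner p w = 0" using cinner_commute[of p w] cinner_commute[of p w'] by simp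
    then have "p \<in> L'" using pL by (auto simp: L_def L'_def orthocomp_def)
    moreover have "z - p \<in> orthocomp L'"
    proof (rule orthocompI)
      fix u assume u: "u \<in> L'"
      have "cinner (z - proj L z) u = 0" using orthocompD(1)[OF proj_orthocomp[OF L]] u sub by blast
      moreover have "cinner w' u = cinner w u" unfolding w'_def using u sub by (intro cinner_proj_left[OF L]) blast
      moreover have "cinner w u = 0" using u orthocompD(2)[of u "insert w W" w] by (simp add: L'_def)
      ultimately show "cinner (z - p) u = 0" by (simp add: p_def cinner_simps)
    qed
    ultimately have "proj L' z = p" by (rule proj_eq[OF L'])
    then show ?thesis by (auto simp: D_def p_def blinfun.diff_left)
  qed
  have DA: "D \<in> Alg"
    unfolding D_def by (intro diff proj_subset_atom_in_Alg[OF K(1)] L L' sub)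
  have "D o\<^sub>L X \<in> elementary"
    by (rule elementaryI_rank_one[where u = w', OF ideal(1)[OF DA X]]) (simp add: rank)
  moreover have "X o\<^sub>L D \<in> elementary"
  proof -
    have "\<exists>c. (X o\<^sub>L D) z = c *\<^sub>C X w'" for z
      using rank[of z] X J apply_scaleC by (metis blinfun_apply_blinfun_compose subsetD)
    then show ?thesis by (rule elementaryI_rank_one[OF ideal(2)[OF DA X]])
  qed
  ultimately have "D o\<^sub>L X \<in> core" "X o\<^sub>L D \<in> core" using elementary_core by auto
  moreover have "proj K - proj L' = (proj K - proj L) + D" by (simp add: D_def)
  ultimately show ?case
    using insert.IH csubspace_add[OF core_csubspace]
    unfolding L_def[symmetric] L'_def[symmetric] by (simp only: compose_simps)
qed

text \<open>Finitely many orthogonality constraints alter the compression of \<open>b\<close> only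
  by an element of \<open>core\<close>, so large entries remain available. This permits a recursive
  choice of vectors that enforces both orthonormality and triangularity.\<close>

lemma factors_atom_case:
  assumes M: "M \<in> \<N>" and N: "N \<in> \<N>" and atom: "\<And>L. L \<in> \<N> \<Longrightarrow> L \<subseteq> N \<or> M \<subseteq> L"
    and ng: "\<not> good N M"
  shows "factors b"
proof -
  define K where "K = M \<inter> orthocomp N"
  have K: "csubspace K" "closed K" unfolding K_def by (intro csubspace_diff_space closed_diff_space M)+
  have at: "K \<subseteq> L \<or> K \<subseteq> orthocomp L" if "L \<in> \<N>" for L
    using atom[OF that] orthocomp_anti[of L N] unfolding K_def by blast
  have PA: "proj K \<in> Alg" by (rule proj_subset_atom_in_Alg[OF at K]) auto
  have step: "\<exists>x\<in>K \<inter> orthocomp V. \<exists>y\<in>K \<inter> orthocomp W. norm x = 1 \<and> norm y = 1 \<and> e < cmod (cinner (blinfun_apply b x) y)"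
    if fin: "finite V" "finite W" for V W
  proof -
    define P where "P = proj K"
    define PV where "PV = proj (K \<inter> orthocomp V)"
    define PW where "PW = proj (K \<inter> orthocomp W)"
    have cV: "csubspace (K \<inter> orthocomp V)" "closed (K \<inter> orthocomp V)"
      and cW: "csubspace (K \<inter> orthocomp W)" "closed (K \<inter> orthocomp W)"
      using K by (auto intro: csubspace_Int csubspace_orthocomp closed_Int closed_orthocomp)
    have PWA: "PW \<in> Alg" unfolding PW_def by (rule proj_subset_atom_in_Alg[OF at cW]) auto
    have "(P - PW) o\<^sub>L (b o\<^sub>L P) \<in> core"
      unfolding P_def PW_def using proj_diff_finite_core[OF at K fin(2) ideal(2)[OF PA b]] by blast
    moreover have "(PW o\<^sub>L b) o\<^sub>L (P - PV) \<in> core"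
      unfolding P_def PV_def using proj_diff_finite_core[OF at K fin(1) ideal(1)[OF PWA b]] by blast
    ultimately have "((P - PW) o\<^sub>L (b o\<^sub>L P)) + ((PW o\<^sub>L b) o\<^sub>L (P - PV)) \<in> core"
      by (rule csubspace_add[OF core_csubspace])
    then have *: "approx (PW o\<^sub>L b o\<^sub>L PV) \<Longrightarrow> approx ((PW o\<^sub>L b o\<^sub>L PV) + (((P - PW) o\<^sub>L (b o\<^sub>L P)) + ((PW o\<^sub>L b) o\<^sub>L (P - PV))))"
      by (rule approx_add[rotated])
    \<comment> \<open>The sum passes from \<open>PW b PV\<close> through \<open>PW b P\<close> to
      \<open>P b P\<close>. Both increments lie in \<open>core\<close>, so \<open>PW b PV\<close>
      inherits the failure of approximability.\<close>
    have "(PW o\<^sub>L b o\<^sub>L PV) + (((P - PW) o\<^sub>L (b o\<^sub>L P)) + ((PW o\<^sub>L b) o\<^sub>L (P - PV))) = P o\<^sub>L b o\<^sub>L P"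
      by (simp add: compose_simps compose_assoc)
    then have "\<not> approx (PW o\<^sub>L b o\<^sub>L PV)"
      using * ng unfolding good_def P_def K_def by auto
    then have "e < norm (PW o\<^sub>L b o\<^sub>L PV)" using approx_of_norm by (meson not_le)
    then obtain x y where xy: "x \<in> K \<inter> orthocomp V" "y \<in> K \<inter> orthocomp W"
        "e * norm x * norm y < cmod (cinner (blinfun_apply b x) y)"
      using large_form_if_norm_gt[OF cV cW, of e b] e unfolding PV_def PW_def by auto
    show ?thesis
      by (rule large_form_normalize[OF b_bounded cV(1) cW(1) _ xy]) (use e in simp)
  qed
  define P where "P s \<longleftrightarrow> (case s of (V, W, x, y) \<Rightarrow> finite V \<and> finite W \<and> x \<in> K \<inter> orthocomp V \<and> y \<in> K \<inter> orthocomp W \<and>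
      norm x = 1 \<and> norm y = 1 \<and> e < cmod (cinner (blinfun_apply b x) y))" for s
  \<comment> \<open>The state carries the constraints: \<open>V\<close> collects the earlier
    \<open>x\<close>, while \<open>W\<close> collects the earlier \<open>y\<close> and the earlier
    images \<open>b x\<close>, the latter for triangularity.\<close>
  define Q where "Q s s' \<longleftrightarrow> (case s of (V, W, x, y) \<Rightarrow> case s' of (V', W', x', y') \<Rightarrow>
      V' = insert x V \<and> W' = insert y (insert (blinfun_apply b x) W))" for s s' :: "'h set \<times> 'h set \<times> 'h \<times> 'h"
  have "\<exists>s. \<forall>n. P (s n) \<and> Q (s n) (s (Suc n))"
  proof (rule dependent_nat_choice[of "\<lambda>_. P" "\<lambda>_. Q"])
    show "\<exists>x. P x" using step[of "{}" "{}"] by (auto simp: P_def)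
    fix s n assume "P s"
    obtain V W x y where s: "s = (V, W, x, y)" by (cases s) auto
    then have "finite (insert x V)" "finite (insert y (insert (blinfun_apply b x) W))"
      using \<open>P s\<close> by (auto simp: P_def)
    from step[OF this] this show "\<exists>s'. P s' \<and> Q s s'" unfolding P_def Q_def s by (auto simp del: Int_iff)
  qed
  then obtain s where s: "\<And>n. P (s n)" "\<And>n. Q (s n) (s (Suc n))" by blast
  define V where "V n = fst (s n)" for n
  define W where "W n = fst (snd (s n))" for n
  define x where "x n = fst (snd (snd (s n)))" for n
  define y where "y n = snd (snd (snd (s n)))" for n
  have p: "x n \<in> K" "x n \<in> orthocomp (V n)" "y n \<in> K" "y n \<in> orthocomp (W n)" "norm (x n) = 1" "norm (y n) = 1"
    "e < cmod (cinner (blinfun_apply b (x n)) (y n))" for n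
    using s(1)[of n] by (auto simp: P_def V_def W_def x_def y_def split: prod.splits)
  have q: "V (Suc n) = insert (x n) (V n)" "W (Suc n) = insert (y n) (insert (blinfun_apply b (x n)) (W n))" for n
    using s(2)[of n] by (auto simp: Q_def V_def W_def x_def y_def split: prod.splits)
  have V: "x i \<in> V j" and W: "y i \<in> W j \<and> blinfun_apply b (x i) \<in> W j" if "i < j" for i j
    using that by (induction j) (auto simp: q less_Suc_eq)
  show ?thesis
  proof (rule factors_atom[OF b_Alg e at p(1) _ p(3)])
    show "orthonormal x" by (rule orthonormalI_less) (use p orthocompD(2) V in blast)+
    show "orthonormal y" by (rule orthonormalI_less) (use p orthocompD(2) W in blast)+
    show "cinner (blinfun_apply b (x i)) (y j) = 0" if "i < j" for i j
      using orthocompD(2)[OF p(4)[of j]] W[OF that] by blast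
    show "e \<le> cmod (cinner (blinfun_apply b (x n)) (y n))" for n using p(7)[of n] by simp
  qed
qed

text \<open>Let \<open>M\<close> be the supremum of the members reachable from \<open>{0}\<close> by
  a good interval. If \<open>M\<close> is not reachable, merging shows failure on every interval
  ending at \<open>M\<close>. If it is, failure occurs on every interval starting at
  \<open>M\<close>, and \<open>M\<close> is either the infimum of the members above it or has an
  immediate successor.\<close>

lemma factors_if_not_good:
  assumes "\<not> good {0} UNIV"
  shows "factors b"
proof -
  define S where "S = {M \<in> \<N>. good {0} M}"
  have "good {0} {0}"
  proof -
    have "proj ({0} \<inter> orthocomp {0::'h}) = 0"
      using proj_diff_space[OF nest_zero nest_zero] by simp
    then show ?thesis unfolding good_def using e by (intro approx_of_norm) simp
  qed
  then have S: "S \<subseteq> \<N>" "{0} \<in> S" using nest_zero by (auto simp: S_def)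
  have zero: "{0} \<subseteq> M" if "M \<in> \<N>" for M
    using csubspace_0[OF nest_csubspace[OF that]] by simp
  define M where "M = closure (cspan (\<Union>S))"
  have MN: "M \<in> \<N>" unfolding M_def by (rule nest_Sup[OF S(1)])
  have SM: "N \<subseteq> M" if "N \<in> S" for N
    unfolding M_def using that complex_vector.span_superset closure_subset by fastforce
  show ?thesis
  proof (cases "good {0} M")
    case False
    have "\<not> good N M" if "N \<in> S" for N
      using good_merge[OF nest_zero _ MN zero SM[OF that]] that False by (auto simp: S_def)
    then show ?thesis using factors_left_limit[OF S(1) _ M_def] S(2) by blast
  next
    case True
    \<comment> \<open>The members strictly above \<open>M\<close>: a good interval from
      \<open>M\<close> to one of them would merge with the good interval below and place that member
      in \<open>S\<close>.\<close>
    define S2 where "S2 = {L \<in> \<N>. \<not> L \<subseteq> M}"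
    have "M \<noteq> UNIV" using True assms by blast
    then have S2: "S2 \<subseteq> \<N>" "UNIV \<in> S2" using nest_UNIV by (auto simp: S2_def)
    have S2M: "M \<subseteq> L" if "L \<in> S2" for L using that nest_linear MN by (auto simp: S2_def)
    have ng: "\<not> good M L" if L: "L \<in> S2" for L
    proof
      assume "good M L"
      then have "good {0} L" using good_merge[OF nest_zero MN _ zero[OF MN] S2M[OF L] True] L S2 by blast
      then have "L \<in> S" using L S2 by (auto simp: S_def)
      then show False using SM L by (auto simp: S2_def)
    qed
    define M' where "M' = \<Inter>S2"
    have M'N: "M' \<in> \<N>" unfolding M'_def by (rule nest_Inter[OF S2(1)])
    show ?thesis
    proof (cases "M' = M")
      case True
      then show ?thesis using factors_right_limit[OF S2(1) _ _ ng] S2 M'_def by blast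
    next
      case False
      \<comment> \<open>Now \<open>M'\<close> is the immediate successor of \<open>M\<close>, so the
        interval between them is an atom.\<close>
      have "M \<subseteq> M'" unfolding M'_def using S2M by blast
      then have "M' \<in> S2" using False M'N by (auto simp: S2_def)
      then have "\<not> good M M'" by (rule ng)
      moreover have "L \<subseteq> M \<or> M' \<subseteq> L" if "L \<in> \<N>" for L
        using that unfolding M'_def S2_def by blast
      ultimately show ?thesis using factors_atom_case[OF M'N MN] by blast
    qed
  qed
qed

end

lemma factors_if_notin_core:
  assumes "b \<in> J" "b \<notin> core"
  shows "factors b"
proof -
  obtain e where e: "e > 0" "\<And>j. j \<in> core \<Longrightarrow> dist j b \<ge> e"
    using core_closed assms(2) unfolding closed_approachable[OF core_closed, symmetric]
    by (meson not_le closed_approachable[OF core_closed])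
  have "\<not> good b (e / 2) {0} UNIV"
  proof -
    have "orthocomp {0} = (UNIV :: 'h set)" by (auto simp: orthocomp_def)
    then have "proj (UNIV \<inter> orthocomp {0}) = (id_blinfun :: 'h \<Rightarrow>\<^sub>L 'h)"
      by (intro blinfun_eqI) (simp add: proj_id)
    then have "\<exists>j\<in>core. norm (b - j) \<le> e / 2" if "good b (e / 2) {0} UNIV"
      using that e(1) by (simp add: good_def[OF assms(1)] approx_def[OF assms(1)])
    then show ?thesis using e by (fastforce simp: dist_norm norm_minus_commute)
  qed
  then show ?thesis using factors_if_not_good[OF assms(1), of "e / 2"] e(1) by simp
qed

text \<open>For the forward implications on hypocompactness and hypofiniteness it is enough to test
  the quotient by \<open>core\<close>: no nonzero class there is compact or of finite rank.\<close>

lemma properties_iff_subset_core: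
  shows "scattered (op_alg J) \<longleftrightarrow> J \<subseteq> core"
    and "hypocompact (op_alg J) \<longleftrightarrow> J \<subseteq> core"
    and "hypofinite (op_alg J) \<longleftrightarrow> J \<subseteq> core"
proof -
  interpret quotient_by_ideal J core by (rule quotient_by_ideal[OF closed_ideal_core])
  show "scattered (op_alg J) \<longleftrightarrow> J \<subseteq> core"
    using scattered_if factors_if_notin_core not_scattered_if_shift by blast
  have *: "\<not> finite_rank_element quot (coset b) \<and> \<not> compact_element quot (coset b)" if b: "b \<in> J" "b \<notin> core" for b
  proof -
    obtain f g h L R where "shift_data f g h" "L \<in> Alg" "R \<in> Alg" "L o\<^sub>L b o\<^sub>L R = osum (\<lambda>_. 1) g h"
      using factors_if_notin_core[OF b] by blast
    from separated_two_sided_mult[OF b(1) this] obtain X C \<delta> where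
      X: "\<forall>i::nat. X i \<in> J \<and> norm (X i) \<le> C" "\<delta> > 0"
        "\<forall>F c q i. finite F \<longrightarrow> q \<in> core \<longrightarrow> i \<in> F \<longrightarrow>
          \<delta> * cmod (c i) \<le> norm ((\<Sum>i\<in>F. c i *\<^sub>C (b o\<^sub>L X i o\<^sub>L b)) - q)"
      by (elim exE conjE) (rule that)
    show ?thesis
      using not_finite_rank_element[of b X C \<delta>, OF b(1) _ _ X(2)] not_compact_element[of b X C \<delta>, OF b(1) _ _ X(2)]
        X(1) X(3)[rule_format] by (metis (no_types, lifting))
  qed
  have nz: "\<exists>b\<in>J. a = coset b \<and> b \<notin> core" if "a \<in> acarrier quot" "a \<noteq> azero quot" for a
    using that coset_eq_zero_iff by (auto simp: quot_carrier)
  show "hypocompact (op_alg J) \<longleftrightarrow> J \<subseteq> core"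
  proof
    assume h: "hypocompact (op_alg J)"
    show "J \<subseteq> core"
    proof (rule ccontr)
      assume "\<not> J \<subseteq> core"
      then have "core \<noteq> acarrier (op_alg J)" by auto
      then obtain a where "compact_element quot a" "a \<noteq> azero quot"
        using h closed_ideal_core unfolding hypocompact_def by blast
      then show False using nz[of a] * by (auto simp: compact_element_def)
    qed
  qed (rule hypofinite_hypocompact_if)
  show "hypofinite (op_alg J) \<longleftrightarrow> J \<subseteq> core"
  proof
    assume h: "hypofinite (op_alg J)"
    show "J \<subseteq> core"
    proof (rule ccontr)
      assume "\<not> J \<subseteq> core"
      then have "core \<noteq> acarrier (op_alg J)" by auto
      then obtain a where "finite_rank_element quot a" "a \<noteq> azero quot"
        using h closed_ideal_core unfolding hypofinite_def by blast
      then show False using nz[of a] * by (auto simp: finite_rank_element_def)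
    qed
  qed (rule hypofinite_hypocompact_if)
qed

end

section \<open>Comparison of the three radicals\<close>

lemma radical_properties_equivalent:
  assumes "nest \<N>" and J: "closed_ideal (nest_algebra \<N>) J"
  shows "hypofinite (ideal_algebra (nest_algebra \<N>) J) \<longleftrightarrow> hypocompact (ideal_algebra (nest_algebra \<N>) J)"
    and "hypocompact (ideal_algebra (nest_algebra \<N>) J) \<longleftrightarrow> scattered (ideal_algebra (nest_algebra \<N>) J)"
proof -
  interpret nest_alg \<N> by standard (rule assms)
  have ideal_eq: "ideal_algebra (nest_algebra \<N>) J = op_alg J"
    by (metis nest_algebra_eq_op_alg ideal_algebra_op_alg)
  have "closed_ideal (op_alg Alg) J" using J nest_algebra_eq_op_alg by metis
  then interpret nest_ideal \<N> J
    by unfold_locales (auto simp: closed_ideal_op_alg[OF closed])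
  show "hypofinite (ideal_algebra (nest_algebra \<N>) J) \<longleftrightarrow> hypocompact (ideal_algebra (nest_algebra \<N>) J)"
    "hypocompact (ideal_algebra (nest_algebra \<N>) J) \<longleftrightarrow> scattered (ideal_algebra (nest_algebra \<N>) J)"
    unfolding ideal_eq using properties_iff_subset_core by blast+
qed

theorem corollary2p6:
  fixes \<N> :: "'h::chilbert_space set set"
  assumes "nest \<N>"
  shows "hypofinite_radical (nest_algebra \<N>) = hypocompact_radical (nest_algebra \<N>) \<and>
         hypocompact_radical (nest_algebra \<N>) = scattered_radical (nest_algebra \<N>)"
proof -
  \<comment> \<open>The predicates agree on every candidate set, so the three definite descriptions
    have equal values.\<close>
  have "is_largest_ideal hypofinite (nest_algebra \<N>) = is_largest_ideal hypocompact (nest_algebra \<N>)"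
    "is_largest_ideal hypocompact (nest_algebra \<N>) = is_largest_ideal scattered (nest_algebra \<N>)"
    unfolding is_largest_ideal_def fun_eq_iff using radical_properties_equivalent[OF assms] by blast+
  then show ?thesis
    unfolding hypofinite_radical_def hypocompact_radical_def scattered_radical_def by simp
qed

end
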